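(* Let $f>0$ and $\nu>0$. The spectrum of the operator $\mathscr{L}:\mathcal{D}(\mathscr{L})\to[L^2(\mathbb{R}^3)]^3$ defined in the context consists entirely of continuous spectrum.
   Context: Points of $\mathbb{R}^3$ are written $\mathbf{x}=(x,y,z)$. Let $$\mathscr{L}=\begin{pmatrix}\nu\Delta-y\partial_x+f\Delta^{-1}\partial_{xy} & f-1+(2-f)\Delta^{-1}\partial_x^2 & 0\\ -f+f\Delta^{-1}\partial_y^2 & \nu\Delta-y\partial_x+(2-f)\Delta^{-1}\partial_{xy} & 0\\ f\Delta^{-1}\partial_{yz} & (2-f)\Delta^{-1}\partial_{xz} & \nu\Delta-y\partial_x\end{pmatrix}$$ with domain $\mathcal{D}(\mathscr{L})=\{\mathbf{u}\in[L^2(\mathbb{R}^3)]^3:\ \nu\Delta\mathbf{u},\ y\partial_x\mathbf{u}\in[L^2(\mathbb{R}^3)]^3\}$, acting on complex-valued fields, where $\Delta^{-1}\partial_j\partial_k$ is the Fourier multiplier with symbol $\xi_j\xi_k/|\boldsymbol{\xi}|^2$. "Consists entirely of continuous spectrum" means that for every $\lambda\in\sigma(\mathscr{L})$ the operator $\lambda-\mathscr{L}$ is injective with dense range (no point spectrum and no residual spectrum). *)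

theory Defs
  imports "HOL-Analysis.Analysis"
begin

text \<open>
  Elements of \<open>L\<^sup>2\<close> are represented by Borel measurable functions. Equality in \<open>L\<^sup>2\<close> is
  almost-everywhere equality and is written out as such; all notions below respect it.
\<close>

definition L2 :: "(real^3 \<Rightarrow> 'b::euclidean_space) set" where
  "L2 = {u. u \<in> borel_measurable lborel \<and> integrable lborel (\<lambda>x. (norm (u x))\<^sup>2)}"

text \<open>Meaningful on \<^const>\<open>L2\<close> only.\<close>

definition L2_norm :: "(real^3 \<Rightarrow> 'b::euclidean_space) \<Rightarrow> real" where
  "L2_norm u = sqrt (\<integral>x. (norm (u x))\<^sup>2 \<partial>lborel)"

subsection \<open>Weak derivatives\<close>

definition partial_deriv :: "3 \<Rightarrow> (real^3 \<Rightarrow> complex) \<Rightarrow> real^3 \<Rightarrow> complex" where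
  "partial_deriv j \<phi> x = frechet_derivative \<phi> (at x) (axis j 1)"

text \<open>
  All iterated partial derivatives are (totally) differentiable, hence continuous, so this is
  the class of compactly supported \<open>C\<^sup>\<infinity>\<close> functions.
\<close>

definition test_functions :: "(real^3 \<Rightarrow> complex) set" where
  "test_functions = {\<phi>. (\<forall>js x. foldr partial_deriv js \<phi> differentiable (at x)) \<and>
                        compact (closure {x. \<phi> x \<noteq> 0})}"

definition laplacian :: "(real^3 \<Rightarrow> complex) \<Rightarrow> real^3 \<Rightarrow> complex" where
  "laplacian \<phi> x = (\<Sum>j\<in>UNIV. partial_deriv j (partial_deriv j \<phi>) x)"

text \<open>
  \<open>g \<in> L\<^sup>2\<close> represents the distribution \<open>\<Delta>u\<close>, respectively \<open>y \<partial>\<^sub>x u\<close>; since \<open>y\<close> does not depend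
  on \<open>x\<close>, the formal transpose of \<open>y \<partial>\<^sub>x\<close> is \<open>- y \<partial>\<^sub>x\<close>.
\<close>

definition is_weak_laplacian :: "(real^3 \<Rightarrow> complex) \<Rightarrow> (real^3 \<Rightarrow> complex) \<Rightarrow> bool" where
  "is_weak_laplacian u g \<longleftrightarrow> g \<in> L2 \<and>
     (\<forall>\<phi>\<in>test_functions. (\<integral>x. g x * \<phi> x \<partial>lborel) = (\<integral>x. u x * laplacian \<phi> x \<partial>lborel))"

definition is_weak_shear :: "(real^3 \<Rightarrow> complex) \<Rightarrow> (real^3 \<Rightarrow> complex) \<Rightarrow> bool" where
  "is_weak_shear u g \<longleftrightarrow> g \<in> L2 \<and>
     (\<forall>\<phi>\<in>test_functions. (\<integral>x. g x * \<phi> x \<partial>lborel) =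
        - (\<integral>x. u x * (complex_of_real (x $ 2) * partial_deriv 1 \<phi> x) \<partial>lborel))"

text \<open>
  The represented classes are unique; the choice below only selects a representative. If no
  representative exists the value is unspecified, which does not occur on the domain of the
  operator defined below.
\<close>

definition weak_laplacian :: "(real^3 \<Rightarrow> complex) \<Rightarrow> real^3 \<Rightarrow> complex" where
  "weak_laplacian u = (SOME g. is_weak_laplacian u g)"

definition weak_shear :: "(real^3 \<Rightarrow> complex) \<Rightarrow> real^3 \<Rightarrow> complex" where
  "weak_shear u = (SOME g. is_weak_shear u g)"

subsection \<open>Fourier multipliers\<close>

text \<open>
  The Fourier--Plancherel transform: \<open>F\<close> is the limit in \<open>L\<^sup>2\<close>, as \<open>R \<rightarrow> \<infinity>\<close>, of the Fourier
  integrals of \<open>u\<close> truncated to the ball of radius \<open>R\<close>. The convergence is stated with the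
  nonnegative integral, which unlike the Bochner integral does not vanish on non-integrable
  arguments.
\<close>

definition is_fourier :: "(real^3 \<Rightarrow> complex) \<Rightarrow> (real^3 \<Rightarrow> complex) \<Rightarrow> bool" where
  "is_fourier u F \<longleftrightarrow> u \<in> L2 \<and> F \<in> L2 \<and>
     ((\<lambda>R::real. \<integral>\<^sup>+\<xi>. ennreal ((cmod (F \<xi> -
          (LINT x:cball 0 R|lborel. exp (- \<i> * complex_of_real (x \<bullet> \<xi>)) * u x)))\<^sup>2) \<partial>lborel)
        \<longlongrightarrow> 0) at_top"

definition is_multiplier :: "(real^3 \<Rightarrow> complex) \<Rightarrow> (real^3 \<Rightarrow> complex) \<Rightarrow> (real^3 \<Rightarrow> complex) \<Rightarrow> bool" where
  "is_multiplier m u g \<longleftrightarrow> (\<exists>F. is_fourier u F \<and> is_fourier g (\<lambda>\<xi>. m \<xi> * F \<xi>))"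

definition multiplier :: "(real^3 \<Rightarrow> complex) \<Rightarrow> (real^3 \<Rightarrow> complex) \<Rightarrow> real^3 \<Rightarrow> complex" where
  "multiplier m u = (SOME g. is_multiplier m u g)"

text \<open>
  \<open>\<Delta>\<^sup>-\<^sup>1 \<partial>\<^sub>j \<partial>\<^sub>k\<close>. The value of the symbol at the origin, a null set, is immaterial.
\<close>

definition riesz2 :: "3 \<Rightarrow> 3 \<Rightarrow> (real^3 \<Rightarrow> complex) \<Rightarrow> real^3 \<Rightarrow> complex" where
  "riesz2 j k = multiplier (\<lambda>\<xi>. complex_of_real (\<xi> $ j * \<xi> $ k / (norm \<xi>)\<^sup>2))"

subsection \<open>The operator\<close>

text \<open>
  For \<open>\<nu> > 0\<close> the condition \<open>\<nu>\<Delta>u \<in> L\<^sup>2\<close> is \<open>\<Delta>u \<in> L\<^sup>2\<close>, so the domain carries no parameter.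
\<close>

definition Ldom :: "(real^3 \<Rightarrow> complex^3) set" where
  "Ldom = {u \<in> L2. \<forall>i. (\<exists>g. is_weak_laplacian (\<lambda>x. u x $ i) g) \<and>
                       (\<exists>g. is_weak_shear (\<lambda>x. u x $ i) g)}"

definition advection_diffusion :: "real \<Rightarrow> (real^3 \<Rightarrow> complex) \<Rightarrow> real^3 \<Rightarrow> complex" where
  "advection_diffusion \<nu> v x = complex_of_real \<nu> * weak_laplacian v x - weak_shear v x"

definition Lop :: "real \<Rightarrow> real \<Rightarrow> (real^3 \<Rightarrow> complex^3) \<Rightarrow> real^3 \<Rightarrow> complex^3" where
  "Lop f \<nu> u x =
    (let u1 = (\<lambda>x. u x $ 1); u2 = (\<lambda>x. u x $ 2); u3 = (\<lambda>x. u x $ 3);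
         A = advection_diffusion \<nu>; a = complex_of_real f; b = complex_of_real (2 - f)
     in vector
       [(A u1 x + a * riesz2 1 2 u1 x) + ((a - 1) * u2 x + b * riesz2 1 1 u2 x),
        (- a * u1 x + a * riesz2 2 2 u1 x) + (A u2 x + b * riesz2 1 2 u2 x),
        a * riesz2 2 3 u1 x + b * riesz2 1 3 u2 x + A u3 x])"

subsection \<open>Spectral notions for an operator \<open>T\<close> with domain \<open>D\<close> in \<open>[L\<^sup>2]\<^sup>3\<close>\<close>

definition L2_injective ::
    "(real^3 \<Rightarrow> complex^3) set \<Rightarrow> ((real^3 \<Rightarrow> complex^3) \<Rightarrow> real^3 \<Rightarrow> complex^3) \<Rightarrow> bool" where
  "L2_injective D T \<longleftrightarrow>
     (\<forall>u\<in>D. \<forall>v\<in>D. (AE x in lborel. T u x = T v x) \<longrightarrow> (AE x in lborel. u x = v x))"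

definition L2_range ::
    "(real^3 \<Rightarrow> complex^3) set \<Rightarrow> ((real^3 \<Rightarrow> complex^3) \<Rightarrow> real^3 \<Rightarrow> complex^3) \<Rightarrow>
      (real^3 \<Rightarrow> complex^3) set" where
  "L2_range D T = {g \<in> L2. \<exists>u\<in>D. AE x in lborel. T u x = g x}"

definition L2_dense :: "(real^3 \<Rightarrow> complex^3) set \<Rightarrow> bool" where
  "L2_dense S \<longleftrightarrow> (\<forall>g\<in>L2. \<forall>\<epsilon>>0. \<exists>h\<in>S. L2_norm (\<lambda>x. h x - g x) < \<epsilon>)"

definition L2_bounded_inverse ::
    "(real^3 \<Rightarrow> complex^3) set \<Rightarrow> ((real^3 \<Rightarrow> complex^3) \<Rightarrow> real^3 \<Rightarrow> complex^3) \<Rightarrow> bool" where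
  "L2_bounded_inverse D T \<longleftrightarrow> L2_injective D T \<and> L2_range D T = L2 \<and>
     (\<exists>C. \<forall>u\<in>D. \<forall>g\<in>L2. (AE x in lborel. T u x = g x) \<longrightarrow> L2_norm u \<le> C * L2_norm g)"

definition shifted ::
    "complex \<Rightarrow> ((real^3 \<Rightarrow> complex^3) \<Rightarrow> real^3 \<Rightarrow> complex^3) \<Rightarrow>
      (real^3 \<Rightarrow> complex^3) \<Rightarrow> real^3 \<Rightarrow> complex^3" where
  "shifted \<mu> T u = (\<lambda>x. \<mu> *s u x - T u x)"

definition L2_spectrum ::
    "(real^3 \<Rightarrow> complex^3) set \<Rightarrow> ((real^3 \<Rightarrow> complex^3) \<Rightarrow> real^3 \<Rightarrow> complex^3) \<Rightarrow> complex set" where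
  "L2_spectrum D T = {\<mu>. \<not> L2_bounded_inverse D (shifted \<mu> T)}"

end

theory Submission
  imports Defs "HOL-Probability.Characteristic_Functions"
begin

text \<open>
  Fix \<open>\<mu>\<close>. In Fourier variables \<open>\<xi> = (\<xi>\<^sub>1, \<xi>\<^sub>2, \<xi>\<^sub>3)\<close> the term \<open>- y \<partial>\<^sub>x\<close> becomes \<open>\<xi>\<^sub>1 \<partial>\<^sub>2\<close>, the Laplacian becomes
  \<open>- |\<xi>|\<^sup>2\<close>, and the remaining terms become multiplication by a bounded matrix \<open>M(\<xi>)\<close>. The equation
  \<open>(\<mu> - \<L>) u = 0\<close> is then, with \<open>U\<close> the transform of \<open>u\<close>, a family of linear ordinary differential
  equations in \<open>\<xi>\<^sub>2\<close>,
  \<open>\<xi>\<^sub>1 \<partial>\<^sub>2 U = (\<mu> + \<nu> |\<xi>|\<^sup>2 - M) U\<close>.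
  For \<open>\<xi>\<^sub>1 \<noteq> 0\<close> the factor \<open>\<nu> \<xi>\<^sub>2\<^sup>2\<close> forces every nonzero solution to grow like
  \<open>exp (\<nu> |\<xi>\<^sub>2|\<^sup>3 / 3 |\<xi>\<^sub>1|)\<close> towards the end where \<open>\<xi>\<^sub>1 \<xi>\<^sub>2 > 0\<close>, so none is square integrable: the operator is
  injective. A field orthogonal to the range solves the adjoint equation, which has the opposite sign
  and the transposed matrix; its solutions grow towards the other end, so it vanishes too and the
  range is dense.

  Both statements are instances of \<open>shear_diffusion_uniqueness\<close>, with a sign \<open>\<sigma> = 1\<close> or \<open>\<sigma> = -1\<close>. It is
  proved for weak solutions by an energy estimate instead of solving the equations: the identity
  \<open>2 Re (\<xi>\<^sub>1 \<partial>\<^sub>2 U \<cdot> cnj U) = \<xi>\<^sub>1 \<partial>\<^sub>2 |U|\<^sup>2\<close>, integrated against a bounded weight whose variation along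
  the characteristics compensates where \<open>\<nu> \<xi>\<^sub>2\<^sup>2\<close> is too small to dominate (\<open>bounded_shear_weight\<close>), shows
  that a weighted norm of \<open>U\<close> is zero. The identity for weak derivatives (\<open>shear_energy_identity\<close>) comes from
  difference quotients along the group of shears \<open>\<xi> \<mapsto> (\<xi>\<^sub>1, \<xi>\<^sub>2 + t \<xi>\<^sub>1, \<xi>\<^sub>3)\<close>, which preserves volume and
  has \<open>\<xi>\<^sub>1 \<partial>\<^sub>2\<close> as generator.

  The passage to Fourier variables rests on the Plancherel theorem (\<open>plancherel_L1_L2\<close>,
  \<open>fourier_exists\<close>, \<open>fourier_inversion\<close>); it also guarantees that the multipliers in \<open>\<L>\<close> are defined on
  all of \<open>L\<^sup>2\<close>. Weak derivatives are transported by testing with Fourier transforms of test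
  functions (\<open>weak_laplacian_FT\<close>, \<open>weak_shear_FT\<close>). Underneath lie the completeness of \<open>L\<^sup>2\<close>, orthogonal
  projection, and the density of test functions.
\<close>

section \<open>The space of square-integrable fields\<close>

lemma L2_D:
  assumes "u \<in> L2"
  shows "u \<in> borel_measurable lborel" "integrable lborel (\<lambda>x. (norm (u x))\<^sup>2)"
    "u \<in> borel_measurable borel"
  using assms by (auto simp: L2_def)

lemma L2_I:
  assumes "u \<in> borel_measurable lborel" "integrable lborel (\<lambda>x. (norm (u x))\<^sup>2)"
  shows "u \<in> L2"
  using assms by (auto simp: L2_def)

lemma L2_dominated:
  assumes u: "u \<in> L2" and v: "v \<in> borel_measurable lborel"
    and le: "\<And>x. norm (v x) \<le> C * norm (u x)"
  shows "v \<in> L2"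
proof (rule L2_I[OF v])
  have "integrable lborel (\<lambda>x. C\<^sup>2 * (norm (u x))\<^sup>2)"
    using L2_D(2)[OF u] by simp
  then show "integrable lborel (\<lambda>x. (norm (v x))\<^sup>2)"
  proof (rule Bochner_Integration.integrable_bound)
    show "AE x in lborel. norm ((norm (v x))\<^sup>2) \<le> norm (C\<^sup>2 * (norm (u x))\<^sup>2)"
      using power_mono[OF le norm_ge_zero, where n = 2] by (simp add: power_mult_distrib)
  qed (use v in measurable)
qed

lemma L2_zero [simp]: "(\<lambda>x. 0) \<in> L2"
  by (auto simp: L2_def)

lemma L2_scaleR: "u \<in> L2 \<Longrightarrow> (\<lambda>x. c *\<^sub>R u x) \<in> L2"
  by (rule L2_dominated[where C = "\<bar>c\<bar>"]) (auto simp: L2_def)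

lemma L2_cmult: "u \<in> L2 \<Longrightarrow> (\<lambda>x. (c::complex) * u x) \<in> L2"
  by (rule L2_dominated[where C = "cmod c"]) (auto simp: L2_def norm_mult)

lemma L2_minus: "u \<in> L2 \<Longrightarrow> (\<lambda>x. - u x) \<in> L2"
  by (rule L2_dominated[where C = 1]) (auto simp: L2_def)

lemma L2_cnj: "u \<in> L2 \<Longrightarrow> (\<lambda>x. cnj (u x)) \<in> L2"
  by (rule L2_dominated[where C = 1])
    (auto simp: L2_def intro!: borel_measurable_continuous_on[where f = cnj] continuous_intros)

lemma L2_mult_bounded:
  assumes "u \<in> L2" "m \<in> borel_measurable borel" "\<And>x. cmod (m x) \<le> C"
  shows "(\<lambda>x. m x * u x) \<in> L2"
  using assms(1)
  by (rule L2_dominated[where C = C])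
    (use assms in \<open>auto simp: L2_def norm_mult intro!: mult_right_mono\<close>)

lemma L2_add:
  assumes u: "u \<in> L2" and v: "v \<in> L2"
  shows "(\<lambda>x. u x + v x) \<in> L2"
proof (rule L2_I)
  show "(\<lambda>x. u x + v x) \<in> borel_measurable lborel"
    using u v by (auto simp: L2_def)
  have "(norm (u x + v x))\<^sup>2 \<le> 2 * (norm (u x))\<^sup>2 + 2 * (norm (v x))\<^sup>2" for x
  proof -
    have "(norm (u x + v x))\<^sup>2 \<le> (norm (u x) + norm (v x))\<^sup>2"
      by (intro power_mono norm_triangle_ineq) auto
    also have "\<dots> \<le> 2 * (norm (u x))\<^sup>2 + 2 * (norm (v x))\<^sup>2"
      using sum_squares_bound[of "norm (u x)" "norm (v x)"] by (simp add: power2_sum)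
    finally show ?thesis .
  qed
  then have "AE x in lborel. norm ((norm (u x + v x))\<^sup>2)
      \<le> norm (2 * (norm (u x))\<^sup>2 + 2 * (norm (v x))\<^sup>2)"
    by simp
  moreover have "integrable lborel (\<lambda>x. 2 * (norm (u x))\<^sup>2 + 2 * (norm (v x))\<^sup>2)"
    using L2_D(2)[OF u] L2_D(2)[OF v] by simp
  moreover have "(\<lambda>x. (norm (u x + v x))\<^sup>2) \<in> borel_measurable lborel"
    using L2_D(1)[OF u] L2_D(1)[OF v] by simp
  ultimately show "integrable lborel (\<lambda>x. (norm (u x + v x))\<^sup>2)"
    by (rule Bochner_Integration.integrable_bound[rotated 2])
qed

lemma L2_diff: "u \<in> L2 \<Longrightarrow> v \<in> L2 \<Longrightarrow> (\<lambda>x. u x - v x) \<in> L2"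
  using L2_add[OF _ L2_minus] by fastforce

lemma L2_sum: "(\<And>i. i \<in> I \<Longrightarrow> u i \<in> L2) \<Longrightarrow> (\<lambda>x. \<Sum>i\<in>I. u i x) \<in> L2"
  by (induction I rule: infinite_finite_induct) (auto intro: L2_add)

lemma L2_AE_cong:
  assumes "u \<in> L2" "v \<in> borel_measurable lborel" "AE x in lborel. u x = v x"
  shows "v \<in> L2"
proof (rule L2_I)
  show "integrable lborel (\<lambda>x. (norm (v x))\<^sup>2)"
    using L2_D[OF assms(1)] assms
    by (subst integrable_cong_AE[where g = "\<lambda>x. (norm (u x))\<^sup>2"]) auto
qed (fact assms)

lemma L2_norm_nonneg [simp]: "0 \<le> L2_norm u"
  by (simp add: L2_norm_def)

lemma L2_norm_power2: "(L2_norm u)\<^sup>2 = (\<integral>x. (norm (u x))\<^sup>2 \<partial>lborel)"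
  by (simp add: L2_norm_def)

lemma L2_norm_AE_cong:
  assumes "u \<in> borel_measurable lborel" "v \<in> borel_measurable lborel"
    "AE x in lborel. u x = v x"
  shows "L2_norm u = L2_norm v"
  unfolding L2_norm_def
  by (intro arg_cong[where f = sqrt] integral_cong_AE) (use assms in auto)

lemma L2_norm_eq_0:
  assumes "u \<in> L2" shows "L2_norm u = 0 \<longleftrightarrow> (AE x in lborel. u x = 0)"
  using integral_nonneg_eq_0_iff_AE[OF L2_D(2)[OF assms]] by (simp add: L2_norm_def)

lemma L2_norm_cnj: "L2_norm (\<lambda>x. cnj (u x)) = L2_norm u"
  by (simp add: L2_norm_def)

lemma integral_mult_cnj: "(\<integral>x. u x * cnj (u x) \<partial>lborel) = complex_of_real ((L2_norm u)\<^sup>2)"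
proof -
  have "(\<integral>x. u x * cnj (u x) \<partial>lborel) = (\<integral>x. complex_of_real ((cmod (u x))\<^sup>2) \<partial>lborel)"
    using complex_norm_square by (intro Bochner_Integration.integral_cong) auto
  then show ?thesis by (simp only: integral_complex_of_real L2_norm_power2)
qed

lemma L2_norm_zero [simp]: "L2_norm (\<lambda>x. 0) = 0"
  by (simp add: L2_norm_def)

lemma L2_norm_minus: "L2_norm (\<lambda>x. - u x) = L2_norm u"
  by (simp add: L2_norm_def)

lemma L2_norm_commute: "L2_norm (\<lambda>x. u x - v x) = L2_norm (\<lambda>x. v x - u x)"
  by (simp add: L2_norm_def norm_minus_commute)

lemma L2_norm_scaleR: "L2_norm (\<lambda>x. c *\<^sub>R u x) = \<bar>c\<bar> * L2_norm u"
  by (simp add: L2_norm_def power_mult_distrib real_sqrt_mult)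

lemma L2_norm_cmult: "L2_norm (\<lambda>x. (c::complex) * u x) = cmod c * L2_norm u"
  by (simp add: L2_norm_def norm_mult power_mult_distrib real_sqrt_mult)

lemma L2_norm_mono:
  assumes "u \<in> L2" "v \<in> borel_measurable lborel" "\<And>x. norm (v x) \<le> norm (u x)"
  shows "L2_norm v \<le> L2_norm u"
  unfolding L2_norm_def
  using L2_dominated[OF assms(1,2), of 1] assms
  by (intro real_sqrt_le_mono integral_mono) (auto simp: L2_def)

lemma integrable_norm_mult:
  assumes u: "u \<in> L2" and v: "v \<in> L2"
  shows "integrable lborel (\<lambda>x. norm (u x) * norm (v x))"
proof (rule Bochner_Integration.integrable_bound
    [where f = "\<lambda>x. (norm (u x))\<^sup>2 + (norm (v x))\<^sup>2"])
  show "AE x in lborel. norm (norm (u x) * norm (v x)) \<le> norm ((norm (u x))\<^sup>2 + (norm (v x))\<^sup>2)"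
  proof (rule AE_I2)
    fix x
    have "0 \<le> norm (u x) * norm (v x)" by simp
    then show "norm (norm (u x) * norm (v x)) \<le> norm ((norm (u x))\<^sup>2 + (norm (v x))\<^sup>2)"
      using sum_squares_bound[of "norm (u x)" "norm (v x)"]
      unfolding real_norm_def abs_of_nonneg[OF \<open>0 \<le> norm (u x) * norm (v x)\<close>] by linarith
  qed
qed (use L2_D[OF u] L2_D[OF v] in auto)

lemma Cauchy_Schwarz_norm:
  assumes u: "u \<in> L2" and v: "v \<in> L2"
  shows "(\<integral>x. norm (u x) * norm (v x) \<partial>lborel) \<le> L2_norm u * L2_norm v"
proof -
  let ?I = "\<integral>x. norm (u x) * norm (v x) \<partial>lborel"
  note i = integrable_norm_mult[OF u v] L2_D(2)[OF u] L2_D(2)[OF v]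
  \<comment> \<open>nonnegativity of the quadratic polynomial \<open>s \<mapsto> \<integral>(s|u| - t|v|)\<^sup>2\<close>\<close>
  have *: "2 * s * t * ?I \<le> s\<^sup>2 * (L2_norm u)\<^sup>2 + t\<^sup>2 * (L2_norm v)\<^sup>2" for s t :: real
  proof -
    have "2 * s * t * ?I = (\<integral>x. 2 * s * t * (norm (u x) * norm (v x)) \<partial>lborel)"
      by simp
    also have "\<dots> \<le> (\<integral>x. s\<^sup>2 * (norm (u x))\<^sup>2 + t\<^sup>2 * (norm (v x))\<^sup>2 \<partial>lborel)"
    proof (rule integral_mono)
      fix x
      show "2 * s * t * (norm (u x) * norm (v x)) \<le> s\<^sup>2 * (norm (u x))\<^sup>2 + t\<^sup>2 * (norm (v x))\<^sup>2"
        using sum_squares_bound[of "s * norm (u x)" "t * norm (v x)"]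
        by (simp add: power_mult_distrib mult_ac)
    qed (use i in auto)
    also have "\<dots> = s\<^sup>2 * (L2_norm u)\<^sup>2 + t\<^sup>2 * (L2_norm v)\<^sup>2"
      using i by (simp add: L2_norm_power2)
    finally show ?thesis .
  qed
  show ?thesis
  proof (cases "L2_norm u = 0 \<or> L2_norm v = 0")
    case True
    then have "AE x in lborel. norm (u x) * norm (v x) = 0"
      using L2_norm_eq_0[OF u] L2_norm_eq_0[OF v] by auto
    then have "?I = 0" by (rule integral_eq_zero_AE)
    then show ?thesis by simp
  next
    case False
    then have p: "L2_norm u > 0" "L2_norm v > 0"
      using L2_norm_nonneg[of u] L2_norm_nonneg[of v] by linarith+
    have "2 * (L2_norm u * L2_norm v) * ?I \<le> 2 * (L2_norm u * L2_norm v) * (L2_norm u * L2_norm v)"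
      using *[of "L2_norm v" "L2_norm u"] by (simp add: power2_eq_square mult_ac)
    then show ?thesis
      using p by (subst (asm) mult_le_cancel_left_pos) auto
  qed
qed

lemma integrable_mult_L2:
  fixes u v :: "real^3 \<Rightarrow> complex"
  assumes "u \<in> L2" "v \<in> L2"
  shows "integrable lborel (\<lambda>x. u x * v x)"
  by (rule Bochner_Integration.integrable_bound[OF integrable_norm_mult[OF assms]])
    (use L2_D[OF assms(1)] L2_D[OF assms(2)] in \<open>auto simp: norm_mult\<close>)

lemma integrable_inner_L2:
  assumes "u \<in> L2" "v \<in> L2"
  shows "integrable lborel (\<lambda>x. u x \<bullet> v x)"
  by (rule Bochner_Integration.integrable_bound[OF integrable_norm_mult[OF assms]])
    (use L2_D[OF assms(1)] L2_D[OF assms(2)] in \<open>auto simp: Cauchy_Schwarz_ineq2\<close>)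

lemma Cauchy_Schwarz_mult:
  fixes u v :: "real^3 \<Rightarrow> complex"
  assumes "u \<in> L2" "v \<in> L2"
  shows "cmod (\<integral>x. u x * v x \<partial>lborel) \<le> L2_norm u * L2_norm v"
  using integral_norm_bound[of lborel "\<lambda>x. u x * v x"] Cauchy_Schwarz_norm[OF assms]
  by (simp add: norm_mult)

lemma Cauchy_Schwarz_inner:
  assumes "u \<in> L2" "v \<in> L2"
  shows "\<bar>\<integral>x. u x \<bullet> v x \<partial>lborel\<bar> \<le> L2_norm u * L2_norm v"
proof -
  have "\<bar>\<integral>x. u x \<bullet> v x \<partial>lborel\<bar> \<le> (\<integral>x. \<bar>u x \<bullet> v x\<bar> \<partial>lborel)"
    using integral_norm_bound[of lborel "\<lambda>x. u x \<bullet> v x"] by simp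
  also have "\<dots> \<le> (\<integral>x. norm (u x) * norm (v x) \<partial>lborel)"
    by (intro integral_mono integrable_abs integrable_inner_L2 integrable_norm_mult assms
        Cauchy_Schwarz_ineq2)
  finally show ?thesis using Cauchy_Schwarz_norm[OF assms] by simp
qed

lemma L2_norm_add_power2:
  assumes "u \<in> L2" "v \<in> L2"
  shows "(L2_norm (\<lambda>x. u x + v x))\<^sup>2
    = (L2_norm u)\<^sup>2 + 2 * (\<integral>x. u x \<bullet> v x \<partial>lborel) + (L2_norm v)\<^sup>2"
proof -
  have "(norm (u x + v x))\<^sup>2 = (norm (u x))\<^sup>2 + 2 * (u x \<bullet> v x) + (norm (v x))\<^sup>2" for x
    by (simp add: power2_norm_eq_inner inner_add inner_commute algebra_simps)
  then show ?thesis
    using L2_D[OF assms(1)] L2_D[OF assms(2)] integrable_inner_L2[OF assms]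
    by (simp add: L2_norm_power2)
qed

lemma L2_norm_triangle:
  assumes "u \<in> L2" "v \<in> L2"
  shows "L2_norm (\<lambda>x. u x + v x) \<le> L2_norm u + L2_norm v"
proof (rule power2_le_imp_le)
  show "(L2_norm (\<lambda>x. u x + v x))\<^sup>2 \<le> (L2_norm u + L2_norm v)\<^sup>2"
    using Cauchy_Schwarz_inner[OF assms]
    by (simp add: L2_norm_add_power2[OF assms] power2_sum)
qed simp

lemma L2_norm_triangle_via:
  assumes "u \<in> L2" "v \<in> L2" "w \<in> L2"
  shows "L2_norm (\<lambda>x. u x - w x) \<le> L2_norm (\<lambda>x. u x - v x) + L2_norm (\<lambda>x. v x - w x)"
  using L2_norm_triangle[OF L2_diff[OF assms(1,2)] L2_diff[OF assms(2,3)]] by simp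

lemma L2_norm_abs_diff:
  assumes "u \<in> L2" "v \<in> L2"
  shows "\<bar>L2_norm u - L2_norm v\<bar> \<le> L2_norm (\<lambda>x. u x - v x)"
  using L2_norm_triangle[OF L2_diff[OF assms] assms(2)]
    L2_norm_triangle[OF L2_diff[OF assms(2,1)] assms(1)]
  by (simp add: L2_norm_commute[of u v])

lemma L2_norm_tendsto:
  assumes "\<And>n. u n \<in> L2" "v \<in> L2" "((\<lambda>n. L2_norm (\<lambda>x. u n x - v x)) \<longlongrightarrow> 0) F"
  shows "((\<lambda>n. L2_norm (u n)) \<longlongrightarrow> L2_norm v) F"
  by (rule LIM_zero_cancel, rule Lim_null_comparison[OF always_eventually assms(3)])
    (use L2_norm_abs_diff[OF assms(1,2)] in auto)

lemma L2_pairing_tendsto: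
  fixes u v :: "real^3 \<Rightarrow> complex"
  assumes u: "\<And>n. u' n \<in> L2" "u \<in> L2" "((\<lambda>n. L2_norm (\<lambda>x. u' n x - u x)) \<longlongrightarrow> 0) F"
    and v: "\<And>n. v' n \<in> L2" "v \<in> L2" "((\<lambda>n. L2_norm (\<lambda>x. v' n x - v x)) \<longlongrightarrow> 0) F"
  shows "((\<lambda>n. \<integral>x. u' n x * v' n x \<partial>lborel) \<longlongrightarrow> (\<integral>x. u x * v x \<partial>lborel)) F"
proof (rule LIM_zero_cancel, rule Lim_null_comparison)
  let ?b = "\<lambda>n. L2_norm (\<lambda>x. u' n x - u x) * L2_norm (v' n) + L2_norm u * L2_norm (\<lambda>x. v' n x - v x)"
  show "\<forall>\<^sub>F n in F. norm ((\<integral>x. u' n x * v' n x \<partial>lborel) - (\<integral>x. u x * v x \<partial>lborel)) \<le> ?b n"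
  proof (intro always_eventually allI)
    fix n
    have "(\<integral>x. u' n x * v' n x \<partial>lborel) - (\<integral>x. u x * v x \<partial>lborel)
      = (\<integral>x. (u' n x - u x) * v' n x + u x * (v' n x - v x) \<partial>lborel)"
      by (subst Bochner_Integration.integral_diff[symmetric])
        (auto intro!: integrable_mult_L2 u v simp: algebra_simps)
    also have "\<dots> = (\<integral>x. (u' n x - u x) * v' n x \<partial>lborel) + (\<integral>x. u x * (v' n x - v x) \<partial>lborel)"
      by (intro Bochner_Integration.integral_add integrable_mult_L2 L2_diff u v)
    also have "norm \<dots> \<le> ?b n"
      by (intro order_trans[OF norm_triangle_ineq] add_mono Cauchy_Schwarz_mult L2_diff u v)
    finally show "norm ((\<integral>x. u' n x * v' n x \<partial>lborel) - (\<integral>x. u x * v x \<partial>lborel)) \<le> ?b n" .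
  qed
  have "(?b \<longlongrightarrow> 0 * L2_norm v + L2_norm u * 0) F"
    by (intro tendsto_intros u v L2_norm_tendsto[OF v])
  then show "(?b \<longlongrightarrow> 0) F" by simp
qed

lemma L2_pairing_tendsto_right:
  fixes u v :: "real^3 \<Rightarrow> complex"
  assumes "u \<in> L2" "\<And>n. v' n \<in> L2" "v \<in> L2" "((\<lambda>n. L2_norm (\<lambda>x. v' n x - v x)) \<longlongrightarrow> 0) F"
  shows "((\<lambda>n. \<integral>x. u x * v' n x \<partial>lborel) \<longlongrightarrow> (\<integral>x. u x * v x \<partial>lborel)) F"
  by (rule L2_pairing_tendsto) (use assms in auto)

lemma L2_dominated_tendsto:
  assumes g: "g \<in> L2" and u: "\<And>n. u n \<in> borel_measurable lborel"
    and le: "\<And>n x. norm (u n x) \<le> C * norm (g x)"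
    and lim: "AE x in lborel. (\<lambda>n::nat. u n x) \<longlonglongrightarrow> 0"
  shows "(\<lambda>n. L2_norm (u n)) \<longlonglongrightarrow> 0"
proof -
  have "(\<lambda>n. \<integral>x. (norm (u n x))\<^sup>2 \<partial>lborel) \<longlonglongrightarrow> integral\<^sup>L lborel (\<lambda>x::real^3. 0::real)"
  proof (rule integral_dominated_convergence[where w = "\<lambda>x. C\<^sup>2 * (norm (g x))\<^sup>2"])
    show "AE x in lborel. (\<lambda>n. (norm (u n x))\<^sup>2) \<longlonglongrightarrow> 0"
      using lim by eventually_elim (auto intro!: tendsto_eq_intros)
    show "AE x in lborel. norm ((norm (u n x))\<^sup>2) \<le> C\<^sup>2 * (norm (g x))\<^sup>2" for n
      using power_mono[OF le norm_ge_zero, where n = 2] by (simp add: power_mult_distrib)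
  qed (use u L2_D[OF g] in auto)
  then show ?thesis
    unfolding L2_norm_def using tendsto_real_sqrt by fastforce
qed

text \<open>Riesz--Fischer: a subsequence with summable increments converges almost everywhere, and
  Fatou's lemma turns this into convergence in norm.\<close>

lemma L2_complete:
  fixes u :: "nat \<Rightarrow> real^3 \<Rightarrow> 'b::euclidean_space"
  assumes u: "\<And>n. u n \<in> L2"
    and Cauchy: "\<And>e. e > 0 \<Longrightarrow> \<exists>N. \<forall>m\<ge>N. \<forall>n\<ge>N. L2_norm (\<lambda>x. u m x - u n x) < e"
  shows "\<exists>v\<in>L2. (\<lambda>n. L2_norm (\<lambda>x. u n x - v x)) \<longlonglongrightarrow> 0"
proof -
  have "\<exists>r. strict_mono r \<and> (\<forall>k. \<forall>m\<ge>r k. \<forall>n\<ge>r k. L2_norm (\<lambda>x. u m x - u n x) < (1/4)^k)"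
  proof -
    have "\<exists>r. \<forall>k. (\<forall>m\<ge>r k. \<forall>n\<ge>r k. L2_norm (\<lambda>x. u m x - u n x) < (1/4)^k) \<and> r k < r (Suc k)"
    proof (rule dependent_nat_choice)
      show "\<exists>x. \<forall>m\<ge>x. \<forall>n\<ge>x. L2_norm (\<lambda>x. u m x - u n x) < (1/4)^0"
        using Cauchy[of 1] by auto
    next
      fix x k
      obtain N where "\<forall>m\<ge>N. \<forall>n\<ge>N. L2_norm (\<lambda>x. u m x - u n x) < (1/4)^Suc k"
        using Cauchy[of "(1/4)^Suc k"] by auto
      then show "\<exists>y. (\<forall>m\<ge>y. \<forall>n\<ge>y. L2_norm (\<lambda>x. u m x - u n x) < (1/4)^Suc k) \<and> x < y"
        by (intro exI[of _ "max N (Suc x)"]) auto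
    qed
    then show ?thesis by (auto simp: strict_mono_Suc_iff)
  qed
  then obtain r where r: "strict_mono r"
    "\<And>k m n. m \<ge> r k \<Longrightarrow> n \<ge> r k \<Longrightarrow> L2_norm (\<lambda>x. u m x - u n x) < (1/4)^k" by blast
  define d where "d k = (\<lambda>x. u (r (Suc k)) x - u (r k) x)" for k
  have dL: "d k \<in> L2" for k unfolding d_def by (intro L2_diff u)
  have [measurable]: "d k \<in> borel_measurable borel" "u k \<in> borel_measurable borel" for k
    using L2_D(3)[OF dL] L2_D(3)[OF u] by auto
  have dn: "L2_norm (d k) \<le> (1/4)^k" for k
    unfolding d_def using r(2)[of k "r (Suc k)" "r k"] r(1)
    by (simp add: strict_mono_less_eq less_imp_le)
  \<comment> \<open>the weights \<open>2\<^sup>k\<close> make both \<open>\<Sum> 2\<^sup>k \<parallel>d\<^sub>k\<parallel>\<^sup>2\<close> and \<open>\<Sum> 2\<^sup>-\<^sup>k\<close> converge\<close>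
  have fin: "(\<integral>\<^sup>+x. (\<Sum>k. ennreal (2^k * (norm (d k x))\<^sup>2)) \<partial>lborel) < \<infinity>"
  proof -
    have "(\<integral>\<^sup>+x. (\<Sum>k. ennreal (2^k * (norm (d k x))\<^sup>2)) \<partial>lborel)
      = (\<Sum>k. \<integral>\<^sup>+x. ennreal (2^k * (norm (d k x))\<^sup>2) \<partial>lborel)"
      by (intro nn_integral_suminf) measurable
    also have "\<dots> = (\<Sum>k. ennreal (2^k * (L2_norm (d k))\<^sup>2))"
      using L2_D[OF dL] by (intro suminf_cong, subst nn_integral_eq_integral) (auto simp: L2_norm_power2)
    also have "\<dots> \<le> (\<Sum>k. ennreal ((1/8)^k))"
    proof (intro suminf_le ennreal_leI)
      fix k
      have "2^k * (L2_norm (d k))\<^sup>2 \<le> 2^k * ((1/4)^k)\<^sup>2"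
        using dn by (intro mult_left_mono power_mono) auto
      also have "\<dots> = (1/8::real)^k"
        by (simp add: power2_eq_square flip: power_mult_distrib)
      finally show "2^k * (L2_norm (d k))\<^sup>2 \<le> (1/8)^k" .
    qed auto
    also have "\<dots> = ennreal (\<Sum>k. (1/8)^k)"
      by (intro suminf_ennreal2 summable_geometric) auto
    finally show ?thesis by (rule order_le_less_trans) (rule ennreal_less_top[folded infinity_ennreal_def])
  qed
  have "AE x in lborel. (\<Sum>k. ennreal (2^k * (norm (d k x))\<^sup>2)) \<noteq> \<infinity>"
    by (rule nn_integral_PInf_AE[OF _ less_imp_neq[OF fin, folded infinity_ennreal_def]]) measurable
  then have conv: "AE x in lborel. convergent (\<lambda>k. u (r k) x)"
  proof eventually_elim
    case (elim x)
    then have s: "summable (\<lambda>k. 2^k * (norm (d k x))\<^sup>2)"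
      by (intro summable_suminf_not_top) (auto simp: top_ennreal_def)
    have "summable (\<lambda>k. norm (d k x))"
    proof (rule summable_comparison_test'[where N = 0])
      show "summable (\<lambda>k. 2^k * (norm (d k x))\<^sup>2 + (1/2)^k)"
        by (intro summable_add s summable_geometric) auto
      show "norm (norm (d k x)) \<le> 2^k * (norm (d k x))\<^sup>2 + (1/2)^k" for k
      proof -
        have "2 * (norm (d k x) * 2^k) \<le> (norm (d k x) * 2^k)\<^sup>2 + 1"
          using sum_squares_bound[of "norm (d k x) * 2^k" 1] by simp
        then have "norm (d k x) * 2^k \<le> (norm (d k x) * 2^k)\<^sup>2 + 1"
          using mult_nonneg_nonneg[of "norm (d k x)" "2^k"] by (smt (verit) norm_ge_zero zero_le_power)
        then have "(norm (d k x) * 2^k) * (1/2)^k \<le> ((norm (d k x) * 2^k)\<^sup>2 + 1) * (1/2)^k"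
          by (intro mult_right_mono) auto
        then show ?thesis
          by (simp add: power2_eq_square algebra_simps power_one_over)
      qed
    qed
    then have "summable (\<lambda>k. d k x)" by (rule summable_norm_cancel)
    then have "convergent (\<lambda>n. \<Sum>k<n. d k x)" by (simp add: summable_iff_convergent)
    moreover have "(\<Sum>k<n. d k x) = u (r n) x - u (r 0) x" for n
      unfolding d_def by (rule sum_lessThan_telescope)
    ultimately have "convergent (\<lambda>n. (u (r n) x - u (r 0) x) + u (r 0) x)"
      by (intro convergent_add convergent_const) simp
    then show ?case by simp
  qed
  define v where "v x = lim (\<lambda>k. u (r k) x)" for x
  have vm: "v \<in> borel_measurable lborel"
    unfolding v_def by measurable
  have key: "v \<in> L2 \<and> L2_norm (\<lambda>x. u m x - v x) \<le> (1/4)^k" if "m \<ge> r k" for m k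
  proof -
    have "(\<integral>\<^sup>+x. ennreal ((norm (u m x - v x))\<^sup>2) \<partial>lborel)
      = (\<integral>\<^sup>+x. liminf (\<lambda>n. ennreal ((norm (u m x - u (r n) x))\<^sup>2)) \<partial>lborel)"
    proof (rule nn_integral_cong_AE, use conv in eventually_elim)
      fix x assume "convergent (\<lambda>k. u (r k) x)"
      then have "(\<lambda>k. u (r k) x) \<longlonglongrightarrow> v x" by (simp add: v_def convergent_LIMSEQ_iff)
      then have "(\<lambda>n. ennreal ((norm (u m x - u (r n) x))\<^sup>2)) \<longlonglongrightarrow> ennreal ((norm (u m x - v x))\<^sup>2)"
        by (intro tendsto_intros)
      then show "ennreal ((norm (u m x - v x))\<^sup>2) = liminf (\<lambda>n. ennreal ((norm (u m x - u (r n) x))\<^sup>2))"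
        by (intro lim_imp_Liminf[symmetric]) auto
    qed
    also have "\<dots> \<le> liminf (\<lambda>n. \<integral>\<^sup>+x. ennreal ((norm (u m x - u (r n) x))\<^sup>2) \<partial>lborel)"
      using vm by (intro nn_integral_liminf) measurable
    also have "\<dots> = liminf (\<lambda>n. ennreal ((L2_norm (\<lambda>x. u m x - u (r n) x))\<^sup>2))"
      using L2_D[OF L2_diff[OF u u]] by (subst nn_integral_eq_integral) (auto simp: L2_norm_power2)
    also have "\<dots> \<le> liminf (\<lambda>n. ennreal (((1/4)^k)\<^sup>2))"
    proof (rule Liminf_mono)
      show "\<forall>\<^sub>F n in sequentially. ennreal ((L2_norm (\<lambda>x. u m x - u (r n) x))\<^sup>2) \<le> ennreal (((1/4)^k)\<^sup>2)"
        using eventually_ge_at_top[of k]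
      proof eventually_elim
        case (elim n)
        then have "r k \<le> r n" using r(1) by (simp add: strict_mono_less_eq)
        then show ?case using r(2)[OF that] by (intro ennreal_leI power_mono) (auto simp: less_imp_le)
      qed
    qed
    also have "\<dots> = ennreal (((1/4)^k)\<^sup>2)" by (simp add: Liminf_const)
    finally have le: "(\<integral>\<^sup>+x. ennreal ((norm (u m x - v x))\<^sup>2) \<partial>lborel) \<le> ennreal (((1/4)^k)\<^sup>2)" .
    have m: "(\<lambda>x. u m x - v x) \<in> borel_measurable lborel"
      using vm L2_D(1)[OF u] by auto
    have L: "(\<lambda>x. u m x - v x) \<in> L2"
      using le m by (intro L2_I integrableI_bounded) (auto simp: order_le_less_trans)
    have "v \<in> L2" using L2_diff[OF u L, of m] by simp
    moreover have "(L2_norm (\<lambda>x. u m x - v x))\<^sup>2 \<le> ((1/4)^k)\<^sup>2"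
      using le L2_D(2)[OF L] by (subst (asm) nn_integral_eq_integral) (auto simp: L2_norm_power2)
    then have "L2_norm (\<lambda>x. u m x - v x) \<le> (1/4)^k"
      by (rule power2_le_imp_le) simp
    ultimately show ?thesis by simp
  qed
  have "(\<lambda>n. L2_norm (\<lambda>x. u n x - v x)) \<longlonglongrightarrow> 0"
  proof (rule LIMSEQ_I)
    fix e :: real assume "e > 0"
    then obtain k where k: "(1/4)^k < e" using real_arch_pow_inv[of e "1/4"] by auto
    show "\<exists>N. \<forall>n\<ge>N. norm (L2_norm (\<lambda>x. u n x - v x) - 0) < e"
      using key[of k] k by (intro exI[of _ "r k"]) force
  qed
  then show ?thesis using key by blast
qed

text \<open>A real subspace of \<open>L\<^sup>2\<close> that is not dense has a nonzero normal vector: the limit of a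
  sequence minimising the distance to a point off the closure; the sequence is Cauchy by the
  parallelogram law.\<close>

lemma L2_orthogonal_complement:
  fixes S :: "(real^3 \<Rightarrow> 'b::euclidean_space) set"
  assumes S: "S \<subseteq> L2" "S \<noteq> {}"
    and add: "\<And>a b. a \<in> S \<Longrightarrow> b \<in> S \<Longrightarrow> (\<lambda>x. a x + b x) \<in> S"
    and scale: "\<And>a c. a \<in> S \<Longrightarrow> (\<lambda>x. c *\<^sub>R a x) \<in> S"
    and g: "g \<in> L2" and e: "e > 0" and far: "\<And>h. h \<in> S \<Longrightarrow> L2_norm (\<lambda>x. h x - g x) \<ge> e"
  shows "\<exists>v\<in>L2. (\<forall>h\<in>S. (\<integral>x. v x \<bullet> h x \<partial>lborel) = 0) \<and> \<not> (AE x in lborel. v x = 0)"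
proof -
  define D where "D = (\<lambda>h. (L2_norm (\<lambda>x. h x - g x))\<^sup>2)"
  define m where "m = Inf (D ` S)"
  have D0: "0 \<le> D h" for h by (simp add: D_def)
  have bb: "bdd_below (D ` S)" by (rule bdd_belowI[of _ 0]) (auto simp: D0)
  have mle: "m \<le> D h" if "h \<in> S" for h unfolding m_def using bb that by (intro cInf_lower) auto
  have "\<exists>h\<in>S. D h < m + 1 / real (Suc n)" for n
  proof -
    have "Inf (D ` S) < m + 1 / real (Suc n)" by (simp add: m_def)
    then show ?thesis using cInf_lessD[of "D ` S"] S(2) by auto
  qed
  then obtain h where h: "\<And>n. h n \<in> S" "\<And>n. D (h n) < m + 1 / real (Suc n)" by metis
  have hL: "h n \<in> L2" for n using h S by auto
  have par: "(L2_norm (\<lambda>x. h i x - h j x))\<^sup>2 \<le> 2 * (1 / real (Suc i) + 1 / real (Suc j))" for i j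
  proof -
    let ?a = "\<lambda>x. h i x - g x" and ?b = "\<lambda>x. h j x - g x"
    have ab: "?a \<in> L2" "?b \<in> L2" by (intro L2_diff hL g)+
    have "(\<lambda>x. (1/2) *\<^sub>R (h i x + h j x)) \<in> S" by (intro scale add h)
    from mle[OF this] have "4 * m \<le> 4 * D (\<lambda>x. (1/2) *\<^sub>R (h i x + h j x))" by simp
    also have "\<dots> = (L2_norm (\<lambda>x. 2 *\<^sub>R ((1/2) *\<^sub>R (h i x + h j x) - g x)))\<^sup>2"
      unfolding D_def L2_norm_scaleR by (simp add: power_mult_distrib)
    also have "(\<lambda>x. 2 *\<^sub>R ((1/2) *\<^sub>R (h i x + h j x) - g x)) = (\<lambda>x. ?a x + ?b x)"
      by (auto simp: algebra_simps scaleR_2)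
    finally have 1: "4 * m \<le> (L2_norm (\<lambda>x. ?a x + ?b x))\<^sup>2" .
    have "(L2_norm (\<lambda>x. h i x - h j x))\<^sup>2 = (L2_norm (\<lambda>x. ?a x + - ?b x))\<^sup>2" by simp
    also have "\<dots> = D (h i) - 2 * (\<integral>x. ?a x \<bullet> ?b x \<partial>lborel) + D (h j)"
      unfolding L2_norm_add_power2[OF ab(1) L2_minus[OF ab(2)]] L2_norm_minus[of ?b]
        inner_minus_right Bochner_Integration.integral_minus by (simp add: D_def)
    also have "\<dots> = 2 * D (h i) + 2 * D (h j) - (L2_norm (\<lambda>x. ?a x + ?b x))\<^sup>2"
      using L2_norm_add_power2[OF ab] by (simp add: D_def)
    finally show ?thesis using 1 h(2)[of i] h(2)[of j] by simp
  qed
  obtain p where p: "p \<in> L2" "(\<lambda>n. L2_norm (\<lambda>x. h n x - p x)) \<longlonglongrightarrow> 0"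
  proof -
    have "\<exists>N. \<forall>i\<ge>N. \<forall>j\<ge>N. L2_norm (\<lambda>x. h i x - h j x) < d" if "d > 0" for d :: real
    proof -
      obtain N where N: "4 / d\<^sup>2 < real N" using reals_Archimedean2 by blast
      have "L2_norm (\<lambda>x. h i x - h j x) < d" if "i \<ge> N" "j \<ge> N" for i j
      proof (rule power2_less_imp_less)
        have NN: "0 < real N" using N \<open>d > 0\<close> by (smt (verit) zero_less_divide_iff zero_less_power)
        have "(L2_norm (\<lambda>x. h i x - h j x))\<^sup>2 \<le> 2 * (1 / real (Suc i) + 1 / real (Suc j))" by (rule par)
        also have "\<dots> \<le> 2 * (1 / real N + 1 / real N)"
          using that NN by (intro mult_left_mono add_mono divide_left_mono) auto
        also have "\<dots> < d\<^sup>2" using N NN \<open>d > 0\<close> by (simp add: field_simps)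
        finally show "(L2_norm (\<lambda>x. h i x - h j x))\<^sup>2 < d\<^sup>2" .
      qed (use \<open>d > 0\<close> in auto)
      then show ?thesis by blast
    qed
    then show ?thesis using L2_complete[of h] hL that by blast
  qed
  define v where "v = (\<lambda>x. g x - p x)"
  have vL: "v \<in> L2" unfolding v_def by (intro L2_diff g p)
  have lim: "(\<lambda>n. L2_norm (\<lambda>x. h n x - g x)) \<longlonglongrightarrow> L2_norm v"
  proof -
    have "(\<lambda>n. L2_norm (\<lambda>x. h n x - g x)) \<longlonglongrightarrow> L2_norm (\<lambda>x. p x - g x)"
      by (rule L2_norm_tendsto) (use p hL g in \<open>auto intro: L2_diff\<close>)
    then show ?thesis by (simp add: v_def L2_norm_commute[of p g])
  qed
  have "e \<le> L2_norm v" using far h(1) by (intro LIMSEQ_le_const[OF lim]) auto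
  then have nz: "\<not> (AE x in lborel. v x = 0)" using L2_norm_eq_0[OF vL] e by auto
  have vm: "(L2_norm v)\<^sup>2 \<le> m"
  proof (rule LIMSEQ_le)
    show "(\<lambda>n. D (h n)) \<longlonglongrightarrow> (L2_norm v)\<^sup>2" unfolding D_def by (intro tendsto_intros lim)
    show "(\<lambda>n. m + 1 / real (Suc n)) \<longlonglongrightarrow> m"
      using tendsto_add[OF tendsto_const lim_inverse_n'[THEN LIMSEQ_Suc], of m] by simp
  qed (use h less_imp_le in blast)
  have "(\<integral>x. v x \<bullet> k x \<partial>lborel) = 0" if k: "k \<in> S" for k
  proof -
    have kL: "k \<in> L2" using k S by auto
    let ?I = "\<integral>x. v x \<bullet> k x \<partial>lborel" and ?q = "(L2_norm k)\<^sup>2"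
    have *: "2 * t * ?I \<le> t\<^sup>2 * ?q" for t
    proof -
      let ?w = "\<lambda>x. v x + (- t) *\<^sub>R k x"
      have wL: "?w \<in> L2" by (intro L2_add L2_scaleR vL kL)
      have "m \<le> (L2_norm ?w)\<^sup>2"
      proof (rule LIMSEQ_le_const)
        have "(\<lambda>n. L2_norm (\<lambda>x. (h n x + t *\<^sub>R k x) - g x)) \<longlonglongrightarrow> L2_norm (\<lambda>x. (p x + t *\<^sub>R k x) - g x)"
          by (rule L2_norm_tendsto) (intro L2_diff L2_add L2_scaleR hL g kL p(1) | simp add: p(2))+
        then show "(\<lambda>n. D (\<lambda>x. h n x + t *\<^sub>R k x)) \<longlonglongrightarrow> (L2_norm ?w)\<^sup>2"
          unfolding D_def L2_norm_commute[of _ g] by (intro tendsto_intros) (simp add: v_def algebra_simps)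
        show "\<exists>N. \<forall>n\<ge>N. m \<le> D (\<lambda>x. h n x + t *\<^sub>R k x)"
          using mle[OF add[OF h(1) scale[OF k]]] by blast
      qed
      also have "(L2_norm ?w)\<^sup>2 = (L2_norm v)\<^sup>2 - 2 * t * ?I + t\<^sup>2 * ?q"
        by (subst L2_norm_add_power2[OF vL L2_scaleR[OF kL]])
          (simp only: L2_norm_scaleR inner_scaleR_right integral_mult_right_zero, simp add: power_mult_distrib)
      finally show ?thesis using vm by simp
    qed
    show ?thesis
    proof (rule ccontr)
      assume I: "?I \<noteq> 0"
      \<comment> \<open>close to the minimiser of \<open>t\<^sup>2 q - 2 t I\<close>, with a denominator that is not zero\<close>
      define t where "t = ?I / (?q + 1)"
      have q: "?q + 1 > 0" by (simp add: add_nonneg_pos)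
      have "2 * ?I\<^sup>2 * (?q + 1) = 2 * t * ?I * (?q + 1)\<^sup>2"
        using q by (simp add: t_def power2_eq_square field_simps)
      also have "\<dots> \<le> t\<^sup>2 * ?q * (?q + 1)\<^sup>2" using *[of t] by (intro mult_right_mono) auto
      also have "\<dots> = ?I\<^sup>2 * ?q" using q by (simp add: t_def power_divide)
      finally have "?I\<^sup>2 * (?q + 2) \<le> 0" by (simp add: algebra_simps)
      moreover have "0 < ?I\<^sup>2 * (?q + 2)" using I q by (intro mult_pos_pos) auto
      ultimately show False by simp
    qed
  qed
  then show ?thesis using vL nz by blast
qed

section \<open>Smooth functions and test functions\<close>

text \<open>The function \<open>p(1/t) e\<^sup>-\<^sup>1\<^sup>/\<^sup>t\<close>, extended by zero to \<open>t \<le> 0\<close>. Allowing a polynomial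
  factor makes the class closed under differentiation.\<close>

definition flat_exp :: "real poly \<Rightarrow> real \<Rightarrow> real" where
  "flat_exp p t = (if t > 0 then poly p (1 / t) * exp (- (1 / t)) else 0)"

lemma poly_div_exp_tendsto_0: "((\<lambda>s::real. poly p s * exp (- s)) \<longlongrightarrow> 0) at_top"
proof -
  have "((\<lambda>s. \<Sum>i\<le>degree p. coeff p i * (s ^ i / exp s)) \<longlongrightarrow> (\<Sum>i\<le>degree p. coeff p i * 0)) at_top"
    by (intro tendsto_intros tendsto_power_div_exp_0)
  moreover have "poly p s * exp (- s) = (\<Sum>i\<le>degree p. coeff p i * (s ^ i / exp s))" for s
    by (simp add: poly_altdef sum_distrib_right sum_distrib_left exp_minus divide_inverse mult_ac)
  ultimately show ?thesis by simp
qed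

lemma flat_exp_tendsto_0: "(flat_exp p \<longlongrightarrow> 0) (at 0)"
proof (rule filterlim_split_at)
  show "(flat_exp p \<longlongrightarrow> 0) (at_left 0)"
    by (rule tendsto_eventually) (auto simp: flat_exp_def eventually_at_filter)
  have "((\<lambda>t. poly p (inverse t) * exp (- inverse t)) \<longlongrightarrow> 0) (at_right 0)"
    by (rule filterlim_compose[OF poly_div_exp_tendsto_0 filterlim_inverse_at_top_right])
  then show "(flat_exp p \<longlongrightarrow> 0) (at_right 0)"
    by (rule Lim_transform_eventually)
      (auto simp: flat_exp_def eventually_at_filter inverse_eq_divide)
qed

lemma flat_exp_has_derivative:
  "(flat_exp p has_real_derivative flat_exp ([:0, 0, 1:] * (p - pderiv p)) t) (at t)"
proof -
  consider "t > 0" | "t < 0" | "t = 0" by linarith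
  then show ?thesis
  proof cases
    case 1
    have "((\<lambda>t. poly p (1 / t) * exp (- (1 / t))) has_real_derivative
        flat_exp ([:0, 0, 1:] * (p - pderiv p)) t) (at t)"
      using 1 by (auto intro!: derivative_eq_intros DERIV_chain2[where f = "poly p"] poly_DERIV
          simp: flat_exp_def field_simps power2_eq_square)
    then show ?thesis
      by (rule has_field_derivative_transform_within_open[where S = "{0<..}"])
        (use 1 in \<open>auto simp: flat_exp_def\<close>)
  next
    case 2
    have "((\<lambda>t. 0) has_real_derivative flat_exp ([:0, 0, 1:] * (p - pderiv p)) t) (at t)"
      using 2 by (simp add: flat_exp_def)
    then show ?thesis
      by (rule has_field_derivative_transform_within_open[where S = "{..<0}"])
        (use 2 in \<open>auto simp: flat_exp_def\<close>)
  next
    case 3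
    have "(\<lambda>y. (flat_exp p y - flat_exp p 0) / (y - 0)) = flat_exp ([:0, 1:] * p)"
      by (auto simp: flat_exp_def fun_eq_iff)
    then show ?thesis
      using flat_exp_tendsto_0[of "[:0, 1:] * p"] 3
      unfolding has_field_derivative_iff by (simp add: flat_exp_def)
  qed
qed

definition smooth :: "(real^3 \<Rightarrow> complex) \<Rightarrow> bool" where
  "smooth \<phi> \<longleftrightarrow> (\<forall>js x. foldr partial_deriv js \<phi> differentiable (at x))"

lemma smooth_coinduct:
  assumes "P \<phi>"
    and "\<And>\<phi> x. P \<phi> \<Longrightarrow> \<phi> differentiable (at x)"
    and step: "\<And>\<phi> j. P \<phi> \<Longrightarrow> P (partial_deriv j \<phi>)"
  shows "smooth \<phi>"
proof -
  have "P (foldr partial_deriv js \<phi>)" for js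
    by (induction js) (simp_all add: assms(1) step)
  then show ?thesis using assms(2) by (auto simp: smooth_def)
qed

lemma smooth_differentiable: "smooth \<phi> \<Longrightarrow> \<phi> differentiable (at x)"
  unfolding smooth_def by (metis foldr_Nil id_apply)

lemma smooth_partial:
  assumes "smooth \<phi>" shows "smooth (partial_deriv j \<phi>)"
  unfolding smooth_def
proof (intro allI)
  fix js x
  have "foldr partial_deriv (js @ [j]) \<phi> differentiable (at x)"
    using assms unfolding smooth_def by blast
  then show "foldr partial_deriv js (partial_deriv j \<phi>) differentiable (at x)" by simp
qed

lemma partial_deriv_eq: "(\<phi> has_derivative D) (at x) \<Longrightarrow> partial_deriv j \<phi> x = D (axis j 1)"
  unfolding partial_deriv_def by (metis frechet_derivative_at)

lemma differentiable_has_derivative: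
  assumes "\<phi> differentiable (at x)"
  shows "(\<phi> has_derivative (\<lambda>h. \<Sum>j\<in>UNIV. h $ j *\<^sub>R partial_deriv j \<phi> x)) (at x)"
proof -
  let ?D = "frechet_derivative \<phi> (at x)"
  have D: "(\<phi> has_derivative ?D) (at x)" using assms by (simp add: frechet_derivative_works)
  then have l: "linear ?D" by (rule has_derivative_linear)
  have "?D h = (\<Sum>j\<in>UNIV. h $ j *\<^sub>R partial_deriv j \<phi> x)" for h
  proof -
    have "?D h = ?D (\<Sum>j\<in>UNIV. h $ j *\<^sub>R axis j 1)"
      by (subst basis_expansion[of h, symmetric]) (simp add: scalar_mult_eq_scaleR)
    then show ?thesis by (simp add: linear_sum[OF l] linear_scale[OF l] partial_deriv_def)
  qed
  then have "?D = (\<lambda>h. \<Sum>j\<in>UNIV. h $ j *\<^sub>R partial_deriv j \<phi> x)" by blast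
  then show ?thesis using D by simp
qed

lemmas smooth_has_derivative = differentiable_has_derivative[OF smooth_differentiable]

text \<open>All closure properties of smooth functions come from one coinduction: the class generated
  by the operations below is closed under partial derivatives.\<close>

inductive smooth_gen :: "(real^3 \<Rightarrow> complex) \<Rightarrow> bool" where
  base: "smooth \<phi> \<Longrightarrow> linear L \<Longrightarrow> smooth_gen (\<lambda>x. \<phi> (t + L x))"
| const: "smooth_gen (\<lambda>x. c)"
| coord: "smooth_gen (\<lambda>x. complex_of_real (x $ j))"
| flat: "smooth_gen (\<lambda>x. complex_of_real (flat_exp p (a * x $ j + b)))"
| add: "smooth_gen \<phi> \<Longrightarrow> smooth_gen \<psi> \<Longrightarrow> smooth_gen (\<lambda>x. \<phi> x + \<psi> x)"
| mult: "smooth_gen \<phi> \<Longrightarrow> smooth_gen \<psi> \<Longrightarrow> smooth_gen (\<lambda>x. \<phi> x * \<psi> x)"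

lemma smooth_gen_sum:
  "(\<And>i. i \<in> I \<Longrightarrow> smooth_gen (\<phi> i)) \<Longrightarrow> smooth_gen (\<lambda>x. \<Sum>i\<in>I. \<phi> i x)"
  by (induction I rule: infinite_finite_induct) (simp_all add: smooth_gen.const smooth_gen.add)

lemma has_derivative_affine_compose:
  fixes L :: "real^3 \<Rightarrow> real^3"
  assumes s: "smooth \<phi>" and L: "linear L"
  shows "((\<lambda>x. \<phi> (t + L x)) has_derivative
    (\<lambda>h. \<Sum>k\<in>UNIV. (L h) $ k *\<^sub>R partial_deriv k \<phi> (t + L x))) (at x)"
proof -
  have "((\<lambda>x. t + L x) has_derivative L) (at x)"
    using has_derivative_add[OF has_derivative_const linear_imp_has_derivative[OF L]] by simp
  from diff_chain_at[OF this smooth_has_derivative[OF s]] show ?thesis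
    by (simp add: o_def)
qed

lemma has_derivative_coord: "((\<lambda>x::real^3. complex_of_real (x $ j)) has_derivative
    (\<lambda>h. complex_of_real (h $ j))) (at x)"
  by (intro bounded_linear_imp_has_derivative bounded_linear_compose[OF bounded_linear_of_real]
      bounded_linear_vec_nth)

lemma has_derivative_flat_exp: "((\<lambda>x::real^3. complex_of_real (flat_exp p (a * x $ j + b))) has_derivative
    (\<lambda>h. complex_of_real (a * h $ j) * complex_of_real (flat_exp ([:0, 0, 1:] * (p - pderiv p)) (a * x $ j + b))))
    (at x)"
proof -
  have 1: "((\<lambda>x::real^3. a * x $ j + b) has_derivative (\<lambda>h. a * h $ j)) (at x)"
    by (auto intro!: derivative_eq_intros bounded_linear_imp_has_derivative bounded_linear_vec_nth)
  have "((\<lambda>x::real^3. flat_exp p (a * x $ j + b)) has_derivative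
      (\<lambda>h. flat_exp ([:0, 0, 1:] * (p - pderiv p)) (a * x $ j + b) * (a * h $ j))) (at x)"
    using has_derivative_compose[OF 1 flat_exp_has_derivative[THEN has_field_derivative_imp_has_derivative]]
    by simp
  from has_derivative_of_real[OF this] show ?thesis
    by (simp add: mult_ac)
qed

lemma smooth_gen_differentiable_partial:
  assumes "smooth_gen \<phi>"
  shows "(\<forall>x. \<phi> differentiable (at x)) \<and> (\<forall>j. smooth_gen (partial_deriv j \<phi>))"
  using assms
proof induction
  case (base \<phi> L t)
  note d = has_derivative_affine_compose[OF base]
  have "partial_deriv j (\<lambda>x. \<phi> (t + L x))
      = (\<lambda>x. \<Sum>k\<in>UNIV. complex_of_real (L (axis j 1) $ k) * partial_deriv k \<phi> (t + L x))" for j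
    by (rule ext, subst partial_deriv_eq[OF d]) (simp add: scaleR_conv_of_real)
  moreover have "smooth_gen (\<lambda>x. \<Sum>k\<in>UNIV. complex_of_real (L (axis j 1) $ k) * partial_deriv k \<phi> (t + L x))" for j
    by (intro smooth_gen_sum smooth_gen.mult smooth_gen.const
        smooth_gen.base[OF smooth_partial[OF base(1)] base(2)])
  ultimately show ?case using differentiableI[OF d] by simp
next
  case (const c)
  have "partial_deriv j (\<lambda>x. c) = (\<lambda>x. 0)" for j
    by (rule ext, subst partial_deriv_eq[OF has_derivative_const]) simp
  then show ?case by (simp add: smooth_gen.const)
next
  case (coord k)
  have "partial_deriv j (\<lambda>x. complex_of_real (x $ k)) = (\<lambda>x. complex_of_real (axis j 1 $ k))" for j
    by (rule ext, subst partial_deriv_eq[OF has_derivative_coord]) simp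
  then show ?case using differentiableI[OF has_derivative_coord] by (simp add: smooth_gen.const)
next
  case (flat p a k b)
  note d = has_derivative_flat_exp
  have "partial_deriv j (\<lambda>x. complex_of_real (flat_exp p (a * x $ k + b)))
    = (\<lambda>x. complex_of_real (a * axis j 1 $ k)
        * complex_of_real (flat_exp ([:0, 0, 1:] * (p - pderiv p)) (a * x $ k + b)))" for j
    by (rule ext, subst partial_deriv_eq[OF d]) simp
  then show ?case using differentiableI[OF d] smooth_gen.mult[OF smooth_gen.const smooth_gen.flat]
    by simp
next
  case (add \<phi> \<psi>)
  then have eq: "partial_deriv j (\<lambda>x. \<phi> x + \<psi> x) = (\<lambda>x. partial_deriv j \<phi> x + partial_deriv j \<psi> x)" for j
    by (intro ext, subst partial_deriv_eq[OF has_derivative_add[OF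
            frechet_derivative_works[THEN iffD1] frechet_derivative_works[THEN iffD1]]])
      (auto simp: partial_deriv_def)
  show ?case
  proof (intro conjI allI)
    show "(\<lambda>x. \<phi> x + \<psi> x) differentiable (at x)" for x
      using add.IH by (intro differentiable_add) blast+
    show "smooth_gen (partial_deriv j (\<lambda>x. \<phi> x + \<psi> x))" for j
      unfolding eq by (rule smooth_gen.add) (use add.IH in blast)+
  qed
next
  case (mult \<phi> \<psi>)
  then have eq: "partial_deriv j (\<lambda>x. \<phi> x * \<psi> x)
      = (\<lambda>x. \<phi> x * partial_deriv j \<psi> x + partial_deriv j \<phi> x * \<psi> x)" for j
    by (intro ext, subst partial_deriv_eq[OF has_derivative_mult[OF
            frechet_derivative_works[THEN iffD1] frechet_derivative_works[THEN iffD1]]])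
      (auto simp: partial_deriv_def)
  show ?case
  proof (intro conjI allI)
    show "(\<lambda>x. \<phi> x * \<psi> x) differentiable (at x)" for x
      using mult.IH by (intro differentiable_mult) blast+
    show "smooth_gen (partial_deriv j (\<lambda>x. \<phi> x * \<psi> x))" for j
      unfolding eq
      by (rule smooth_gen.add; rule smooth_gen.mult) (use mult.IH mult.hyps in blast)+
  qed
qed

lemma smooth_gen_imp_smooth: "smooth_gen \<phi> \<Longrightarrow> smooth \<phi>"
  by (rule smooth_coinduct[where P = smooth_gen]) (simp_all add: smooth_gen_differentiable_partial)

lemma smooth_imp_smooth_gen: "smooth \<phi> \<Longrightarrow> smooth_gen \<phi>"
  using smooth_gen.base[OF _ linear_id, of \<phi> 0] by simp

lemma smooth_const: "smooth (\<lambda>x. c)"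
  by (rule smooth_gen_imp_smooth[OF smooth_gen.const])

lemma smooth_coord: "smooth (\<lambda>x. complex_of_real (x $ j))"
  by (rule smooth_gen_imp_smooth[OF smooth_gen.coord])

lemma smooth_flat_exp: "smooth (\<lambda>x. complex_of_real (flat_exp p (a * x $ j + b)))"
  by (rule smooth_gen_imp_smooth[OF smooth_gen.flat])

lemma smooth_affine: "smooth \<phi> \<Longrightarrow> linear L \<Longrightarrow> smooth (\<lambda>x. \<phi> (t + L x))"
  by (rule smooth_gen_imp_smooth[OF smooth_gen.base])

lemma smooth_add: "smooth \<phi> \<Longrightarrow> smooth \<psi> \<Longrightarrow> smooth (\<lambda>x. \<phi> x + \<psi> x)"
  by (rule smooth_gen_imp_smooth[OF smooth_gen.add[OF smooth_imp_smooth_gen smooth_imp_smooth_gen]])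

lemma smooth_mult: "smooth \<phi> \<Longrightarrow> smooth \<psi> \<Longrightarrow> smooth (\<lambda>x. \<phi> x * \<psi> x)"
  by (rule smooth_gen_imp_smooth[OF smooth_gen.mult[OF smooth_imp_smooth_gen smooth_imp_smooth_gen]])

lemma smooth_sum: "(\<And>i. i \<in> I \<Longrightarrow> smooth (\<phi> i)) \<Longrightarrow> smooth (\<lambda>x. \<Sum>i\<in>I. \<phi> i x)"
  by (induction I rule: infinite_finite_induct) (simp_all add: smooth_add smooth_const)

lemma smooth_prod: "(\<And>i. i \<in> I \<Longrightarrow> smooth (\<phi> i)) \<Longrightarrow> smooth (\<lambda>x. \<Prod>i\<in>I. \<phi> i x)"
  by (induction I rule: infinite_finite_induct) (simp_all add: smooth_mult smooth_const)

lemma partial_deriv_mult: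
  assumes "smooth \<phi>" "smooth \<psi>"
  shows "partial_deriv j (\<lambda>x. \<phi> x * \<psi> x) x = \<phi> x * partial_deriv j \<psi> x + partial_deriv j \<phi> x * \<psi> x"
  using smooth_differentiable[OF assms(1), of x] smooth_differentiable[OF assms(2), of x]
  by (subst partial_deriv_eq[OF has_derivative_mult[OF
          frechet_derivative_works[THEN iffD1] frechet_derivative_works[THEN iffD1]]])
    (auto simp: partial_deriv_def)

lemma partial_deriv_add:
  assumes "smooth \<phi>" "smooth \<psi>"
  shows "partial_deriv j (\<lambda>x. \<phi> x + \<psi> x) x = partial_deriv j \<phi> x + partial_deriv j \<psi> x"
  using smooth_differentiable[OF assms(1), of x] smooth_differentiable[OF assms(2), of x]
  by (subst partial_deriv_eq[OF has_derivative_add[OF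
          frechet_derivative_works[THEN iffD1] frechet_derivative_works[THEN iffD1]]])
    (auto simp: partial_deriv_def)

lemma partial_deriv_const: "partial_deriv j (\<lambda>x. c) x = 0"
  by (subst partial_deriv_eq[OF has_derivative_const]) simp

lemma partial_deriv_cmult:
  assumes "smooth \<phi>"
  shows "partial_deriv j (\<lambda>x. c * \<phi> x) x = c * partial_deriv j \<phi> x"
  using partial_deriv_mult[OF smooth_const assms, of j c x] by (simp add: partial_deriv_const)

lemma partial_deriv_coord: "partial_deriv j (\<lambda>x. complex_of_real (x $ k)) x = (if j = k then 1 else 0)"
  by (subst partial_deriv_eq[OF has_derivative_coord]) (auto simp: axis_def)

lemma partial_deriv_affine:
  fixes L :: "real^3 \<Rightarrow> real^3"
  assumes "smooth \<phi>" "linear L"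
  shows "partial_deriv j (\<lambda>x. \<phi> (t + L x)) x
    = (\<Sum>k\<in>UNIV. (L (axis j 1)) $ k *\<^sub>R partial_deriv k \<phi> (t + L x))"
  by (rule partial_deriv_eq[OF has_derivative_affine_compose[OF assms]])

lemma smooth_continuous: "smooth \<phi> \<Longrightarrow> continuous_on S \<phi>"
  by (meson continuous_at_imp_continuous_on differentiable_imp_continuous_within smooth_differentiable)

lemma smooth_measurable: "smooth \<phi> \<Longrightarrow> \<phi> \<in> borel_measurable borel"
  by (intro borel_measurable_continuous_onI smooth_continuous)

subsection \<open>Compact support\<close>

lemma test_function_iff:
  "\<phi> \<in> test_functions \<longleftrightarrow> smooth \<phi> \<and> (\<exists>r. \<forall>x. r < norm x \<longrightarrow> \<phi> x = 0)"
proof -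
  have "bounded {x. \<phi> x \<noteq> 0} \<longleftrightarrow> (\<exists>r. \<forall>x. r < norm x \<longrightarrow> \<phi> x = 0)"
    unfolding bounded_iff mem_Collect_eq Ball_def not_le[symmetric] by blast
  then show ?thesis
    unfolding test_functions_def smooth_def mem_Collect_eq compact_closure by blast
qed

lemma test_smooth: "\<phi> \<in> test_functions \<Longrightarrow> smooth \<phi>"
  by (simp add: test_function_iff)

lemma test_support:
  assumes "\<phi> \<in> test_functions"
  obtains r where "r > 0" "\<And>x. r < norm x \<Longrightarrow> \<phi> x = 0"
proof -
  obtain r where "\<forall>x. r < norm x \<longrightarrow> \<phi> x = 0" using assms by (auto simp: test_function_iff)
  then show ?thesis by (intro that[of "max r 1"]) auto
qed

lemma test_mult_smooth:
  assumes "\<phi> \<in> test_functions" "smooth \<psi>"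
  shows "(\<lambda>x. \<psi> x * \<phi> x) \<in> test_functions" "(\<lambda>x. \<phi> x * \<psi> x) \<in> test_functions"
  using assms by (auto simp: test_function_iff intro: smooth_mult)

lemma test_add:
  assumes "\<phi> \<in> test_functions" "\<psi> \<in> test_functions"
  shows "(\<lambda>x. \<phi> x + \<psi> x) \<in> test_functions"
proof -
  obtain r s where "\<And>x. r < norm x \<Longrightarrow> \<phi> x = 0" "\<And>x. s < norm x \<Longrightarrow> \<psi> x = 0"
    using assms test_support by metis
  then show ?thesis
    using assms by (auto simp: test_function_iff intro!: smooth_add exI[of _ "max r s"])
qed

lemma test_cmult: "\<phi> \<in> test_functions \<Longrightarrow> (\<lambda>x. c * \<phi> x) \<in> test_functions"
  using test_mult_smooth(1)[OF _ smooth_const] .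

lemma test_scaleR: "\<phi> \<in> test_functions \<Longrightarrow> (\<lambda>x. c *\<^sub>R \<phi> x) \<in> test_functions"
  using test_cmult[of \<phi> "complex_of_real c"] by (simp add: scaleR_conv_of_real)

lemma test_zero: "(\<lambda>x. 0) \<in> test_functions"
  by (auto simp: test_function_iff smooth_const)

lemma partial_deriv_outside_support:
  assumes "\<And>x. r < norm x \<Longrightarrow> \<phi> x = 0" "r < norm x"
  shows "partial_deriv j \<phi> x = 0"
proof -
  have "(\<phi> has_derivative (\<lambda>h. 0)) (at x)"
    by (rule has_derivative_transform_within_open[OF has_derivative_const[of 0], where s = "{x. r < norm x}"])
      (use assms in \<open>auto intro!: open_Collect_less continuous_intros\<close>)
  from partial_deriv_eq[OF this] show ?thesis .
qed

lemma test_partial: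
  assumes "\<phi> \<in> test_functions"
  shows "partial_deriv j \<phi> \<in> test_functions"
proof -
  obtain r where "\<And>x. r < norm x \<Longrightarrow> \<phi> x = 0" using assms test_support by metis
  then have "\<And>x. r < norm x \<Longrightarrow> partial_deriv j \<phi> x = 0"
    by (rule partial_deriv_outside_support)
  then show ?thesis using assms by (auto simp: test_function_iff intro: smooth_partial)
qed

lemma test_affine:
  fixes L :: "real^3 \<Rightarrow> real^3"
  assumes "\<phi> \<in> test_functions" "linear L" and le: "\<And>x. norm x \<le> c * (1 + norm (t + L x))" and "c > 0"
  shows "(\<lambda>x. \<phi> (t + L x)) \<in> test_functions"
proof -
  obtain r where r: "\<And>x. r < norm x \<Longrightarrow> \<phi> x = 0" using assms test_support by metis
  have "\<phi> (t + L x) = 0" if "c * (1 + r) < norm x" for x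
  proof (rule r)
    have "c * (1 + r) < c * (1 + norm (t + L x))" using le[of x] that by linarith
    then show "r < norm (t + L x)" using \<open>c > 0\<close> by simp
  qed
  then show ?thesis using assms by (auto simp: test_function_iff intro: smooth_affine)
qed

lemma test_bounded:
  assumes "\<phi> \<in> test_functions"
  obtains B where "B > 0" "\<And>x. cmod (\<phi> x) \<le> B"
proof -
  obtain r where r: "\<And>x. r < norm x \<Longrightarrow> \<phi> x = 0" using assms test_support by metis
  have "bounded (\<phi> ` cball 0 r)"
    by (intro compact_imp_bounded compact_continuous_image smooth_continuous test_smooth assms) auto
  then obtain B where "\<forall>y\<in>\<phi> ` cball 0 r. cmod y \<le> B"
    unfolding bounded_iff by blast
  then have B: "\<And>x. x \<in> cball 0 r \<Longrightarrow> cmod (\<phi> x) \<le> B" by blast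
  show ?thesis
  proof (rule that[of "max B 1"])
    show "cmod (\<phi> x) \<le> max B 1" for x
      using B[of x] r[of x] by (cases "norm x \<le> r") auto
  qed auto
qed

lemma integrable_indicator_cball: "integrable lborel (\<lambda>x::real^3. B * indicator (cball 0 r) x :: real)"
  by (intro integrable_mult_right integrable_real_indicator emeasure_bounded_finite) auto

lemma indicator_cball_L2: "(\<lambda>x::real^3. B * indicator (cball 0 r) x :: real) \<in> L2"
proof (rule L2_I)
  have "(norm (B * indicator (cball 0 r) x))\<^sup>2 = B\<^sup>2 * indicator (cball 0 r) x" for x :: "real^3"
    by (auto simp: indicator_def)
  then show "integrable lborel (\<lambda>x::real^3. (norm (B * indicator (cball 0 r) x))\<^sup>2)"
    using integrable_indicator_cball[of "B\<^sup>2" r] by simp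
  have [measurable]: "cball 0 r \<in> sets (borel :: (real^3) measure)" by simp
  show "(\<lambda>x::real^3. B * indicator (cball 0 r) x :: real) \<in> borel_measurable lborel" by measurable
qed

lemma test_bound_indicator:
  assumes "\<phi> \<in> test_functions"
  obtains B r where "B > 0" "r > 0" "\<And>x. cmod (\<phi> x) \<le> B * indicator (cball 0 r) x"
proof -
  obtain B where "B > 0" "\<And>x. cmod (\<phi> x) \<le> B" by (rule test_bounded[OF assms]) blast
  moreover obtain r where "r > 0" "\<And>x. r < norm x \<Longrightarrow> \<phi> x = 0" using test_support[OF assms] by metis
  ultimately show ?thesis by (intro that[of B r]) (auto simp: indicator_def)
qed

lemma test_measurable: "\<phi> \<in> test_functions \<Longrightarrow> \<phi> \<in> borel_measurable borel"
  by (simp add: test_smooth smooth_measurable)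

lemma test_L2: assumes "\<phi> \<in> test_functions" shows "\<phi> \<in> L2"
proof -
  obtain B r where "\<And>x. cmod (\<phi> x) \<le> B * indicator (cball 0 r) x" by (rule test_bound_indicator[OF assms]) blast
  then show ?thesis
    by (intro L2_dominated[OF indicator_cball_L2[of B r], where C = 1])
      (use test_measurable[OF assms] in \<open>auto intro: order_trans[OF _ abs_ge_self]\<close>)
qed

lemma test_integrable: assumes "\<phi> \<in> test_functions" shows "integrable lborel \<phi>"
proof -
  obtain B r where "\<And>x. cmod (\<phi> x) \<le> B * indicator (cball 0 r) x" by (rule test_bound_indicator[OF assms]) blast
  then show ?thesis
    by (intro Bochner_Integration.integrable_bound[OF integrable_indicator_cball[of B r]])
      (use test_measurable[OF assms] in \<open>auto intro: order_trans[OF _ abs_ge_self]\<close>)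
qed

section \<open>Density of test functions and transport by measure-preserving maps\<close>

text \<open>The positive and the negative part of \<open>f\<close> are densities of two measures that agree on open
  boxes, an intersection-stable generator of the Borel sets.\<close>

lemma AE_zero_if_box_integrals_zero:
  fixes f :: "'a::euclidean_space \<Rightarrow> real"
  assumes m: "f \<in> borel_measurable borel"
    and i: "\<And>a b. integrable lborel (\<lambda>x. indicator (box a b) x * f x)"
    and z: "\<And>a b. (\<integral>x. indicator (box a b) x * f x \<partial>lborel) = 0"
  shows "AE x in lborel. f x = 0"
proof -
  let ?P = "\<lambda>x. ennreal (f x)" and ?N = "\<lambda>x. ennreal (- f x)"
  have eq: "emeasure (density lborel ?P) (box a b) = emeasure (density lborel ?N) (box a b)"
    and fin: "emeasure (density lborel ?P) (box a b) \<noteq> \<infinity>" for a b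
  proof -
    let ?g = "\<lambda>x. indicator (box a b) x * f x"
    have P: "emeasure (density lborel ?P) (box a b) = (\<integral>\<^sup>+x. ennreal (?g x) \<partial>lborel)"
      using m by (subst emeasure_density) (auto intro!: nn_integral_cong simp: indicator_def)
    have N: "emeasure (density lborel ?N) (box a b) = (\<integral>\<^sup>+x. ennreal (- ?g x) \<partial>lborel)"
      using m by (subst emeasure_density) (auto intro!: nn_integral_cong simp: indicator_def)
    have inj: "X = Y" if "X \<noteq> \<infinity>" "Y \<noteq> \<infinity>" "enn2real X = enn2real Y" for X Y :: ennreal
      using that by (cases X; cases Y) auto
    have f: "(\<integral>\<^sup>+x. ennreal (?g x) \<partial>lborel) \<noteq> \<infinity>" "(\<integral>\<^sup>+x. ennreal (- ?g x) \<partial>lborel) \<noteq> \<infinity>"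
      using i[of a b] unfolding real_integrable_def by blast+
    have "enn2real (\<integral>\<^sup>+x. ennreal (?g x) \<partial>lborel) = enn2real (\<integral>\<^sup>+x. ennreal (- ?g x) \<partial>lborel)"
      using real_lebesgue_integral_def[OF i[of a b]] z[of a b] by linarith
    then have "(\<integral>\<^sup>+x. ennreal (?g x) \<partial>lborel) = (\<integral>\<^sup>+x. ennreal (- ?g x) \<partial>lborel)"
      by (rule inj[OF f])
    then show "emeasure (density lborel ?P) (box a b) = emeasure (density lborel ?N) (box a b)"
      using P N by simp
    show "emeasure (density lborel ?P) (box a b) \<noteq> \<infinity>" using P f(1) by simp
  qed
  have "density lborel ?P = density lborel ?N"
  proof (rule measure_eqI_generator_eq)
    let ?E = "range (\<lambda>(a, b). box a b::'a set)"
    show "Int_stable ?E"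
      by (auto simp: Int_stable_def box_Int_box)
    show "?E \<subseteq> Pow UNIV" "sets (density lborel ?P) = sigma_sets UNIV ?E"
      "sets (density lborel ?N) = sigma_sets UNIV ?E"
      by (simp_all add: borel_eq_box)
    let ?A = "\<lambda>n::nat. box (- (real n *\<^sub>R One)) (real n *\<^sub>R One) :: 'a set"
    show "range ?A \<subseteq> ?E" "(\<Union>i. ?A i) = UNIV"
      unfolding UN_box_eq_UNIV by auto
    show "emeasure (density lborel ?P) (?A i) \<noteq> \<infinity>" for i by (rule fin)
    show "emeasure (density lborel ?P) X = emeasure (density lborel ?N) X" if "X \<in> ?E" for X
      using that eq by auto
  qed
  then have "AE x in lborel. ?P x = ?N x"
    using m by (intro sigma_finite_measure.density_unique[OF sigma_finite_lborel]) auto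
  then show ?thesis
  proof eventually_elim
    case (elim x)
    then show ?case by (cases "f x \<ge> 0") (auto simp: ennreal_neg ennreal_eq_0_iff)
  qed
qed

text \<open>The indicator of an open box is the pointwise limit of the products of the functions
  \<open>e\<^sup>-\<^sup>1\<^sup>/\<^sup>n\<^sup>t\<close>, taken at the distances \<open>t\<close> to the faces.\<close>

lemma box_indicator_limit_of_test_functions:
  fixes a b :: "real^3"
  obtains \<psi> where "\<And>n. \<psi> n \<in> test_functions"
    "\<And>n x. cmod (\<psi> n x) \<le> indicator (box a b) x"
    "\<And>x. (\<lambda>n::nat. \<psi> n x) \<longlonglongrightarrow> indicator (box a b) x"
proof
  define e where "e = flat_exp [:1:]"
  have e: "0 \<le> e t" "e t \<le> 1" "t \<le> 0 \<Longrightarrow> e t = 0" "t > 0 \<Longrightarrow> e t = exp (- (1 / t))" for t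
    by (auto simp: e_def flat_exp_def)
  define p where "p n x = (\<Prod>j\<in>UNIV. e (real (Suc n) * (x $ j - a $ j)) * e (real (Suc n) * (b $ j - x $ j)))"
    for n :: nat and x :: "real^3"
  define \<psi> where "\<psi> n x = complex_of_real (p n x)" for n x
  have le: "cmod (\<psi> n x) \<le> indicator (box a b) x" for n x
  proof (cases "x \<in> box a b")
    case True
    have "\<bar>p n x\<bar> = p n x" unfolding p_def by (intro abs_of_nonneg prod_nonneg mult_nonneg_nonneg ballI e)
    also have "\<dots> \<le> 1" unfolding p_def by (intro prod_le_1 conjI mult_nonneg_nonneg mult_le_one e)
    finally show ?thesis using True by (simp add: \<psi>_def)
  next
    case False
    then obtain j where "x $ j \<le> a $ j \<or> b $ j \<le> x $ j" by (auto simp: mem_box_cart not_less)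
    then have "e (real (Suc n) * (x $ j - a $ j)) * e (real (Suc n) * (b $ j - x $ j)) = 0"
      using e(3)[of "real (Suc n) * (x $ j - a $ j)"] e(3)[of "real (Suc n) * (b $ j - x $ j)"]
      by (auto simp: mult_le_0_iff)
    then have "p n x = 0" unfolding p_def by (intro prod_zero) auto
    then show ?thesis by (simp add: \<psi>_def)
  qed
  show "cmod (\<psi> n x) \<le> indicator (box a b) x" for n x by (rule le)
  show "\<psi> n \<in> test_functions" for n
  proof -
    have "smooth (\<lambda>x. \<Prod>j\<in>UNIV. complex_of_real (flat_exp [:1:] (real (Suc n) * x $ j + - real (Suc n) * a $ j))
      * complex_of_real (flat_exp [:1:] (- real (Suc n) * x $ j + real (Suc n) * b $ j)))"
      by (intro smooth_prod smooth_mult smooth_flat_exp)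
    also have "(\<lambda>x. \<Prod>j\<in>UNIV. complex_of_real (flat_exp [:1:] (real (Suc n) * x $ j + - real (Suc n) * a $ j))
      * complex_of_real (flat_exp [:1:] (- real (Suc n) * x $ j + real (Suc n) * b $ j))) = \<psi> n"
      unfolding \<psi>_def p_def e_def of_real_prod of_real_mult[where 'a = complex]
      by (intro ext prod.cong refl arg_cong2[where f = "(*)"] arg_cong[where f = "\<lambda>t. complex_of_real (flat_exp [:1:] t)"])
        (simp_all add: algebra_simps)
    finally have s: "smooth (\<psi> n)" .
    obtain r where r: "\<And>x. x \<in> box a b \<Longrightarrow> norm x \<le> r"
      using bounded_box[of a b] unfolding bounded_iff by blast
    have "\<psi> n x = 0" if "r < norm x" for x
    proof -
      have "x \<notin> box a b" using r[of x] that by force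
      then show ?thesis using le[of n x] by simp
    qed
    then show ?thesis using s by (auto simp: test_function_iff)
  qed
  show "(\<lambda>n. \<psi> n x) \<longlonglongrightarrow> indicator (box a b) x" for x
  proof (cases "x \<in> box a b")
    case True
    have lim: "(\<lambda>n. e (real (Suc n) * t)) \<longlonglongrightarrow> 1" if "t > 0" for t
    proof -
      have "(\<lambda>n. exp (- ((1 / t) * (1 / real (Suc n))))) \<longlonglongrightarrow> exp (- ((1 / t) * 0))"
        by (intro tendsto_intros LIMSEQ_Suc[OF lim_1_over_n])
      moreover have "e (real (Suc n) * t) = exp (- ((1 / t) * (1 / real (Suc n))))" for n
        using that by (subst e(4)) (auto simp: field_simps simp del: of_nat_Suc)
      ultimately show ?thesis by simp
    qed
    have "(\<lambda>n. \<psi> n x) \<longlonglongrightarrow> complex_of_real (\<Prod>j::3\<in>UNIV. 1 * 1)"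
      unfolding \<psi>_def p_def using True
      by (intro tendsto_intros lim) (auto simp: mem_box_cart)
    then show ?thesis using True by simp
  next
    case False
    then have "\<psi> n x = 0" for n using le[of n x] by simp
    then show ?thesis using False by simp
  qed
qed

lemma indicator_box_L2: "(\<lambda>x. indicator (box a b) x :: complex) \<in> L2"
proof -
  obtain r where "\<And>x. x \<in> box a b \<Longrightarrow> norm x \<le> r"
    using bounded_box[of a b] unfolding bounded_iff by blast
  then show ?thesis
    by (intro L2_dominated[OF indicator_cball_L2[of 1 r], where C = 1]) (auto simp: indicator_def)
qed

lemma test_functions_separate:
  assumes h: "h \<in> L2" and z: "\<And>\<psi>. \<psi> \<in> test_functions \<Longrightarrow> (\<integral>x. h x * \<psi> x \<partial>lborel) = 0"
  shows "AE x in lborel. h x = 0"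
proof -
  have hm [measurable]: "h \<in> borel_measurable borel" using L2_D(3)[OF h] .
  have i: "integrable lborel (\<lambda>x. indicator (box a b) x * h x)" for a b
    by (rule integrable_mult_L2[OF indicator_box_L2 h])
  have box: "(\<integral>x. indicator (box a b) x * h x \<partial>lborel) = 0" for a b
  proof -
    obtain \<psi> where \<psi>: "\<And>n. \<psi> n \<in> test_functions"
      "\<And>n x. cmod (\<psi> n x) \<le> indicator (box a b) x"
      "\<And>x. (\<lambda>n::nat. \<psi> n x) \<longlonglongrightarrow> indicator (box a b) x"
      by (rule box_indicator_limit_of_test_functions) blast
    have "(\<lambda>n. \<integral>x. \<psi> n x * h x \<partial>lborel) \<longlonglongrightarrow> (\<integral>x. indicator (box a b) x * h x \<partial>lborel)"
    proof (rule integral_dominated_convergence[where w = "\<lambda>x. cmod (indicator (box a b) x * h x)"])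
      show "AE x in lborel. (\<lambda>n. \<psi> n x * h x) \<longlonglongrightarrow> indicator (box a b) x * h x"
        by (intro AE_I2 tendsto_intros \<psi>)
      show "AE x in lborel. norm (\<psi> n x * h x) \<le> cmod (indicator (box a b) x * h x)" for n
      proof (rule AE_I2)
        fix x
        have "cmod (\<psi> n x) \<le> cmod (indicator (box a b) x)"
          using \<psi>(2)[of n x] by (cases "x \<in> box a b") auto
        then show "norm (\<psi> n x * h x) \<le> cmod (indicator (box a b) x * h x)"
          unfolding norm_mult by (rule mult_right_mono) simp
      qed
      show "(\<lambda>x. \<psi> n x * h x) \<in> borel_measurable lborel" for n
        using test_measurable[OF \<psi>(1)] by measurable
    qed (use i[of a b] in auto)
    moreover have "(\<integral>x. \<psi> n x * h x \<partial>lborel) = 0" for n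
      using z[OF \<psi>(1)] by (simp add: mult.commute)
    ultimately have "(\<lambda>n::nat. 0) \<longlonglongrightarrow> (\<integral>x. indicator (box a b) x * h x \<partial>lborel)" by simp
    then show ?thesis by (simp only: LIMSEQ_const_iff)
  qed
  have Re: "AE x in lborel. Re (h x) = 0"
  proof (rule AE_zero_if_box_integrals_zero)
    fix a b :: "real^3"
    have eq: "indicator (box a b) x * Re (h x) = Re (indicator (box a b) x * h x)" for x
      by (simp add: indicator_def)
    show "integrable lborel (\<lambda>x. indicator (box a b) x * Re (h x))"
      unfolding eq by (intro integrable_Re i)
    show "(\<integral>x. indicator (box a b) x * Re (h x) \<partial>lborel) = 0"
      unfolding eq integral_Re[OF i] box by simp
  qed measurable
  have Im: "AE x in lborel. Im (h x) = 0"
  proof (rule AE_zero_if_box_integrals_zero)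
    fix a b :: "real^3"
    have eq: "indicator (box a b) x * Im (h x) = Im (indicator (box a b) x * h x)" for x
      by (simp add: indicator_def)
    show "integrable lborel (\<lambda>x. indicator (box a b) x * Im (h x))"
      unfolding eq by (intro integrable_Im i)
    show "(\<integral>x. indicator (box a b) x * Im (h x) \<partial>lborel) = 0"
      unfolding eq integral_Im[OF i] box by simp
  qed measurable
  show ?thesis using Re Im by eventually_elim (simp add: complex_eq_iff)
qed

lemma test_functions_separate_eq:
  assumes "g \<in> L2" "h \<in> L2"
    and eq: "\<And>\<psi>. \<psi> \<in> test_functions \<Longrightarrow> (\<integral>x. g x * \<psi> x \<partial>lborel) = (\<integral>x. h x * \<psi> x \<partial>lborel)"
  shows "AE x in lborel. g x = h x"
proof -
  have "AE x in lborel. g x - h x = 0"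
  proof (rule test_functions_separate[OF L2_diff[OF assms(1,2)]])
    fix \<psi> assume t: "\<psi> \<in> test_functions"
    show "(\<integral>x. (g x - h x) * \<psi> x \<partial>lborel) = 0"
      unfolding left_diff_distrib
      by (subst Bochner_Integration.integral_diff)
        (auto intro!: integrable_mult_L2 assms test_L2 t simp: eq[OF t])
  qed
  then show ?thesis by simp
qed

lemma inner_complex_Re: "v \<bullet> w = Re (cnj v * w)"
  by (simp add: inner_complex_def)

text \<open>Density follows from separation by the projection theorem.\<close>

lemma test_functions_dense:
  assumes u: "u \<in> L2" and e: "e > 0"
  shows "\<exists>\<psi>\<in>test_functions. L2_norm (\<lambda>x. \<psi> x - u x) < e"
proof (rule ccontr)
  assume "\<not> ?thesis"
  then have far: "\<And>\<psi>. \<psi> \<in> test_functions \<Longrightarrow> L2_norm (\<lambda>x. \<psi> x - u x) \<ge> e" by force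
  obtain v where v: "v \<in> L2" "\<And>\<psi>. \<psi> \<in> test_functions \<Longrightarrow> (\<integral>x. v x \<bullet> \<psi> x \<partial>lborel) = 0"
    "\<not> (AE x in lborel. v x = 0)"
    using L2_orthogonal_complement[of test_functions, OF _ _ test_add test_scaleR u e far]
      test_L2 test_zero by blast
  have "(\<integral>x. cnj (v x) * \<psi> x \<partial>lborel) = 0" if t: "\<psi> \<in> test_functions" for \<psi>
  proof -
    have i: "integrable lborel (\<lambda>x. cnj (v x) * \<psi> x)" if "\<psi> \<in> test_functions" for \<psi>
      by (intro integrable_mult_L2 L2_cnj v test_L2 that)
    have re: "Re (\<integral>x. cnj (v x) * \<psi> x \<partial>lborel) = 0" if "\<psi> \<in> test_functions" for \<psi>
      using v(2)[OF that] unfolding inner_complex_Re integral_Re[OF i[OF that]] .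
    have "Re (\<integral>x. cnj (v x) * (\<i> * \<psi> x) \<partial>lborel) = 0" by (rule re[OF test_cmult[OF t]])
    also have "(\<integral>x. cnj (v x) * (\<i> * \<psi> x) \<partial>lborel) = \<i> * (\<integral>x. cnj (v x) * \<psi> x \<partial>lborel)"
      by (simp add: mult.left_commute)
    finally show ?thesis using re[OF t] by (simp add: complex_eq_iff)
  qed
  then have "AE x in lborel. cnj (v x) = 0"
    by (rule test_functions_separate[OF L2_cnj[OF v(1)]])
  then show False using v(3) by simp
qed

lemma test_functions_dense_seq:
  assumes u: "u \<in> L2"
  obtains \<psi> where "\<And>n::nat. \<psi> n \<in> test_functions" "(\<lambda>n. L2_norm (\<lambda>x. \<psi> n x - u x)) \<longlonglongrightarrow> 0"
proof -
  have "\<exists>\<psi>\<in>test_functions. L2_norm (\<lambda>x. \<psi> x - u x) < 1 / real (Suc n)" for n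
    by (rule test_functions_dense[OF u]) simp
  then obtain \<psi> where \<psi>: "\<And>n. \<psi> n \<in> test_functions" "\<And>n. L2_norm (\<lambda>x. \<psi> n x - u x) < 1 / real (Suc n)"
    by metis
  have "(\<lambda>n. L2_norm (\<lambda>x. \<psi> n x - u x)) \<longlonglongrightarrow> 0"
    by (rule tendsto_sandwich[OF always_eventually always_eventually tendsto_const LIMSEQ_Suc[OF lim_1_over_n]])
      (use \<psi>(2) less_imp_le in auto)
  then show ?thesis using that \<psi>(1) by blast
qed

subsection \<open>Measure-preserving maps\<close>

definition lborel_preserving :: "(real^3 \<Rightarrow> real^3) \<Rightarrow> bool" where
  "lborel_preserving \<tau> \<longleftrightarrow> \<tau> \<in> borel_measurable borel \<and> distr lborel borel \<tau> = lborel"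

lemma lborel_preserving_integral:
  fixes f :: "real^3 \<Rightarrow> 'b::{banach, second_countable_topology}"
  assumes "lborel_preserving \<tau>" "f \<in> borel_measurable borel"
  shows "(\<integral>x. f (\<tau> x) \<partial>lborel) = (\<integral>x. f x \<partial>lborel)"
  using integral_distr[of \<tau> lborel borel f] assms by (simp add: lborel_preserving_def)

lemma lborel_preserving_integrable:
  fixes f :: "real^3 \<Rightarrow> 'b::{banach, second_countable_topology}"
  assumes "lborel_preserving \<tau>" "f \<in> borel_measurable borel"
  shows "integrable lborel (\<lambda>x. f (\<tau> x)) \<longleftrightarrow> integrable lborel f"
  using integrable_distr_eq[of \<tau> lborel borel f] assms by (simp add: lborel_preserving_def)

lemma lborel_preserving_L2:
  assumes \<tau>: "lborel_preserving \<tau>" and u: "u \<in> L2"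
  shows "(\<lambda>x. u (\<tau> x)) \<in> L2" "L2_norm (\<lambda>x. u (\<tau> x)) = L2_norm u"
proof -
  have [measurable]: "u \<in> borel_measurable borel" "\<tau> \<in> borel_measurable borel"
    using L2_D(3)[OF u] \<tau> by (auto simp: lborel_preserving_def)
  have m: "(\<lambda>x. (norm (u x))\<^sup>2) \<in> borel_measurable borel" by measurable
  show "(\<lambda>x. u (\<tau> x)) \<in> L2"
    using lborel_preserving_integrable[OF \<tau> m] L2_D(2)[OF u] by (intro L2_I) auto
  show "L2_norm (\<lambda>x. u (\<tau> x)) = L2_norm u"
    using lborel_preserving_integral[OF \<tau> m] by (simp add: L2_norm_def)
qed

lemma lborel_preserving_translation: "lborel_preserving (\<lambda>x. c + x)"
  using lborel_distr_plus[of c] by (auto simp: lborel_preserving_def)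

lemma lborel_preserving_uminus: "lborel_preserving uminus"
  using lborel_affine[of "-1" "0::real^3"] by (simp add: lborel_preserving_def density_1)

text \<open>Strong continuity: immediate for test functions by dominated convergence, and transferred
  to \<open>L\<^sup>2\<close> by density, the maps being isometries.\<close>

lemma L2_transport_continuous:
  fixes u :: "real^3 \<Rightarrow> complex"
  assumes \<tau>: "\<And>n. lborel_preserving (\<tau> n)" and lim: "\<And>x. (\<lambda>n::nat. \<tau> n x) \<longlonglongrightarrow> x"
    and c: "\<And>n x. norm x \<le> c * (1 + norm (\<tau> n x))" "c > 0" and u: "u \<in> L2"
  shows "(\<lambda>n. L2_norm (\<lambda>x. u (\<tau> n x) - u x)) \<longlonglongrightarrow> 0"
proof (rule LIMSEQ_I)
  fix e :: real assume e: "e > 0"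
  obtain \<psi> where \<psi>: "\<psi> \<in> test_functions" "L2_norm (\<lambda>x. \<psi> x - u x) < e / 3"
    using test_functions_dense[OF u, of "e / 3"] e by auto
  obtain B r where B: "B > 0" "r > 0" "\<And>x. cmod (\<psi> x) \<le> B * indicator (cball 0 r) x"
    by (rule test_bound_indicator[OF \<psi>(1)]) blast
  have [measurable]: "\<psi> \<in> borel_measurable borel" "\<tau> n \<in> borel_measurable borel" for n
    using test_measurable[OF \<psi>(1)] \<tau>[of n] by (auto simp: lborel_preserving_def)
  define R where "R = max r (c * (1 + r))"
  have "(\<lambda>n. L2_norm (\<lambda>x. \<psi> (\<tau> n x) - \<psi> x)) \<longlonglongrightarrow> 0"
  proof (rule L2_dominated_tendsto[OF indicator_cball_L2[of "2 * B" R], where C = 1])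
    fix n x
    have 1: "cmod (\<psi> x) \<le> B * indicator (cball 0 R) x"
      using B by (intro order_trans[OF B(3)] mult_left_mono) (auto simp: indicator_def R_def)
    have 2: "cmod (\<psi> (\<tau> n x)) \<le> B * indicator (cball 0 R) x"
    proof (cases "norm (\<tau> n x) \<le> r")
      case True
      then have "c * (1 + norm (\<tau> n x)) \<le> c * (1 + r)" using c(2) by (intro mult_left_mono) auto
      then have "norm x \<le> R" using c(1)[of x n] by (simp add: R_def)
      then show ?thesis using B(3)[of "\<tau> n x"] True by simp
    next
      case False
      then show ?thesis using B(3)[of "\<tau> n x"] B(1) by simp
    qed
    show "norm (\<psi> (\<tau> n x) - \<psi> x) \<le> 1 * norm (2 * B * indicator (cball 0 R) x)"
      using norm_triangle_ineq4[of "\<psi> (\<tau> n x)" "\<psi> x"] 1 2 B(1) by (simp add: abs_mult)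
  next
    show "AE x in lborel. (\<lambda>n. \<psi> (\<tau> n x) - \<psi> x) \<longlonglongrightarrow> 0"
    proof (rule AE_I2)
      fix x
      have "isCont \<psi> x"
        using smooth_continuous[OF test_smooth[OF \<psi>(1)], of UNIV] by (simp add: continuous_on_eq_continuous_at)
      from isCont_tendsto_compose[OF this lim] show "(\<lambda>n. \<psi> (\<tau> n x) - \<psi> x) \<longlonglongrightarrow> 0"
        by (simp add: LIM_zero)
    qed
  qed measurable
  from LIMSEQ_D[OF this, of "e / 3"] e obtain N where N: "\<And>n. n \<ge> N \<Longrightarrow> L2_norm (\<lambda>x. \<psi> (\<tau> n x) - \<psi> x) < e / 3"
    by auto
  have "L2_norm (\<lambda>x. u (\<tau> n x) - u x) < e" if "n \<ge> N" for n
  proof -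
    note L = lborel_preserving_L2(1)[OF \<tau>[of n] u] lborel_preserving_L2(1)[OF \<tau>[of n] test_L2[OF \<psi>(1)]]
      test_L2[OF \<psi>(1)]
    have "L2_norm (\<lambda>x. u (\<tau> n x) - \<psi> (\<tau> n x)) = L2_norm (\<lambda>x. u x - \<psi> x)"
      by (rule lborel_preserving_L2(2)[OF \<tau> L2_diff[OF u L(3)]])
    then show ?thesis
      using L2_norm_triangle_via[OF L(1) L(2) u] L2_norm_triangle_via[OF L(2) L(3) u] N[OF that] \<psi>(2)
        L2_norm_commute[of u \<psi>] by linarith
  qed
  then show "\<exists>N. \<forall>n\<ge>N. norm (L2_norm (\<lambda>x. u (\<tau> n x) - u x) - 0) < e" by auto
qed

text \<open>For dominated convergence along the maps \<open>x \<mapsto> x + h X(x)\<close>, which will be translations and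
  shears: the Lipschitz bound controls the quotients on bounded sets, and the last assumption keeps
  their supports in one ball.\<close>

lemma test_flow_quotient:
  assumes \<phi>: "\<phi> \<in> test_functions"
    and X: "\<And>x. norm (X x) \<le> c * (1 + norm x)" and c: "c > 0"
    and h: "\<And>n. h n \<noteq> 0" "h \<longlonglongrightarrow> 0" "\<And>n x. norm x \<le> c * (1 + norm (x + h n *\<^sub>R X x))"
  obtains B R where "\<And>n x. cmod ((\<phi> (x + h n *\<^sub>R X x) - \<phi> x) / complex_of_real (h n)) \<le> B * indicator (cball 0 R) x"
    "\<And>x. (\<lambda>n::nat. (\<phi> (x + h n *\<^sub>R X x) - \<phi> x) / complex_of_real (h n)) \<longlonglongrightarrow> (\<Sum>j\<in>UNIV. X x $ j *\<^sub>R partial_deriv j \<phi> x)"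
proof -
  obtain r where r: "r > 0" "\<And>x. r < norm x \<Longrightarrow> \<phi> x = 0" using test_support[OF \<phi>] by metis
  define D where "D = (\<lambda>x v. \<Sum>j\<in>UNIV. v $ j *\<^sub>R partial_deriv j \<phi> x)"
  have D: "(\<phi> has_derivative D x) (at x)" for x
    unfolding D_def by (rule smooth_has_derivative[OF test_smooth[OF \<phi>]])
  have "\<exists>b. \<forall>x. cmod (partial_deriv j \<phi> x) \<le> b" for j
    using test_bounded[OF test_partial[OF \<phi>]] by metis
  then obtain b where b: "\<And>j x. cmod (partial_deriv j \<phi> x) \<le> b j" by metis
  define K where "K = (\<Sum>j\<in>UNIV. b j)"
  have b0: "0 \<le> b j" for j using b[of j 0] norm_ge_zero order_trans by blast
  then have K0: "0 \<le> K" unfolding K_def by (intro sum_nonneg)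
  have "onorm (D x) \<le> K" for x
  proof (rule onorm_le)
    fix v :: "real^3"
    have "norm (D x v) \<le> (\<Sum>j\<in>UNIV. norm (v $ j *\<^sub>R partial_deriv j \<phi> x))"
      unfolding D_def by (rule norm_sum)
    also have "\<dots> \<le> (\<Sum>j\<in>UNIV. norm v * b j)"
      by (intro sum_mono) (auto intro!: mult_mono b component_le_norm_cart)
    finally show "norm (D x v) \<le> K * norm v" by (simp add: K_def sum_distrib_left mult.commute)
  qed
  then have Lip: "cmod (\<phi> x - \<phi> y) \<le> K * norm (x - y)" for x y
    by (intro differentiable_bound[of UNIV \<phi> D]) (auto intro: has_derivative_at_withinI D)
  define R where "R = max r (c * (1 + r))"
  have 1: "cmod ((\<phi> (x + h n *\<^sub>R X x) - \<phi> x) / complex_of_real (h n)) \<le> (K * (c * (1 + R))) * indicator (cball 0 R) x" for n x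
  proof (cases "norm x \<le> R")
    case True
    have "cmod (\<phi> (x + h n *\<^sub>R X x) - \<phi> x) \<le> K * (\<bar>h n\<bar> * norm (X x))"
      using Lip[of "x + h n *\<^sub>R X x" x] by simp
    also have "\<dots> \<le> K * (\<bar>h n\<bar> * (c * (1 + R)))"
      using True c by (intro mult_left_mono order_trans[OF X] K0) auto
    finally show ?thesis using True h(1)[of n] by (simp add: norm_divide field_simps)
  next
    case False
    have "r < norm (x + h n *\<^sub>R X x)"
    proof (rule ccontr)
      assume "\<not> ?thesis"
      then have "c * (1 + norm (x + h n *\<^sub>R X x)) \<le> c * (1 + r)" using c by (intro mult_left_mono) auto
      then show False using h(3)[of x n] False by (simp add: R_def)
    qed
    then show ?thesis using r(2)[of x] r(2)[of "x + h n *\<^sub>R X x"] False by (simp add: R_def)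
  qed
  have 2: "(\<lambda>n. (\<phi> (x + h n *\<^sub>R X x) - \<phi> x) / complex_of_real (h n)) \<longlonglongrightarrow> (\<Sum>j\<in>UNIV. X x $ j *\<^sub>R partial_deriv j \<phi> x)" for x
  proof -
    have "((\<lambda>s. x + s *\<^sub>R X x) has_derivative (\<lambda>s. s *\<^sub>R X x)) (at 0)"
      by (auto intro!: derivative_eq_intros)
    from diff_chain_at[OF this, of \<phi> "D x"] D[of x]
    have "((\<lambda>s. \<phi> (x + s *\<^sub>R X x)) has_derivative (\<lambda>s. D x (s *\<^sub>R X x))) (at 0)"
      by (simp add: o_def)
    moreover have "D x (s *\<^sub>R X x) = s *\<^sub>R D x (X x)" for s
      using linear_scale[OF has_derivative_linear[OF D]] .
    ultimately have "((\<lambda>s. \<phi> (x + s *\<^sub>R X x)) has_vector_derivative D x (X x)) (at 0)"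
      by (simp add: has_vector_derivative_def)
    then have "(\<lambda>s. norm (\<phi> (x + s *\<^sub>R X x) - \<phi> x - s *\<^sub>R D x (X x)) / norm s) \<midarrow>0\<rightarrow> 0"
      unfolding has_vector_derivative_def has_derivative_at by simp
    then have "(\<lambda>n. norm (\<phi> (x + h n *\<^sub>R X x) - \<phi> x - h n *\<^sub>R D x (X x)) / norm (h n)) \<longlonglongrightarrow> 0"
      using h unfolding tendsto_at_iff_sequentially by (auto simp: o_def)
    moreover have "norm (\<phi> (x + h n *\<^sub>R X x) - \<phi> x - h n *\<^sub>R D x (X x)) / norm (h n)
      = norm ((\<phi> (x + h n *\<^sub>R X x) - \<phi> x) / complex_of_real (h n) - D x (X x))" for n
    proof -
      have "(\<phi> (x + h n *\<^sub>R X x) - \<phi> x) / complex_of_real (h n) - D x (X x)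
        = (\<phi> (x + h n *\<^sub>R X x) - \<phi> x - h n *\<^sub>R D x (X x)) / complex_of_real (h n)"
        using h(1)[of n] by (simp add: scaleR_conv_of_real diff_divide_distrib)
      then show ?thesis by (simp add: norm_divide)
    qed
    ultimately have "(\<lambda>n. norm ((\<phi> (x + h n *\<^sub>R X x) - \<phi> x) / complex_of_real (h n) - D x (X x))) \<longlonglongrightarrow> 0"
      by simp
    then show ?thesis unfolding D_def tendsto_norm_zero_iff by (rule LIM_zero_cancel)
  qed
  show ?thesis using 1 2 by (rule that)
qed

text \<open>The difference quotients have integral zero by translation invariance.\<close>

lemma integral_partial_deriv_eq_0:
  assumes \<phi>: "\<phi> \<in> test_functions"
  shows "(\<integral>x. partial_deriv j \<phi> x \<partial>lborel) = 0"
proof -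
  define h where "h n = 1 / real (Suc n)" for n
  have h: "h n \<noteq> 0" "h n \<le> 1" "h n \<ge> 0" for n by (auto simp: h_def)
  have h0: "h \<longlonglongrightarrow> 0" unfolding h_def by (rule LIMSEQ_Suc[OF lim_1_over_n])
  have ax: "norm (axis j 1 :: real^3) = 1" by simp
  have hb: "norm x \<le> 2 * (1 + norm (x + h n *\<^sub>R axis j 1))" for n and x :: "real^3"
  proof -
    have "norm x = norm ((x + h n *\<^sub>R axis j 1) - h n *\<^sub>R axis j 1)" by simp
    also have "\<dots> \<le> norm (x + h n *\<^sub>R axis j 1) + norm (h n *\<^sub>R axis j (1::real) :: real^3)" by (rule norm_triangle_ineq4)
    also have "norm (h n *\<^sub>R axis j (1::real) :: real^3) = h n" using h(3)[of n] by simp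
    finally show ?thesis using h(2)[of n] norm_ge_zero[of "x + h n *\<^sub>R axis j 1"]
      unfolding distrib_left by linarith
  qed
  obtain B R where B: "\<And>n x. cmod ((\<phi> (x + h n *\<^sub>R axis j 1) - \<phi> x) / complex_of_real (h n)) \<le> B * indicator (cball 0 R) x"
    "\<And>x. (\<lambda>n. (\<phi> (x + h n *\<^sub>R axis j 1) - \<phi> x) / complex_of_real (h n)) \<longlonglongrightarrow>
      (\<Sum>k\<in>UNIV. (axis j 1 :: real^3) $ k *\<^sub>R partial_deriv k \<phi> x)"
    using test_flow_quotient[OF \<phi>, of "\<lambda>x. axis j 1" 2 h] h h0 hb ax by auto
  have ph: "(\<Sum>k\<in>UNIV. (axis j 1 :: real^3) $ k *\<^sub>R partial_deriv k \<phi> x) = partial_deriv j \<phi> x" for x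
    by (simp add: axis_def if_distrib[of "\<lambda>a. a *\<^sub>R _"] sum.delta cong: if_cong)
  have [measurable]: "\<phi> \<in> borel_measurable borel" "partial_deriv j \<phi> \<in> borel_measurable borel"
    using test_measurable[OF \<phi>] test_measurable[OF test_partial[OF \<phi>]] .
  have "(\<lambda>n. \<integral>x. (\<phi> (x + h n *\<^sub>R axis j 1) - \<phi> x) / complex_of_real (h n) \<partial>lborel) \<longlonglongrightarrow> (\<integral>x. partial_deriv j \<phi> x \<partial>lborel)"
    by (rule integral_dominated_convergence[OF _ _ integrable_indicator_cball[of B R]])
      (use B in \<open>auto simp: ph\<close>)
  moreover have "(\<integral>x. (\<phi> (x + h n *\<^sub>R axis j 1) - \<phi> x) / complex_of_real (h n) \<partial>lborel) = 0" for n
  proof -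
    note T = lborel_preserving_translation[of "h n *\<^sub>R axis j 1"]
    have "integrable lborel (\<lambda>x. \<phi> (h n *\<^sub>R axis j 1 + x))"
      using lborel_preserving_integrable[OF T, of \<phi>] test_integrable[OF \<phi>] by simp
    then show ?thesis
      using lborel_preserving_integral[OF T, of \<phi>] test_integrable[OF \<phi>]
      by (simp add: add.commute)
  qed
  ultimately have "(\<lambda>n::nat. 0) \<longlonglongrightarrow> (\<integral>x. partial_deriv j \<phi> x \<partial>lborel)" by (simp only:)
  then show ?thesis by (simp only: LIMSEQ_const_iff)
qed

lemma integral_by_parts:
  assumes \<phi>: "\<phi> \<in> test_functions" and \<psi>: "smooth \<psi>"
  shows "(\<integral>x. \<psi> x * partial_deriv j \<phi> x \<partial>lborel) = - (\<integral>x. partial_deriv j \<psi> x * \<phi> x \<partial>lborel)"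
proof -
  have "(\<integral>x. \<psi> x * partial_deriv j \<phi> x + partial_deriv j \<psi> x * \<phi> x \<partial>lborel) = 0"
    using integral_partial_deriv_eq_0[OF test_mult_smooth(1)[OF \<phi> \<psi>], of j]
    by (simp add: partial_deriv_mult[OF \<psi> test_smooth[OF \<phi>]])
  moreover have "integrable lborel (\<lambda>x. \<psi> x * partial_deriv j \<phi> x)" "integrable lborel (\<lambda>x. partial_deriv j \<psi> x * \<phi> x)"
    by (intro test_integrable test_mult_smooth test_partial \<phi> \<psi> smooth_partial)+
  ultimately show ?thesis by (simp add: eq_neg_iff_add_eq_0)
qed

subsection \<open>The shear group\<close>

definition shear :: "real \<Rightarrow> real^3 \<Rightarrow> real^3" where
  "shear t x = x + (t * x $ 1) *\<^sub>R axis 2 1"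

lemma shear_nth [simp]: "shear t x $ 1 = x $ 1" "shear t x $ 2 = x $ 2 + t * x $ 1" "shear t x $ 3 = x $ 3"
  by (simp_all add: shear_def axis_def)

lemma shear_shear: "shear s (shear t x) = shear (s + t) x"
  by (simp add: vec_eq_iff forall_3 algebra_simps)

lemma shear_0 [simp]: "shear 0 x = x"
  by (simp add: shear_def)

lemma linear_shear: "linear (shear t)"
  by (rule linearI) (auto simp: shear_def algebra_simps)

lemma norm_shear_le: "norm (shear t x) \<le> (1 + \<bar>t\<bar>) * norm x"
proof -
  have "norm (shear t x) \<le> norm x + norm ((t * x $ 1) *\<^sub>R axis 2 (1::real) :: real^3)"
    unfolding shear_def by (rule norm_triangle_ineq)
  also have "norm ((t * x $ 1) *\<^sub>R axis 2 (1::real) :: real^3) \<le> \<bar>t\<bar> * norm x"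
    using component_le_norm_cart[of x 1] by (simp add: abs_mult mult_left_mono)
  finally show ?thesis by (simp add: algebra_simps)
qed

lemma norm_le_shear: "norm x \<le> (1 + \<bar>t\<bar>) * norm (shear t x)"
  using norm_shear_le[of "- t" "shear t x"] by (simp add: shear_shear)

lemma shear_measurable [measurable]: "shear t \<in> borel_measurable borel"
  by (intro borel_measurable_continuous_onI linear_continuous_on linear_conv_bounded_linear[THEN iffD1] linear_shear)

lemma lborel_preserving_shear: "lborel_preserving (shear t)"
proof -
  have "lborel = distr lborel borel (shear t)"
  proof (rule lborel_eqI)
    fix l u :: "real^3" assume le: "\<And>b. b \<in> Basis \<Longrightarrow> l \<bullet> b \<le> u \<bullet> b"
    have vi: "shear t -` A = shear (- t) ` A" for A
    proof (intro set_eqI iffI)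
      fix x assume "x \<in> shear t -` A"
      then have "shear (- t) (shear t x) \<in> shear (- t) ` A" by blast
      then show "x \<in> shear (- t) ` A" by (simp add: shear_shear)
    qed (auto simp: shear_shear)
    have det: "det (matrix (shear (- t))) = 1"
      by (simp add: det_3 matrix_def axis_def)
    have bm: "shear t -` box l u \<in> sets borel"
      using measurable_sets[OF shear_measurable, of "box l u" t] by simp
    have bd: "bounded (shear t -` box l u)"
      unfolding vi by (intro bounded_linear_image bounded_box linear_conv_bounded_linear[THEN iffD1] linear_shear)
    have "emeasure (distr lborel borel (shear t)) (box l u) = emeasure lborel (shear t -` box l u)"
      by (subst emeasure_distr) auto
    also have "\<dots> = ennreal (measure lborel (shear t -` box l u))"
      using emeasure_bounded_finite[OF bd] by (intro emeasure_eq_ennreal_measure) auto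
    also have "measure lborel (shear t -` box l u) = measure lebesgue (shear (- t) ` box l u)"
      using bm by (simp add: vi)
    also have "\<dots> = measure lborel (box l u)"
      using measure_linear_image[OF linear_shear lmeasurable_box, of "- t" l u] det by simp
    also have "ennreal (measure lborel (box l u)) = (\<Prod>b\<in>Basis. (u - l) \<bullet> b)"
      using le by (simp add: inner_diff_left)
    finally show "emeasure (distr lborel borel (shear t)) (box l u) = (\<Prod>b\<in>Basis. (u - l) \<bullet> b)" .
  qed simp
  then show ?thesis by (simp add: lborel_preserving_def)
qed

lemma test_shear: "\<phi> \<in> test_functions \<Longrightarrow> (\<lambda>x. \<phi> (shear t x)) \<in> test_functions"
proof -
  assume \<phi>: "\<phi> \<in> test_functions"
  have "norm x \<le> (1 + \<bar>t\<bar>) * (1 + norm (0 + shear t x))" for x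
    using norm_le_shear[of x t] mult_left_mono[of "norm (shear t x)" "1 + norm (shear t x)" "1 + \<bar>t\<bar>"] by simp
  from test_affine[OF \<phi> linear_shear this] show ?thesis by simp
qed

section \<open>The Plancherel theorem\<close>

definition FT :: "(real^3 \<Rightarrow> complex) \<Rightarrow> real^3 \<Rightarrow> complex" where
  "FT f \<xi> = (\<integral>x. exp (- \<i> * complex_of_real (x \<bullet> \<xi>)) * f x \<partial>lborel)"

lemma cmod_character [simp]: "cmod (exp (- \<i> * complex_of_real t)) = 1"
  "cmod (exp (- (\<i> * complex_of_real t))) = 1"
  by (simp_all add: norm_exp_eq_Re)

lemma character_measurable [measurable]:
  "(\<lambda>x. exp (- \<i> * complex_of_real (x \<bullet> \<xi>))) \<in> borel_measurable (borel :: (real^3) measure)"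
  by measurable

lemma integrable_character_mult:
  assumes "integrable lborel f"
  shows "integrable lborel (\<lambda>x. exp (- \<i> * complex_of_real (x \<bullet> \<xi>)) * f x)"
proof (rule Bochner_Integration.integrable_bound[OF assms])
  have [measurable]: "f \<in> borel_measurable borel" using borel_measurable_integrable[OF assms] by simp
  show "(\<lambda>x. exp (- \<i> * complex_of_real (x \<bullet> \<xi>)) * f x) \<in> borel_measurable lborel" by measurable
qed (simp add: norm_mult)

lemma FT_bound: "cmod (FT f \<xi>) \<le> (\<integral>x. cmod (f x) \<partial>lborel)"
  unfolding FT_def
  using integral_norm_bound[of lborel "\<lambda>x. exp (- \<i> * complex_of_real (x \<bullet> \<xi>)) * f x"]
  by (simp add: norm_mult)

lemma FT_measurable [measurable]:
  assumes [measurable]: "f \<in> borel_measurable borel"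
  shows "FT f \<in> borel_measurable borel"
proof -
  have "(\<lambda>\<xi>. \<integral>x. exp (- \<i> * complex_of_real (x \<bullet> \<xi>)) * f x \<partial>lborel) \<in> borel_measurable borel"
    by (rule sigma_finite_measure.borel_measurable_lebesgue_integral[OF sigma_finite_lborel]) measurable
  then show ?thesis by (simp add: FT_def[abs_def])
qed

lemma FT_diff:
  assumes "integrable lborel f" "integrable lborel g"
  shows "FT (\<lambda>x. f x - g x) \<xi> = FT f \<xi> - FT g \<xi>"
  unfolding FT_def right_diff_distrib
  by (rule Bochner_Integration.integral_diff) (intro integrable_character_mult assms)+

lemma FT_add:
  assumes "integrable lborel f" "integrable lborel g"
  shows "FT (\<lambda>x. f x + g x) \<xi> = FT f \<xi> + FT g \<xi>"
  unfolding FT_def distrib_left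
  by (rule Bochner_Integration.integral_add) (intro integrable_character_mult assms)+

lemma FT_cmult: "FT (\<lambda>x. c * f x) \<xi> = c * FT f \<xi>"
  unfolding FT_def by (simp add: mult.left_commute)

lemma cnj_FT: "cnj (FT f \<xi>) = FT (\<lambda>x. cnj (f x)) (- \<xi>)"
  unfolding FT_def by (subst Bochner_Integration.integral_cnj[symmetric]) (simp add: exp_cnj)

lemma swap_integrals:
  fixes F :: "real^3 \<Rightarrow> real^3 \<Rightarrow> complex"
  assumes m: "(\<lambda>(x, y). F x y) \<in> borel_measurable (lborel \<Otimes>\<^sub>M lborel)"
    and le: "\<And>x y. cmod (F x y) \<le> G x y"
    and G: "\<And>x. integrable lborel (G x)" "integrable lborel (\<lambda>x. \<integral>y. G x y \<partial>lborel)"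
  shows "(\<integral>x. \<integral>y. F x y \<partial>lborel \<partial>lborel) = (\<integral>y. \<integral>x. F x y \<partial>lborel \<partial>lborel)"
proof -
  have [measurable]: "(\<lambda>(x, y). F x y) \<in> borel_measurable (lborel \<Otimes>\<^sub>M lborel)" by (rule m)
  have i: "integrable lborel (F x)" for x
    by (rule Bochner_Integration.integrable_bound[OF G(1)]) (measurable, use le in \<open>auto intro: order_trans[OF _ abs_ge_self]\<close>)
  have "integrable (lborel \<Otimes>\<^sub>M lborel) (\<lambda>(x, y). F x y)"
  proof (rule lborel_pair.Fubini_integrable[OF m])
    show "integrable lborel (\<lambda>x. \<integral>y. norm (case (x, y) of (x, y) \<Rightarrow> F x y) \<partial>lborel)"
    proof (rule Bochner_Integration.integrable_bound[OF G(2)])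
      show "(\<lambda>x. \<integral>y. norm (case (x, y) of (x, y) \<Rightarrow> F x y) \<partial>lborel) \<in> borel_measurable lborel"
        by (rule sigma_finite_measure.borel_measurable_lebesgue_integral[OF sigma_finite_lborel]) measurable
      show "AE x in lborel. norm (\<integral>y. norm (case (x, y) of (x, y) \<Rightarrow> F x y) \<partial>lborel) \<le> norm (\<integral>y. G x y \<partial>lborel)"
      proof (rule AE_I2)
        fix x
        have "(\<integral>y. norm (F x y) \<partial>lborel) \<le> (\<integral>y. G x y \<partial>lborel)"
          by (rule integral_mono) (use i G(1) le in auto)
        moreover have "0 \<le> (\<integral>y. norm (F x y) \<partial>lborel)" by (rule Bochner_Integration.integral_nonneg) simp
        ultimately show "norm (\<integral>y. norm (case (x, y) of (x, y) \<Rightarrow> F x y) \<partial>lborel) \<le> norm (\<integral>y. G x y \<partial>lborel)"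
          by simp
      qed
    qed
  qed (use i in simp)
  from lborel_pair.Fubini_integral[OF this] show ?thesis by simp
qed

lemma FT_multiplication:
  assumes f: "integrable lborel f" and g: "integrable lborel g"
  shows "(\<integral>\<xi>. FT f \<xi> * g \<xi> \<partial>lborel) = (\<integral>x. f x * FT g x \<partial>lborel)"
proof -
  have [measurable]: "f \<in> borel_measurable borel" "g \<in> borel_measurable borel"
    using borel_measurable_integrable[OF f] borel_measurable_integrable[OF g] by auto
  have "(\<integral>\<xi>. FT f \<xi> * g \<xi> \<partial>lborel)
    = (\<integral>\<xi>. \<integral>x. exp (- \<i> * complex_of_real (x \<bullet> \<xi>)) * f x * g \<xi> \<partial>lborel \<partial>lborel)"
    by (simp add: FT_def)
  also have "\<dots> = (\<integral>x. \<integral>\<xi>. exp (- \<i> * complex_of_real (x \<bullet> \<xi>)) * f x * g \<xi> \<partial>lborel \<partial>lborel)"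
  proof (rule swap_integrals[where G = "\<lambda>\<xi> x. cmod (f x) * cmod (g \<xi>)"])
    show "(\<lambda>(\<xi>, x). exp (- \<i> * complex_of_real (x \<bullet> \<xi>)) * f x * g \<xi>) \<in> borel_measurable (lborel \<Otimes>\<^sub>M lborel)"
      by measurable
  qed (use f g in \<open>auto simp: norm_mult\<close>)
  also have "\<dots> = (\<integral>x. f x * FT g x \<partial>lborel)"
    by (simp add: FT_def inner_commute mult_ac flip: integral_mult_right_zero)
  finally show ?thesis .
qed

subsection \<open>Gaussians\<close>

lemma lborel_prod_integrals:
  fixes g :: "'a::euclidean_space \<Rightarrow> real \<Rightarrow> complex"
  assumes g: "\<And>b. b \<in> Basis \<Longrightarrow> integrable lborel (g b)"
  shows "integrable lborel (\<lambda>x. \<Prod>b\<in>Basis. g b (x \<bullet> b))"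
    and "(\<integral>x. (\<Prod>b\<in>Basis. g b (x \<bullet> b)) \<partial>lborel) = (\<Prod>b\<in>Basis. \<integral>t. g b t \<partial>lborel)"
proof -
  interpret product_sigma_finite "\<lambda>_::'a. lborel :: real measure" by standard
  let ?P = "\<Pi>\<^sub>M b\<in>(Basis::'a set). (lborel :: real measure)"
  let ?T = "\<lambda>f. \<Sum>b\<in>Basis. f b *\<^sub>R b"
  have gm: "g b \<in> borel_measurable borel" if "b \<in> Basis" for b
    using borel_measurable_integrable[OF g[OF that]] by simp
  have m: "(\<lambda>x. \<Prod>b\<in>Basis. g b (x \<bullet> b)) \<in> borel_measurable borel"
    by (intro borel_measurable_prod measurable_compose[OF _ gm]) auto
  have T: "?T \<in> ?P \<rightarrow>\<^sub>M borel" by measurable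
  have eq: "(\<Prod>b\<in>Basis. g b (?T f \<bullet> b)) = (\<Prod>b\<in>Basis. g b (f b))" for f
    by (intro prod.cong refl arg_cong2[where f = g]) simp
  show "integrable lborel (\<lambda>x. \<Prod>b\<in>Basis. g b (x \<bullet> b))"
    unfolding lborel_eq[where 'a = 'a] integrable_distr_eq[OF T m] eq
    by (intro product_integrable_prod g) auto
  show "(\<integral>x. (\<Prod>b\<in>Basis. g b (x \<bullet> b)) \<partial>lborel) = (\<Prod>b\<in>Basis. \<integral>t. g b t \<partial>lborel)"
    unfolding lborel_eq[where 'a = 'a] integral_distr[OF T m] eq
    by (intro product_integral_prod g) auto
qed

lemma gaussian_1d_integrable: "integrable lborel (\<lambda>x::real. exp (- x\<^sup>2 / 2))"
proof -
  have "integrable lborel (\<lambda>x. sqrt (2 * pi) * std_normal_density x)" by simp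
  then show ?thesis by (simp add: std_normal_density_def)
qed

lemma gaussian_1d_FT:
  "(\<integral>x. exp (- \<i> * complex_of_real (x * t)) * complex_of_real (exp (- x\<^sup>2 / 2)) \<partial>lborel)
    = complex_of_real (sqrt (2 * pi) * exp (- t\<^sup>2 / 2))"
proof -
  have "complex_of_real (exp (- t\<^sup>2 / 2)) = char std_normal_distribution (- t)"
    by (simp add: char_std_normal_distribution)
  also have "\<dots> = (\<integral>x. std_normal_density x *\<^sub>R iexp (- t * x) \<partial>lborel)"
    unfolding char_def by (subst integral_density) auto
  also have "\<dots> = (\<integral>x. complex_of_real (1 / sqrt (2 * pi)) *
      (exp (- \<i> * complex_of_real (x * t)) * complex_of_real (exp (- x\<^sup>2 / 2))) \<partial>lborel)"
    by (intro Bochner_Integration.integral_cong refl)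
      (simp add: std_normal_density_def scaleR_conv_of_real mult_ac)
  also have "\<dots> = complex_of_real (1 / sqrt (2 * pi)) *
      (\<integral>x. exp (- \<i> * complex_of_real (x * t)) * complex_of_real (exp (- x\<^sup>2 / 2)) \<partial>lborel)"
    by (rule integral_mult_right_zero)
  finally show ?thesis by (simp add: field_simps)
qed

definition gaussian :: "real^3 \<Rightarrow> real" where
  "gaussian x = exp (- (norm x)\<^sup>2 / 2)"

lemma gaussian_pos: "gaussian x > 0" and gaussian_le_1: "gaussian x \<le> 1"
  by (auto simp: gaussian_def)

lemma gaussian_measurable [measurable]: "gaussian \<in> borel_measurable borel"
  unfolding gaussian_def[abs_def] by measurable

lemma gaussian_character_prod:
  "exp (- \<i> * complex_of_real (x \<bullet> \<xi>)) * complex_of_real (gaussian x)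
    = (\<Prod>b\<in>Basis. exp (- \<i> * complex_of_real ((x \<bullet> b) * (\<xi> \<bullet> b))) * complex_of_real (exp (- (x \<bullet> b)\<^sup>2 / 2)))"
proof -
  have 1: "exp (- \<i> * complex_of_real (x \<bullet> \<xi>)) = (\<Prod>b\<in>Basis. exp (- \<i> * complex_of_real ((x \<bullet> b) * (\<xi> \<bullet> b))))"
    by (subst euclidean_inner) (simp add: exp_sum[symmetric] sum_distrib_left sum_negf)
  have "- (norm x)\<^sup>2 / 2 = (\<Sum>b\<in>Basis. - (x \<bullet> b)\<^sup>2 / 2)"
    unfolding power2_norm_eq_inner by (subst euclidean_inner)
      (simp add: power2_eq_square sum_negf sum_divide_distrib)
  then have 2: "gaussian x = (\<Prod>b\<in>Basis. exp (- (x \<bullet> b)\<^sup>2 / 2))"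
    by (simp add: gaussian_def exp_sum)
  show ?thesis unfolding 1 2 by (simp add: prod.distrib)
qed

lemma gaussian_1d_character_integrable:
  "integrable lborel (\<lambda>x. exp (- \<i> * complex_of_real (x * t)) * complex_of_real (exp (- x\<^sup>2 / 2)))"
  by (rule Bochner_Integration.integrable_bound[OF gaussian_1d_integrable]) (auto simp: norm_mult)

lemma integrable_gaussian: "integrable lborel gaussian"
proof -
  have "integrable lborel (\<lambda>x::real^3. \<Prod>b\<in>Basis. exp (- \<i> * complex_of_real ((x \<bullet> b) * (0 \<bullet> b))) * complex_of_real (exp (- (x \<bullet> b)\<^sup>2 / 2)))"
    by (rule lborel_prod_integrals(1)) (rule gaussian_1d_character_integrable)
  then have "integrable lborel (\<lambda>x. complex_of_real (gaussian x))"
    unfolding gaussian_character_prod[symmetric] by simp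
  then show ?thesis by (rule iffD1[OF complex_of_real_integrable_eq])
qed

lemma FT_gaussian:
  "FT (\<lambda>x. complex_of_real (gaussian x)) \<xi> = complex_of_real (sqrt (2 * pi) ^ 3 * gaussian \<xi>)"
proof -
  have "FT (\<lambda>x. complex_of_real (gaussian x)) \<xi>
    = (\<Prod>b\<in>Basis. \<integral>t. exp (- \<i> * complex_of_real (t * (\<xi> \<bullet> b))) * complex_of_real (exp (- t\<^sup>2 / 2)) \<partial>lborel)"
    unfolding FT_def gaussian_character_prod
    by (rule lborel_prod_integrals(2)) (rule gaussian_1d_character_integrable)
  also have "\<dots> = (\<Prod>b\<in>Basis. complex_of_real (sqrt (2 * pi)) * (exp (- \<i> * complex_of_real ((\<xi> \<bullet> b) * (0 \<bullet> b))) * complex_of_real (exp (- (\<xi> \<bullet> b)\<^sup>2 / 2))))"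
    unfolding gaussian_1d_FT by (intro prod.cong) auto
  also have "\<dots> = complex_of_real (sqrt (2 * pi)) ^ 3 * (exp (- \<i> * complex_of_real (\<xi> \<bullet> 0)) * complex_of_real (gaussian \<xi>))"
    unfolding prod.distrib[of "\<lambda>b. complex_of_real (sqrt (2 * pi))"] gaussian_character_prod[symmetric] by simp
  finally show ?thesis by simp
qed

definition plancherel_const :: real where "plancherel_const = (2 * pi) ^ 3"

lemma plancherel_const_pos: "plancherel_const > 0"
  by (simp add: plancherel_const_def)

lemma integral_gaussian: "(\<integral>x. sqrt (2 * pi) ^ 3 * gaussian x \<partial>lborel) = plancherel_const"
proof -
  have "complex_of_real (\<integral>x. gaussian x \<partial>lborel) = FT (\<lambda>x. complex_of_real (gaussian x)) 0"
    unfolding FT_def by (simp flip: integral_complex_of_real)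
  then have "(\<integral>x. gaussian x \<partial>lborel) = sqrt (2 * pi) ^ 3"
    unfolding FT_gaussian of_real_eq_iff by (simp add: gaussian_def[of 0])
  moreover have "sqrt (2 * pi) ^ 3 * sqrt (2 * pi) ^ 3 = plancherel_const"
    unfolding plancherel_const_def power_mult_distrib[symmetric] by simp
  ultimately show ?thesis by simp
qed

lemma integral_dilation:
  fixes F :: "real^3 \<Rightarrow> 'b::{banach, second_countable_topology}"
  assumes c: "c > 0" and F [measurable]: "F \<in> borel_measurable borel"
  shows "(\<integral>x. F x \<partial>lborel) = c ^ 3 *\<^sub>R (\<integral>x. F (c *\<^sub>R x) \<partial>lborel)"
proof -
  have "(\<integral>x. F x \<partial>lborel) = (\<integral>x. F x \<partial>(density (distr lborel borel (\<lambda>x. 0 + c *\<^sub>R x)) (\<lambda>_. \<bar>c\<bar> ^ DIM(real^3))))"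
    using c by (subst lborel_affine[of c 0, symmetric]) auto
  also have "\<dots> = c ^ 3 *\<^sub>R (\<integral>x. F (c *\<^sub>R x) \<partial>lborel)"
    using c by (subst integral_density) (auto simp: integral_distr)
  finally show ?thesis .
qed

lemma integrable_gaussian_dilated:
  assumes k: "k > 0"
  shows "integrable lborel (\<lambda>\<xi>. gaussian ((1 / k) *\<^sub>R \<xi>))"
proof -
  have d: "lborel = density (distr lborel borel (\<lambda>x::real^3. 0 + (1/k) *\<^sub>R x)) (\<lambda>_. \<bar>1/k\<bar> ^ DIM(real^3))"
    using k by (intro lborel_affine) auto
  have "integrable (density (distr lborel borel (\<lambda>x::real^3. 0 + (1/k) *\<^sub>R x)) (\<lambda>_. \<bar>1/k\<bar> ^ DIM(real^3))) gaussian"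
    using integrable_gaussian d by metis
  then have "integrable (distr lborel borel (\<lambda>x::real^3. 0 + (1/k) *\<^sub>R x)) gaussian"
    using k by (subst (asm) integrable_density) auto
  then show ?thesis
    by (subst (asm) integrable_distr_eq) auto
qed

subsection \<open>Isometry on integrable square-integrable functions\<close>

text \<open>Inserting the Gaussian factor \<open>g\<^sub>k(\<xi>) = e\<^sup>-\<^sup>|\<^sup>\<xi>\<^sup>|\<^sup>2\<^sup>/\<^sup>2\<^sup>k\<^sup>2\<close> makes all integrals absolutely
  convergent; undoing the two Fourier integrals leaves an average of the autocorrelation of \<open>f\<close>
  over a Gaussian of width \<open>1/k\<close>.\<close>

lemma regularized_plancherel:
  assumes f: "integrable lborel f" "f \<in> L2" and k: "k > 0"
  shows "(\<integral>\<xi>. complex_of_real ((cmod (FT f \<xi>))\<^sup>2 * gaussian ((1 / k) *\<^sub>R \<xi>)) \<partial>lborel)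
    = (\<integral>w. (\<integral>x. f x * cnj (f ((1 / k) *\<^sub>R w + x)) \<partial>lborel) * complex_of_real (sqrt (2 * pi) ^ 3 * gaussian w) \<partial>lborel)"
proof -
  have [measurable]: "f \<in> borel_measurable borel"
    using borel_measurable_integrable[OF f(1)] by simp
  let ?K = "\<lambda>w. sqrt (2 * pi) ^ 3 * gaussian w"
  let ?e = "\<lambda>x \<xi>. exp (- \<i> * complex_of_real (x \<bullet> \<xi>))"
  define g where "g \<xi> = gaussian ((1 / k) *\<^sub>R \<xi>)" for \<xi>
  have [measurable]: "g \<in> borel_measurable borel" unfolding g_def[abs_def] by measurable
  have g: "integrable lborel g"
    unfolding g_def[abs_def] using k by (rule integrable_gaussian_dilated)
  have FTg: "FT (\<lambda>x. complex_of_real (g x)) z = complex_of_real (k ^ 3 * ?K (k *\<^sub>R z))" for z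
  proof -
    have "FT (\<lambda>x. complex_of_real (g x)) z = k ^ 3 *\<^sub>R (\<integral>x. ?e (k *\<^sub>R x) z * complex_of_real (g (k *\<^sub>R x)) \<partial>lborel)"
      unfolding FT_def using k by (rule integral_dilation) measurable
    also have "(\<integral>x. ?e (k *\<^sub>R x) z * complex_of_real (g (k *\<^sub>R x)) \<partial>lborel)
        = FT (\<lambda>x. complex_of_real (gaussian x)) (k *\<^sub>R z)"
      unfolding FT_def g_def using k by (simp add: inner_scaleR_left inner_scaleR_right)
    finally show ?thesis by (simp add: FT_gaussian scaleR_conv_of_real)
  qed
  define h where "h \<xi> = cnj (FT f \<xi>) * complex_of_real (g \<xi>)" for \<xi>
  have FTb: "cmod (FT f \<xi>) \<le> (\<integral>x. cmod (f x) \<partial>lborel)" for \<xi> by (rule FT_bound)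
  have ih: "integrable lborel h"
  proof (rule Bochner_Integration.integrable_bound[where f = "\<lambda>\<xi>. (\<integral>x. cmod (f x) \<partial>lborel) * g \<xi>"])
    have [measurable]: "cnj \<in> borel_measurable borel"
      by (intro borel_measurable_continuous_onI continuous_intros)
    have "(\<lambda>\<xi>. cnj (FT f \<xi>)) \<in> borel_measurable borel"
      by (rule measurable_compose[OF FT_measurable]) measurable
    then show "h \<in> borel_measurable lborel" unfolding h_def[abs_def] by simp
    show "AE \<xi> in lborel. norm (h \<xi>) \<le> norm ((\<integral>x. cmod (f x) \<partial>lborel) * g \<xi>)"
      using FTb gaussian_pos by (auto simp: h_def g_def norm_mult abs_mult intro!: mult_right_mono order_trans[OF FTb abs_ge_self])
  qed (use g in simp)
  have FTh: "FT h x = (\<integral>w. cnj (f ((1 / k) *\<^sub>R w + x)) * complex_of_real (?K w) \<partial>lborel)" for x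
  proof -
    have "FT h x = cnj (\<integral>\<xi>. FT f \<xi> * (?e \<xi> (- x) * complex_of_real (g \<xi>)) \<partial>lborel)"
      unfolding FT_def[of h] h_def
      by (subst Bochner_Integration.integral_cnj[symmetric]) (simp add: exp_cnj mult_ac)
    moreover have "(\<integral>\<xi>. FT f \<xi> * (?e \<xi> (- x) * complex_of_real (g \<xi>)) \<partial>lborel)
        = (\<integral>y. f y * FT (\<lambda>\<xi>. ?e \<xi> (- x) * complex_of_real (g \<xi>)) y \<partial>lborel)"
      using g by (intro FT_multiplication f integrable_character_mult) simp
    moreover have "FT (\<lambda>\<xi>. ?e \<xi> (- x) * complex_of_real (g \<xi>)) y = complex_of_real (k ^ 3 * ?K (k *\<^sub>R (y - x)))" for y
      unfolding FTg[symmetric] FT_def by (simp add: inner_diff_right algebra_simps flip: exp_add)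
    moreover have "(\<integral>y. f y * complex_of_real (k ^ 3 * ?K (k *\<^sub>R (y - x))) \<partial>lborel)
        = (\<integral>w. f (x + (1 / k) *\<^sub>R w) * complex_of_real (?K w) \<partial>lborel)"
    proof -
    have "(\<integral>y. f y * complex_of_real (k ^ 3 * ?K (k *\<^sub>R (y - x))) \<partial>lborel)
        = (\<integral>z. f (x + z) * complex_of_real (k ^ 3 * ?K (k *\<^sub>R ((x + z) - x))) \<partial>lborel)"
      by (rule lborel_preserving_integral[OF lborel_preserving_translation, symmetric]) measurable
    also have "\<dots> = (\<integral>z. f (x + z) * complex_of_real (k ^ 3 * ?K (k *\<^sub>R z)) \<partial>lborel)" by simp
    also have "\<dots> = (1 / k) ^ 3 *\<^sub>R (\<integral>w. f (x + (1 / k) *\<^sub>R w) * complex_of_real (k ^ 3 * ?K (k *\<^sub>R ((1 / k) *\<^sub>R w))) \<partial>lborel)"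
      using k by (intro integral_dilation) auto
    also have "\<dots> = (\<integral>w. f (x + (1 / k) *\<^sub>R w) * complex_of_real (?K w) \<partial>lborel)"
    proof -
      have "f (x + (1 / k) *\<^sub>R w) * complex_of_real (k ^ 3 * ?K (k *\<^sub>R ((1 / k) *\<^sub>R w)))
          = k ^ 3 *\<^sub>R (f (x + (1 / k) *\<^sub>R w) * complex_of_real (?K w))" for w
      proof -
        have "k *\<^sub>R ((1 / k) *\<^sub>R w) = w" using k by simp
        then show ?thesis by (simp add: scaleR_conv_of_real mult_ac)
      qed
      then show ?thesis using k by (simp add: power_one_over)
    qed
    finally show ?thesis .
    qed
    moreover have "cnj (\<integral>w. f (x + (1 / k) *\<^sub>R w) * complex_of_real (?K w) \<partial>lborel)
        = (\<integral>w. cnj (f ((1 / k) *\<^sub>R w + x)) * complex_of_real (?K w) \<partial>lborel)"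
      by (subst Bochner_Integration.integral_cnj[symmetric]) (simp add: add.commute)
    ultimately show ?thesis by (simp only:)
  qed
  have "(\<integral>\<xi>. complex_of_real ((cmod (FT f \<xi>))\<^sup>2 * gaussian ((1 / k) *\<^sub>R \<xi>)) \<partial>lborel) = (\<integral>\<xi>. FT f \<xi> * h \<xi> \<partial>lborel)"
  proof (rule Bochner_Integration.integral_cong)
    fix \<xi>
    have "complex_of_real ((cmod (FT f \<xi>))\<^sup>2) = FT f \<xi> * cnj (FT f \<xi>)"
      using complex_norm_square[of "FT f \<xi>"] by simp
    then show "complex_of_real ((cmod (FT f \<xi>))\<^sup>2 * gaussian ((1 / k) *\<^sub>R \<xi>)) = FT f \<xi> * h \<xi>"
      by (simp add: h_def g_def)
  qed simp
  also have "\<dots> = (\<integral>x. f x * FT h x \<partial>lborel)"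
    by (rule FT_multiplication[OF f(1) ih])
  also have "\<dots> = (\<integral>x. \<integral>w. f x * cnj (f ((1 / k) *\<^sub>R w + x)) * complex_of_real (?K w) \<partial>lborel \<partial>lborel)"
    unfolding FTh by (simp add: mult.assoc flip: integral_mult_right_zero)
  also have "\<dots> = (\<integral>w. \<integral>x. f x * cnj (f ((1 / k) *\<^sub>R w + x)) * complex_of_real (?K w) \<partial>lborel \<partial>lborel)"
  proof (rule swap_integrals[symmetric, where G = "\<lambda>w x. cmod (f x) * cmod (f ((1 / k) *\<^sub>R w + x)) * ?K w"])
    have [measurable]: "cnj \<in> borel_measurable borel"
      by (intro borel_measurable_continuous_onI continuous_intros)
    have [measurable]: "(\<lambda>p::(real^3) \<times> (real^3). cnj (f ((1 / k) *\<^sub>R fst p + snd p))) \<in> borel_measurable (borel \<Otimes>\<^sub>M borel)"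
      by (rule measurable_compose[where g = cnj]) measurable
    show "(\<lambda>(w, x). f x * cnj (f ((1 / k) *\<^sub>R w + x)) * complex_of_real (?K w)) \<in> borel_measurable (lborel \<Otimes>\<^sub>M lborel)"
      unfolding split_beta by simp
    have tr: "(\<lambda>x. f ((1 / k) *\<^sub>R w + x)) \<in> L2" "L2_norm (\<lambda>x. f ((1 / k) *\<^sub>R w + x)) = L2_norm f" for w
      using lborel_preserving_L2[OF lborel_preserving_translation f(2)] by auto
    have i: "integrable lborel (\<lambda>x. cmod (f x) * cmod (f ((1 / k) *\<^sub>R w + x)))" for w
      by (rule integrable_norm_mult[OF f(2) tr(1)])
    then show "integrable lborel (\<lambda>x. cmod (f x) * cmod (f ((1 / k) *\<^sub>R w + x)) * ?K w)" for w
      by simp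
    have le: "(\<integral>x. cmod (f x) * cmod (f ((1 / k) *\<^sub>R w + x)) \<partial>lborel) \<le> (L2_norm f)\<^sup>2" for w
      using Cauchy_Schwarz_norm[OF f(2) tr(1)] by (simp add: tr(2) power2_eq_square)
    show "integrable lborel (\<lambda>w. \<integral>x. cmod (f x) * cmod (f ((1 / k) *\<^sub>R w + x)) * ?K w \<partial>lborel)"
    proof (rule Bochner_Integration.integrable_bound[where f = "\<lambda>w. (L2_norm f)\<^sup>2 * ?K w"])
      show "(\<lambda>w. \<integral>x. cmod (f x) * cmod (f ((1 / k) *\<^sub>R w + x)) * ?K w \<partial>lborel) \<in> borel_measurable lborel"
        by (rule sigma_finite_measure.borel_measurable_lebesgue_integral[OF sigma_finite_lborel]) measurable
      show "AE w in lborel. norm (\<integral>x. cmod (f x) * cmod (f ((1 / k) *\<^sub>R w + x)) * ?K w \<partial>lborel) \<le> norm ((L2_norm f)\<^sup>2 * ?K w)"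
      proof (rule AE_I2)
        fix w
        have "0 \<le> (\<integral>x. cmod (f x) * cmod (f ((1 / k) *\<^sub>R w + x)) \<partial>lborel)" by (rule Bochner_Integration.integral_nonneg) simp
        then have "norm (\<integral>x. cmod (f x) * cmod (f ((1 / k) *\<^sub>R w + x)) * ?K w \<partial>lborel)
          = (\<integral>x. cmod (f x) * cmod (f ((1 / k) *\<^sub>R w + x)) \<partial>lborel) * ?K w"
          using gaussian_pos[of w] by (simp add: abs_mult)
        also have "\<dots> \<le> (L2_norm f)\<^sup>2 * ?K w"
          using gaussian_pos[of w] by (intro mult_right_mono le) simp
        finally show "norm (\<integral>x. cmod (f x) * cmod (f ((1 / k) *\<^sub>R w + x)) * ?K w \<partial>lborel) \<le> norm ((L2_norm f)\<^sup>2 * ?K w)"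
          using abs_ge_self order_trans by fastforce
      qed
    qed (use integrable_gaussian in simp)
    show "cmod (f x * cnj (f ((1 / k) *\<^sub>R w + x)) * complex_of_real (?K w)) \<le> cmod (f x) * cmod (f ((1 / k) *\<^sub>R w + x)) * ?K w" for w x
      using gaussian_pos[of w] by (simp add: norm_mult norm_power)
  qed
  finally show ?thesis by simp
qed

lemma L2_autocorrelation_tendsto:
  assumes f: "f \<in> L2"
  shows "(\<lambda>n. \<integral>x. f x * cnj (f ((1 / real (Suc n)) *\<^sub>R w + x)) \<partial>lborel) \<longlonglongrightarrow> complex_of_real ((L2_norm f)\<^sup>2)"
proof -
  let ?\<tau> = "\<lambda>n x. (1 / real (Suc n)) *\<^sub>R w + x"
  have z: "(\<lambda>n. (1 / real (Suc n)) *\<^sub>R w) \<longlonglongrightarrow> 0 *\<^sub>R w"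
    by (intro tendsto_intros LIMSEQ_Suc[OF lim_1_over_n])
  have "(\<lambda>n. L2_norm (\<lambda>x. f (?\<tau> n x) - f x)) \<longlonglongrightarrow> 0"
  proof (rule L2_transport_continuous[OF _ _ _ _ f])
    show "(\<lambda>n. ?\<tau> n x) \<longlonglongrightarrow> x" for x
      using tendsto_add[OF z tendsto_const[of x]] by simp
    show "norm x \<le> (1 + norm w) * (1 + norm (?\<tau> n x))" for n x
    proof -
      have "norm x = norm (?\<tau> n x - (1 / real (Suc n)) *\<^sub>R w)" by simp
      also have "\<dots> \<le> norm (?\<tau> n x) + norm ((1 / real (Suc n)) *\<^sub>R w)" by (rule norm_triangle_ineq4)
      also have "norm ((1 / real (Suc n)) *\<^sub>R w) \<le> norm w"
        using mult_left_le_one_le[of "norm w" "1 / real (Suc n)"] by simp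
      finally have "norm x \<le> norm (?\<tau> n x) + norm w" by simp
      also have "\<dots> \<le> (1 + norm w) * (1 + norm (?\<tau> n x))" by (simp add: algebra_simps)
      finally show ?thesis .
    qed
  qed (auto intro: lborel_preserving_translation add_pos_nonneg)
  moreover have "L2_norm (\<lambda>x. cnj (f (?\<tau> n x)) - cnj (f x)) = L2_norm (\<lambda>x. f (?\<tau> n x) - f x)" for n
    unfolding L2_norm_def by (simp flip: complex_cnj_diff)
  ultimately have "(\<lambda>n. L2_norm (\<lambda>x. cnj (f (?\<tau> n x)) - cnj (f x))) \<longlonglongrightarrow> 0" by simp
  then have "(\<lambda>n. \<integral>x. f x * cnj (f (?\<tau> n x)) \<partial>lborel) \<longlonglongrightarrow> (\<integral>x. f x * cnj (f x) \<partial>lborel)"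
    by (intro L2_pairing_tendsto_right f L2_cnj lborel_preserving_L2(1)[OF lborel_preserving_translation])
  then show ?thesis unfolding integral_mult_cnj .
qed

text \<open>The regularized integrals converge because the autocorrelation of \<open>f\<close> is continuous at zero. Fatou's
  lemma then gives integrability of \<open>|FT f|\<^sup>2\<close>, after which dominated convergence removes the Gaussian.\<close>

lemma plancherel_L1_L2:
  assumes f: "integrable lborel f" "f \<in> L2"
  shows "FT f \<in> L2" "(L2_norm (FT f))\<^sup>2 = plancherel_const * (L2_norm f)\<^sup>2"
proof -
  have fm [measurable]: "f \<in> borel_measurable borel"
    using borel_measurable_integrable[OF f(1)] by simp
  have Fm [measurable]: "FT f \<in> borel_measurable borel" by measurable
  let ?K = "\<lambda>w. sqrt (2 * pi) ^ 3 * gaussian w"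
  let ?k = "\<lambda>n::nat. 1 / real (Suc n)"
  define A where "A n = (\<integral>\<xi>. (cmod (FT f \<xi>))\<^sup>2 * gaussian (?k n *\<^sub>R \<xi>) \<partial>lborel)" for n
  have A: "A \<longlonglongrightarrow> plancherel_const * (L2_norm f)\<^sup>2"
  proof -
    have "(\<lambda>n. \<integral>w. (\<integral>x. f x * cnj (f (?k n *\<^sub>R w + x)) \<partial>lborel) * complex_of_real (?K w) \<partial>lborel)
      \<longlonglongrightarrow> (\<integral>w. complex_of_real ((L2_norm f)\<^sup>2) * complex_of_real (?K w) \<partial>lborel)"
    proof (rule integral_dominated_convergence[where w = "\<lambda>w. (L2_norm f)\<^sup>2 * ?K w"])
      show "AE w in lborel. (\<lambda>n. (\<integral>x. f x * cnj (f (?k n *\<^sub>R w + x)) \<partial>lborel) * complex_of_real (?K w))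
        \<longlonglongrightarrow> complex_of_real ((L2_norm f)\<^sup>2) * complex_of_real (?K w)"
        by (intro AE_I2 tendsto_mult tendsto_const L2_autocorrelation_tendsto f)
      show "AE w in lborel. norm ((\<integral>x. f x * cnj (f (?k n *\<^sub>R w + x)) \<partial>lborel) * complex_of_real (?K w)) \<le> (L2_norm f)\<^sup>2 * ?K w" for n
      proof (rule AE_I2)
        fix w
        note T = lborel_preserving_L2[OF lborel_preserving_translation[of "?k n *\<^sub>R w"] f(2)]
        have c: "L2_norm (\<lambda>x. cnj (f (?k n *\<^sub>R w + x))) = L2_norm f"
          using T(2) by (simp add: L2_norm_def)
        have "cmod (\<integral>x. f x * cnj (f (?k n *\<^sub>R w + x)) \<partial>lborel) \<le> (L2_norm f)\<^sup>2"
          using Cauchy_Schwarz_mult[OF f(2) L2_cnj[OF T(1)]] unfolding c power2_eq_square .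
        then show "norm ((\<integral>x. f x * cnj (f (?k n *\<^sub>R w + x)) \<partial>lborel) * complex_of_real (?K w)) \<le> (L2_norm f)\<^sup>2 * ?K w"
          unfolding norm_mult using gaussian_pos[of w] by (intro mult_mono) (auto simp: norm_mult norm_power)
      qed
      show "(\<lambda>w. (\<integral>x. f x * cnj (f (?k n *\<^sub>R w + x)) \<partial>lborel) * complex_of_real (?K w)) \<in> borel_measurable lborel" for n
      proof -
        have [measurable]: "cnj \<in> borel_measurable borel"
          by (intro borel_measurable_continuous_onI continuous_intros)
        have [measurable]: "(\<lambda>p::(real^3) \<times> (real^3). cnj (f (?k n *\<^sub>R fst p + snd p))) \<in> borel_measurable (borel \<Otimes>\<^sub>M borel)"
          by (rule measurable_compose[where g = cnj]) measurable
        have "(\<lambda>w. \<integral>x. f x * cnj (f (?k n *\<^sub>R w + x)) \<partial>lborel) \<in> borel_measurable borel"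
          by (rule sigma_finite_measure.borel_measurable_lebesgue_integral[OF sigma_finite_lborel])
            (simp add: split_beta)
        then show ?thesis by simp
      qed
    qed (use integrable_gaussian in auto)
    also have "(\<integral>w. complex_of_real ((L2_norm f)\<^sup>2) * complex_of_real (?K w) \<partial>lborel)
        = complex_of_real ((L2_norm f)\<^sup>2 * (\<integral>w. ?K w \<partial>lborel))"
      by (simp only: of_real_mult[symmetric] integral_complex_of_real integral_mult_right_zero)
    also have "(\<integral>w. ?K w \<partial>lborel) = plancherel_const" by (rule integral_gaussian)
    also have "(\<lambda>n. \<integral>w. (\<integral>x. f x * cnj (f (?k n *\<^sub>R w + x)) \<partial>lborel) * complex_of_real (?K w) \<partial>lborel)
        = (\<lambda>n. complex_of_real (A n))"
      by (rule ext, subst regularized_plancherel[OF f, symmetric]) (simp_all only: A_def integral_complex_of_real of_nat_0_less_iff zero_less_Suc)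
    finally show ?thesis by (simp only: tendsto_of_real_iff mult.commute)
  qed
  have Ai: "integrable lborel (\<lambda>\<xi>. (cmod (FT f \<xi>))\<^sup>2 * gaussian (?k n *\<^sub>R \<xi>))" for n
  proof (rule Bochner_Integration.integrable_bound[where f = "\<lambda>\<xi>. (\<integral>x. cmod (f x) \<partial>lborel)\<^sup>2 * gaussian (?k n *\<^sub>R \<xi>)"])
    show "AE \<xi> in lborel. norm ((cmod (FT f \<xi>))\<^sup>2 * gaussian (?k n *\<^sub>R \<xi>))
        \<le> norm ((\<integral>x. cmod (f x) \<partial>lborel)\<^sup>2 * gaussian (?k n *\<^sub>R \<xi>))"
      unfolding norm_mult by (intro AE_I2 mult_right_mono) (simp_all add: power_mono FT_bound)
  qed (use integrable_gaussian_dilated[of "real (Suc n)"] in \<open>simp, measurable\<close>)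
  have g1: "(\<lambda>n. (cmod (FT f \<xi>))\<^sup>2 * gaussian (?k n *\<^sub>R \<xi>)) \<longlonglongrightarrow> (cmod (FT f \<xi>))\<^sup>2" for \<xi>
  proof -
    have "(\<lambda>n. (cmod (FT f \<xi>))\<^sup>2 * exp (- (norm (?k n *\<^sub>R \<xi>))\<^sup>2 / 2)) \<longlonglongrightarrow> (cmod (FT f \<xi>))\<^sup>2 * exp (- (norm (0 *\<^sub>R \<xi>))\<^sup>2 / 2)"
      by (intro tendsto_intros LIMSEQ_Suc[OF lim_1_over_n]) simp
    then show ?thesis by (simp add: gaussian_def)
  qed
  have "(\<integral>\<^sup>+\<xi>. ennreal ((cmod (FT f \<xi>))\<^sup>2) \<partial>lborel)
      = (\<integral>\<^sup>+\<xi>. liminf (\<lambda>n. ennreal ((cmod (FT f \<xi>))\<^sup>2 * gaussian (?k n *\<^sub>R \<xi>))) \<partial>lborel)"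
    by (intro nn_integral_cong lim_imp_Liminf[symmetric] tendsto_ennrealI g1) simp
  also have "\<dots> \<le> liminf (\<lambda>n. \<integral>\<^sup>+\<xi>. ennreal ((cmod (FT f \<xi>))\<^sup>2 * gaussian (?k n *\<^sub>R \<xi>)) \<partial>lborel)"
    by (intro nn_integral_liminf) measurable
  also have "\<dots> = liminf (\<lambda>n. ennreal (A n))"
    unfolding A_def by (subst nn_integral_eq_integral[OF Ai]) (auto simp: gaussian_pos less_imp_le)
  also have "\<dots> = ennreal (plancherel_const * (L2_norm f)\<^sup>2)"
    by (intro lim_imp_Liminf tendsto_ennrealI A) simp
  finally have "(\<integral>\<^sup>+\<xi>. ennreal ((cmod (FT f \<xi>))\<^sup>2) \<partial>lborel) < \<infinity>"
    by (rule order_le_less_trans) (rule ennreal_less_top[folded infinity_ennreal_def])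
  then have i: "integrable lborel (\<lambda>\<xi>. (cmod (FT f \<xi>))\<^sup>2)"
    by (intro integrableI_bounded) simp_all
  then show "FT f \<in> L2" by (intro L2_I) simp
  have "A \<longlonglongrightarrow> (\<integral>\<xi>. (cmod (FT f \<xi>))\<^sup>2 \<partial>lborel)"
    unfolding A_def
  proof (rule integral_dominated_convergence[OF _ _ i])
    show "AE \<xi> in lborel. norm ((cmod (FT f \<xi>))\<^sup>2 * gaussian (?k n *\<^sub>R \<xi>)) \<le> (cmod (FT f \<xi>))\<^sup>2" for n
      using gaussian_le_1 gaussian_pos by (intro AE_I2) (simp add: abs_mult mult_left_le less_imp_le)
  qed (use g1 in \<open>auto intro: measurable\<close>)
  then show "(L2_norm (FT f))\<^sup>2 = plancherel_const * (L2_norm f)\<^sup>2"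
    unfolding L2_norm_power2 using A LIMSEQ_unique by (simp add: L2_norm_power2) blast
qed

section \<open>The Fourier transform on \<open>L\<^sup>2\<close>\<close>

definition trunc :: "real \<Rightarrow> (real^3 \<Rightarrow> complex) \<Rightarrow> real^3 \<Rightarrow> complex" where
  "trunc R u x = indicator (cball 0 R) x *\<^sub>R u x"

lemma trunc_FT: "(LINT x:cball 0 R|lborel. exp (- \<i> * complex_of_real (x \<bullet> \<xi>)) * u x) = FT (trunc R u) \<xi>"
  unfolding set_lebesgue_integral_def FT_def trunc_def by simp

lemma trunc_measurable:
  assumes [measurable]: "u \<in> borel_measurable borel"
  shows "trunc R u \<in> borel_measurable borel"
proof -
  have [measurable]: "cball 0 R \<in> sets (borel :: (real^3) measure)" by simp
  show ?thesis unfolding trunc_def[abs_def] by measurable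
qed

lemma norm_trunc_le: "cmod (trunc R u x) \<le> cmod (u x)"
  by (simp add: trunc_def indicator_def)

lemma trunc_L2: "u \<in> L2 \<Longrightarrow> trunc R u \<in> L2"
  by (rule L2_dominated[where C = 1]) (auto simp: norm_trunc_le intro: trunc_measurable dest: L2_D)

lemma trunc_integrable:
  assumes u: "u \<in> L2" shows "integrable lborel (trunc R u)"
proof (rule Bochner_Integration.integrable_bound[OF integrable_norm_mult[OF indicator_cball_L2[of 1 R] u]])
  show "trunc R u \<in> borel_measurable lborel" using trunc_measurable L2_D(3)[OF u] by simp
  show "AE x in lborel. norm (trunc R u x) \<le> norm (norm (1 * indicat_real (cball 0 R) x) * norm (u x))"
    by (simp add: trunc_def indicator_def)
qed

lemma trunc_tendsto:
  assumes u: "u \<in> L2"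
  shows "((\<lambda>R. L2_norm (\<lambda>x. trunc R u x - u x)) \<longlongrightarrow> 0) at_top"
proof (rule tendsto_at_topI_sequentially)
  fix X :: "nat \<Rightarrow> real" assume X: "filterlim X at_top sequentially"
  show "(\<lambda>n. L2_norm (\<lambda>x. trunc (X n) u x - u x)) \<longlonglongrightarrow> 0"
  proof (rule L2_dominated_tendsto[OF u, where C = 1])
    show "AE x in lborel. (\<lambda>n. trunc (X n) u x - u x) \<longlonglongrightarrow> 0"
    proof (rule AE_I2, rule tendsto_eventually)
      fix x :: "real^3"
      have "\<forall>\<^sub>F n in sequentially. norm x \<le> X n" using X by (simp add: filterlim_at_top)
      then show "\<forall>\<^sub>F n in sequentially. trunc (X n) u x - u x = 0"
        by eventually_elim (simp add: trunc_def)
    qed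
    show "(\<lambda>x. trunc (X n) u x - u x) \<in> borel_measurable lborel" for n
      using trunc_measurable L2_D(3)[OF u] by simp
    show "norm (trunc (X n) u x - u x) \<le> 1 * norm (u x)" for n x
      by (simp add: trunc_def indicator_def)
  qed
qed

lemma FT_trunc_L2: "u \<in> L2 \<Longrightarrow> FT (trunc R u) \<in> L2"
  by (intro plancherel_L1_L2 trunc_integrable trunc_L2)

lemma L2_norm_FT:
  assumes "integrable lborel f" "f \<in> L2"
  shows "L2_norm (FT f) = sqrt plancherel_const * L2_norm f"
proof -
  have "L2_norm (FT f) = sqrt ((L2_norm (FT f))\<^sup>2)" by simp
  then show ?thesis unfolding plancherel_L1_L2(2)[OF assms] by (simp add: real_sqrt_mult)
qed

lemma L2_norm_FT_diff:
  assumes "integrable lborel f" "f \<in> L2" "integrable lborel g" "g \<in> L2"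
  shows "L2_norm (\<lambda>\<xi>. FT f \<xi> - FT g \<xi>) = sqrt plancherel_const * L2_norm (\<lambda>x. f x - g x)"
proof -
  have "(\<lambda>\<xi>. FT f \<xi> - FT g \<xi>) = FT (\<lambda>x. f x - g x)"
    using FT_diff[OF assms(1,3)] by auto
  then show ?thesis
    using L2_norm_FT[of "\<lambda>x. f x - g x"] assms by (simp add: L2_diff)
qed

text \<open>The truncated transforms are square integrable by Plancherel, so the nonnegative integral in the
  definition is the square of a norm.\<close>

lemma is_fourier_iff:
  "is_fourier u F \<longleftrightarrow> u \<in> L2 \<and> F \<in> L2 \<and> ((\<lambda>R. L2_norm (\<lambda>\<xi>. FT (trunc R u) \<xi> - F \<xi>)) \<longlongrightarrow> 0) at_top"
proof -
  {
    assume u: "u \<in> L2" and F: "F \<in> L2"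
    have "(\<integral>\<^sup>+\<xi>. ennreal ((cmod (F \<xi> - FT (trunc R u) \<xi>))\<^sup>2) \<partial>lborel)
        = ennreal ((L2_norm (\<lambda>\<xi>. FT (trunc R u) \<xi> - F \<xi>))\<^sup>2)" for R
      using L2_D(2)[OF L2_diff[OF F FT_trunc_L2[OF u, of R]]]
      by (subst nn_integral_eq_integral) (simp_all add: L2_norm_power2 norm_minus_commute)
    then have "((\<lambda>R. \<integral>\<^sup>+\<xi>. ennreal ((cmod (F \<xi> - FT (trunc R u) \<xi>))\<^sup>2) \<partial>lborel) \<longlongrightarrow> 0) at_top
        \<longleftrightarrow> ((\<lambda>R. (L2_norm (\<lambda>\<xi>. FT (trunc R u) \<xi> - F \<xi>))\<^sup>2) \<longlongrightarrow> 0) at_top"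
      by (simp add: tendsto_ennreal_iff[where x = 0, simplified])
    also have "\<dots> \<longleftrightarrow> ((\<lambda>R. L2_norm (\<lambda>\<xi>. FT (trunc R u) \<xi> - F \<xi>)) \<longlongrightarrow> 0) at_top"
    proof
      assume "((\<lambda>R. (L2_norm (\<lambda>\<xi>. FT (trunc R u) \<xi> - F \<xi>))\<^sup>2) \<longlongrightarrow> 0) at_top"
      from tendsto_real_sqrt[OF this]
      show "((\<lambda>R. L2_norm (\<lambda>\<xi>. FT (trunc R u) \<xi> - F \<xi>)) \<longlongrightarrow> 0) at_top" by simp
    next
      assume "((\<lambda>R. L2_norm (\<lambda>\<xi>. FT (trunc R u) \<xi> - F \<xi>)) \<longlongrightarrow> 0) at_top"
      from tendsto_power[OF this, of 2]
      show "((\<lambda>R. (L2_norm (\<lambda>\<xi>. FT (trunc R u) \<xi> - F \<xi>))\<^sup>2) \<longlongrightarrow> 0) at_top" by simp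
    qed
    finally have "((\<lambda>R. \<integral>\<^sup>+\<xi>. ennreal ((cmod (F \<xi> - FT (trunc R u) \<xi>))\<^sup>2) \<partial>lborel) \<longlongrightarrow> 0) at_top
        \<longleftrightarrow> ((\<lambda>R. L2_norm (\<lambda>\<xi>. FT (trunc R u) \<xi> - F \<xi>)) \<longlongrightarrow> 0) at_top" .
  }
  then show ?thesis unfolding is_fourier_def trunc_FT by blast
qed

lemma fourier_L2: assumes "is_fourier u F" shows "u \<in> L2" "F \<in> L2"
  using assms by (auto simp: is_fourier_iff)

text \<open>The transforms of the truncations form a Cauchy sequence because the transform is isometric up to
  the constant; comparing real radii with integer ones gives convergence along all radii.\<close>

lemma fourier_exists:
  assumes u: "u \<in> L2"
  shows "\<exists>F. is_fourier u F"
proof -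
  let ?T = "\<lambda>R. FT (trunc R u)"
  let ?c = "sqrt plancherel_const"
  have c: "?c > 0" by (simp add: plancherel_const_pos)
  have d: "L2_norm (\<lambda>\<xi>. ?T R \<xi> - ?T S \<xi>) = ?c * L2_norm (\<lambda>x. trunc R u x - trunc S u x)" for R S
    by (intro L2_norm_FT_diff trunc_integrable trunc_L2 u)
  have lim: "(\<lambda>n. L2_norm (\<lambda>x. trunc (real n) u x - u x)) \<longlonglongrightarrow> 0"
    using filterlim_compose[OF trunc_tendsto[OF u] filterlim_real_sequentially] .
  obtain F where F: "F \<in> L2" "(\<lambda>n. L2_norm (\<lambda>\<xi>. ?T (real n) \<xi> - F \<xi>)) \<longlonglongrightarrow> 0"
  proof -
    have "\<exists>N. \<forall>m\<ge>N. \<forall>n\<ge>N. L2_norm (\<lambda>\<xi>. ?T (real m) \<xi> - ?T (real n) \<xi>) < e" if e: "e > 0" for e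
    proof -
      obtain N where N: "\<And>n. n \<ge> N \<Longrightarrow> L2_norm (\<lambda>x. trunc (real n) u x - u x) < e / (2 * ?c)"
        using LIMSEQ_D[OF lim, of "e / (2 * ?c)"] e c by auto
      have "L2_norm (\<lambda>\<xi>. ?T (real m) \<xi> - ?T (real n) \<xi>) < e" if mn: "m \<ge> N" "n \<ge> N" for m n
      proof -
        have "L2_norm (\<lambda>x. trunc (real m) u x - trunc (real n) u x)
            \<le> L2_norm (\<lambda>x. trunc (real m) u x - u x) + L2_norm (\<lambda>x. u x - trunc (real n) u x)"
          by (intro L2_norm_triangle_via trunc_L2 u)
        also have "\<dots> < e / (2 * ?c) + e / (2 * ?c)"
          unfolding L2_norm_commute[of u] by (intro add_strict_mono N mn)
        also have "\<dots> = e / ?c" by (simp add: field_simps)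
        finally show ?thesis using c by (simp add: d field_simps)
      qed
      then show ?thesis by blast
    qed
    then show ?thesis using L2_complete[of "\<lambda>n. ?T (real n)"] FT_trunc_L2[OF u] that by blast
  qed
  have "((\<lambda>R. L2_norm (\<lambda>\<xi>. ?T R \<xi> - F \<xi>)) \<longlongrightarrow> 0) at_top"
  proof -
    have le: "L2_norm (\<lambda>\<xi>. ?T R \<xi> - F \<xi>) \<le> ?c * L2_norm (\<lambda>x. trunc R u x - u x)" for R
    proof (rule LIMSEQ_le_const)
      show "(\<lambda>n. ?c * (L2_norm (\<lambda>x. trunc R u x - u x) + L2_norm (\<lambda>x. trunc (real n) u x - u x))
          + L2_norm (\<lambda>\<xi>. ?T (real n) \<xi> - F \<xi>)) \<longlonglongrightarrow> ?c * L2_norm (\<lambda>x. trunc R u x - u x)"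
        by (rule tendsto_eq_intros lim F | simp)+
      have "L2_norm (\<lambda>\<xi>. ?T R \<xi> - F \<xi>)
          \<le> ?c * (L2_norm (\<lambda>x. trunc R u x - u x) + L2_norm (\<lambda>x. trunc (real n) u x - u x))
            + L2_norm (\<lambda>\<xi>. ?T (real n) \<xi> - F \<xi>)" for n
      proof -
        have "L2_norm (\<lambda>x. trunc R u x - trunc (real n) u x)
            \<le> L2_norm (\<lambda>x. trunc R u x - u x) + L2_norm (\<lambda>x. trunc (real n) u x - u x)"
          using L2_norm_triangle_via[OF trunc_L2[OF u] u trunc_L2[OF u], of R "real n"]
          by (simp add: L2_norm_commute[of u])
        then have "?c * L2_norm (\<lambda>x. trunc R u x - trunc (real n) u x)
            \<le> ?c * (L2_norm (\<lambda>x. trunc R u x - u x) + L2_norm (\<lambda>x. trunc (real n) u x - u x))"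
          using c by (intro mult_left_mono) auto
        moreover have "L2_norm (\<lambda>\<xi>. ?T R \<xi> - F \<xi>) \<le> L2_norm (\<lambda>\<xi>. ?T R \<xi> - ?T (real n) \<xi>) + L2_norm (\<lambda>\<xi>. ?T (real n) \<xi> - F \<xi>)"
          by (intro L2_norm_triangle_via FT_trunc_L2 u F)
        ultimately show ?thesis unfolding d by linarith
      qed
      then show "\<exists>N. \<forall>n\<ge>N. L2_norm (\<lambda>\<xi>. ?T R \<xi> - F \<xi>)
          \<le> ?c * (L2_norm (\<lambda>x. trunc R u x - u x) + L2_norm (\<lambda>x. trunc (real n) u x - u x))
            + L2_norm (\<lambda>\<xi>. ?T (real n) \<xi> - F \<xi>)" by blast
    qed
    have lim0: "((\<lambda>R. ?c * L2_norm (\<lambda>x. trunc R u x - u x)) \<longlongrightarrow> 0) at_top"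
      using tendsto_mult_right_zero[OF trunc_tendsto[OF u]] .
    show ?thesis
      by (rule Lim_null_comparison[OF always_eventually lim0]) (simp add: le)
  qed
  then show ?thesis using u F(1) by (auto simp: is_fourier_iff)
qed

lemma fourier_norm:
  assumes "is_fourier u F" shows "L2_norm F = sqrt plancherel_const * L2_norm u"
proof -
  have uF: "u \<in> L2" "F \<in> L2" "((\<lambda>R. L2_norm (\<lambda>\<xi>. FT (trunc R u) \<xi> - F \<xi>)) \<longlongrightarrow> 0) at_top"
    using assms by (auto simp: is_fourier_iff)
  have "((\<lambda>R. L2_norm (FT (trunc R u))) \<longlongrightarrow> L2_norm F) at_top"
    by (rule L2_norm_tendsto[OF FT_trunc_L2]) (use uF in auto)
  moreover have "((\<lambda>R. L2_norm (FT (trunc R u))) \<longlongrightarrow> sqrt plancherel_const * L2_norm u) at_top"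
    unfolding L2_norm_FT[OF trunc_integrable trunc_L2, OF uF(1) uF(1)]
    by (intro tendsto_mult tendsto_const L2_norm_tendsto[OF trunc_L2] trunc_tendsto uF)
  ultimately show ?thesis using tendsto_unique[OF trivial_limit_at_top_linorder] by blast
qed

lemma fourier_add:
  assumes "is_fourier u F" "is_fourier v G"
  shows "is_fourier (\<lambda>x. u x + v x) (\<lambda>\<xi>. F \<xi> + G \<xi>)"
proof -
  have u: "u \<in> L2" "F \<in> L2" "((\<lambda>R. L2_norm (\<lambda>\<xi>. FT (trunc R u) \<xi> - F \<xi>)) \<longlongrightarrow> 0) at_top"
    and v: "v \<in> L2" "G \<in> L2" "((\<lambda>R. L2_norm (\<lambda>\<xi>. FT (trunc R v) \<xi> - G \<xi>)) \<longlongrightarrow> 0) at_top"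
    using assms by (auto simp: is_fourier_iff)
  have "((\<lambda>R. L2_norm (\<lambda>\<xi>. FT (trunc R (\<lambda>x. u x + v x)) \<xi> - (F \<xi> + G \<xi>))) \<longlongrightarrow> 0) at_top"
  proof (rule Lim_null_comparison)
    show "\<forall>\<^sub>F R in at_top. norm (L2_norm (\<lambda>\<xi>. FT (trunc R (\<lambda>x. u x + v x)) \<xi> - (F \<xi> + G \<xi>)))
        \<le> L2_norm (\<lambda>\<xi>. FT (trunc R u) \<xi> - F \<xi>) + L2_norm (\<lambda>\<xi>. FT (trunc R v) \<xi> - G \<xi>)"
    proof (intro always_eventually allI)
      fix R
      have "trunc R (\<lambda>x. u x + v x) = (\<lambda>x. trunc R u x + trunc R v x)"
        by (auto simp: trunc_def scaleR_add_right)
      then have eq: "(\<lambda>\<xi>. FT (trunc R (\<lambda>x. u x + v x)) \<xi> - (F \<xi> + G \<xi>))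
          = (\<lambda>\<xi>. (FT (trunc R u) \<xi> - F \<xi>) + (FT (trunc R v) \<xi> - G \<xi>))"
        by (simp add: FT_add trunc_integrable u v algebra_simps)
      show "norm (L2_norm (\<lambda>\<xi>. FT (trunc R (\<lambda>x. u x + v x)) \<xi> - (F \<xi> + G \<xi>)))
        \<le> L2_norm (\<lambda>\<xi>. FT (trunc R u) \<xi> - F \<xi>) + L2_norm (\<lambda>\<xi>. FT (trunc R v) \<xi> - G \<xi>)"
        unfolding eq using L2_norm_triangle[OF L2_diff[OF FT_trunc_L2[OF u(1)] u(2)] L2_diff[OF FT_trunc_L2[OF v(1)] v(2)], of R R]
        by simp
    qed
    show "((\<lambda>R. L2_norm (\<lambda>\<xi>. FT (trunc R u) \<xi> - F \<xi>) + L2_norm (\<lambda>\<xi>. FT (trunc R v) \<xi> - G \<xi>)) \<longlongrightarrow> 0) at_top"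
      using tendsto_add[OF u(3) v(3)] by simp
  qed
  then show ?thesis using u v by (simp add: is_fourier_iff L2_add)
qed

lemma fourier_cmult:
  assumes "is_fourier u F" shows "is_fourier (\<lambda>x. c * u x) (\<lambda>\<xi>. c * F \<xi>)"
proof -
  have u: "u \<in> L2" "F \<in> L2" "((\<lambda>R. L2_norm (\<lambda>\<xi>. FT (trunc R u) \<xi> - F \<xi>)) \<longlongrightarrow> 0) at_top"
    using assms by (auto simp: is_fourier_iff)
  have "trunc R (\<lambda>x. c * u x) = (\<lambda>x. c * trunc R u x)" for R
    by (auto simp: trunc_def)
  then have "L2_norm (\<lambda>\<xi>. FT (trunc R (\<lambda>x. c * u x)) \<xi> - c * F \<xi>) = cmod c * L2_norm (\<lambda>\<xi>. FT (trunc R u) \<xi> - F \<xi>)" for R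
    unfolding L2_norm_cmult[symmetric] by (simp add: FT_cmult right_diff_distrib)
  then show ?thesis
    using u tendsto_mult_right_zero[OF u(3)] by (simp add: is_fourier_iff L2_cmult)
qed

lemma fourier_diff:
  assumes "is_fourier u F" "is_fourier v G"
  shows "is_fourier (\<lambda>x. u x - v x) (\<lambda>\<xi>. F \<xi> - G \<xi>)"
  using fourier_add[OF assms(1) fourier_cmult[OF assms(2), of "-1"]] by simp

lemma fourier_cong:
  assumes F: "is_fourier u F"
    and v: "v \<in> borel_measurable lborel" "AE x in lborel. u x = v x"
    and G: "G \<in> borel_measurable lborel" "AE \<xi> in lborel. F \<xi> = G \<xi>"
  shows "is_fourier v G"
proof -
  have u: "u \<in> L2" "F \<in> L2" using fourier_L2[OF F] .
  have vG: "v \<in> L2" "G \<in> L2" using L2_AE_cong u v G by blast+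
  have "FT (trunc R u) \<xi> = FT (trunc R v) \<xi>" for R \<xi>
    unfolding FT_def
  proof (rule integral_cong_AE)
    show "AE x in lborel. exp (- \<i> * complex_of_real (x \<bullet> \<xi>)) * trunc R u x = exp (- \<i> * complex_of_real (x \<bullet> \<xi>)) * trunc R v x"
      using v(2) by eventually_elim (simp add: trunc_def)
  qed (use trunc_measurable[OF L2_D(3)[OF u(1)], of R] trunc_measurable[OF L2_D(3)[OF vG(1)], of R] in measurable)
  moreover have "L2_norm (\<lambda>\<xi>. FT (trunc R v) \<xi> - F \<xi>) = L2_norm (\<lambda>\<xi>. FT (trunc R v) \<xi> - G \<xi>)" for R
  proof (rule L2_norm_AE_cong)
    show "AE \<xi> in lborel. FT (trunc R v) \<xi> - F \<xi> = FT (trunc R v) \<xi> - G \<xi>"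
      using G(2) by eventually_elim simp
  qed (use L2_D(1)[OF FT_trunc_L2[OF vG(1)], of R] L2_D(1)[OF u(2)] G(1) in auto)
  ultimately show ?thesis using F vG by (simp add: is_fourier_iff)
qed

lemma fourier_unique:
  assumes "is_fourier u F" "is_fourier v G" "AE x in lborel. u x = v x"
  shows "AE \<xi> in lborel. F \<xi> = G \<xi>"
proof -
  note d = fourier_diff[OF assms(1,2)]
  have "L2_norm (\<lambda>x. u x - v x) = 0"
    using L2_norm_eq_0[OF fourier_L2(1)[OF d]] assms(3) by simp
  then have "L2_norm (\<lambda>\<xi>. F \<xi> - G \<xi>) = 0" using fourier_norm[OF d] by simp
  then show ?thesis using L2_norm_eq_0[OF fourier_L2(2)[OF d]] by simp
qed

lemma fourier_inj:
  assumes "is_fourier u F" "is_fourier v G" "AE \<xi> in lborel. F \<xi> = G \<xi>"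
  shows "AE x in lborel. u x = v x"
proof -
  note d = fourier_diff[OF assms(1,2)]
  have "L2_norm (\<lambda>\<xi>. F \<xi> - G \<xi>) = 0"
    using L2_norm_eq_0[OF fourier_L2(2)[OF d]] assms(3) by simp
  then have "L2_norm (\<lambda>x. u x - v x) = 0" using fourier_norm[OF d] plancherel_const_pos by simp
  then show ?thesis using L2_norm_eq_0[OF fourier_L2(1)[OF d]] by simp
qed

lemma fourier_pairing:
  assumes "is_fourier u F" "is_fourier v G"
  shows "(\<integral>x. F x * v x \<partial>lborel) = (\<integral>x. u x * G x \<partial>lborel)"
proof -
  have u: "u \<in> L2" "F \<in> L2" "((\<lambda>R. L2_norm (\<lambda>\<xi>. FT (trunc R u) \<xi> - F \<xi>)) \<longlongrightarrow> 0) at_top"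
    and v: "v \<in> L2" "G \<in> L2" "((\<lambda>R. L2_norm (\<lambda>\<xi>. FT (trunc R v) \<xi> - G \<xi>)) \<longlongrightarrow> 0) at_top"
    using assms by (auto simp: is_fourier_iff)
  have "((\<lambda>R. \<integral>x. FT (trunc R u) x * trunc R v x \<partial>lborel) \<longlongrightarrow> (\<integral>x. F x * v x \<partial>lborel)) at_top"
    by (intro L2_pairing_tendsto FT_trunc_L2 trunc_L2 trunc_tendsto u v)
  moreover have "((\<lambda>R. \<integral>x. trunc R u x * FT (trunc R v) x \<partial>lborel) \<longlongrightarrow> (\<integral>x. u x * G x \<partial>lborel)) at_top"
    by (intro L2_pairing_tendsto FT_trunc_L2 trunc_L2 trunc_tendsto u v)
  ultimately show ?thesis
    unfolding FT_multiplication[OF trunc_integrable[OF u(1)] trunc_integrable[OF v(1)]]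
    using tendsto_unique[OF trivial_limit_at_top_linorder] by blast
qed

lemma fourier_L1:
  assumes f: "integrable lborel f" "f \<in> L2"
  shows "is_fourier f (FT f)"
proof -
  have "((\<lambda>R. sqrt plancherel_const * L2_norm (\<lambda>x. trunc R f x - f x)) \<longlongrightarrow> 0) at_top"
    by (rule tendsto_mult_right_zero[OF trunc_tendsto[OF f(2)]])
  then show ?thesis
    using f plancherel_L1_L2[OF f]
    by (simp add: is_fourier_iff L2_norm_FT_diff trunc_integrable trunc_L2)
qed

lemma fourier_cnj_reflect:
  assumes "is_fourier u F"
  shows "is_fourier (\<lambda>x. cnj (u (- x))) (\<lambda>\<xi>. cnj (F \<xi>))"
proof -
  have u: "u \<in> L2" "F \<in> L2" "((\<lambda>R. L2_norm (\<lambda>\<xi>. FT (trunc R u) \<xi> - F \<xi>)) \<longlongrightarrow> 0) at_top"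
    using assms by (auto simp: is_fourier_iff)
  have "FT (trunc R (\<lambda>x. cnj (u (- x)))) \<xi> = cnj (FT (trunc R u) \<xi>)" for R \<xi>
  proof -
    have "FT (trunc R (\<lambda>x. cnj (u (- x)))) \<xi> = (\<integral>x. exp (- \<i> * complex_of_real (- x \<bullet> - \<xi>)) * cnj (trunc R u (- x)) \<partial>lborel)"
      unfolding FT_def by (simp add: trunc_def indicator_def)
    also have "\<dots> = (\<integral>x. exp (- \<i> * complex_of_real (x \<bullet> - \<xi>)) * cnj (trunc R u x) \<partial>lborel)"
      using trunc_measurable[OF L2_D(3)[OF u(1)], of R]
      by (intro lborel_preserving_integral[OF lborel_preserving_uminus] borel_measurable_times character_measurable)
        (auto intro!: borel_measurable_continuous_on[where f = cnj] continuous_intros)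
    finally show ?thesis unfolding cnj_FT by (simp add: FT_def)
  qed
  then have "L2_norm (\<lambda>\<xi>. FT (trunc R (\<lambda>x. cnj (u (- x)))) \<xi> - cnj (F \<xi>)) = L2_norm (\<lambda>\<xi>. FT (trunc R u) \<xi> - F \<xi>)" for R
    unfolding L2_norm_def by (simp flip: complex_cnj_diff)
  then show ?thesis
    using u by (simp add: is_fourier_iff L2_cnj lborel_preserving_L2(1)[OF lborel_preserving_uminus])
qed

text \<open>Inversion needs no further limit: with \<open>K\<close> the transform of the transform of \<open>G\<close> and
  \<open>c = (2\<pi>)\<^sup>3\<close>, the pairing formula and the isometry give \<open>\<langle>K, G(-\<cdot>)\<rangle> = c\<parallel>G\<parallel>\<^sup>2\<close> and
  \<open>\<parallel>K\<parallel> = c\<parallel>G\<parallel>\<close>, so \<open>K - c G(-\<cdot>)\<close> has norm zero.\<close>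

lemma fourier_inversion:
  assumes GH: "is_fourier G H"
  shows "is_fourier H (\<lambda>\<xi>. complex_of_real plancherel_const * G (- \<xi>))"
proof -
  let ?c = plancherel_const
  have L: "G \<in> L2" "H \<in> L2" using fourier_L2[OF GH] .
  obtain K where K: "is_fourier H K" using fourier_exists[OF L(2)] ..
  have KL: "K \<in> L2" using fourier_L2(2)[OF K] .
  define g where "g \<xi> = G (- \<xi>)" for \<xi>
  have g: "g \<in> L2" "L2_norm g = L2_norm G"
    using lborel_preserving_L2[OF lborel_preserving_uminus L(1)] by (auto simp: g_def[abs_def])
  have "(\<integral>x. K x * cnj (g x) \<partial>lborel) = (\<integral>x. H x * cnj (H x) \<partial>lborel)"
    using fourier_pairing[OF K fourier_cnj_reflect[OF GH]] by (simp add: g_def)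
  then have Kg: "(\<integral>x. K x * cnj (g x) \<partial>lborel) = complex_of_real ((L2_norm H)\<^sup>2)"
    unfolding integral_mult_cnj .
  have H2: "(L2_norm H)\<^sup>2 = ?c * (L2_norm G)\<^sup>2"
    using plancherel_const_pos by (simp add: fourier_norm[OF GH] power_mult_distrib)
  have K2: "(L2_norm K)\<^sup>2 = ?c * (?c * (L2_norm G)\<^sup>2)"
    using plancherel_const_pos H2 by (simp add: fourier_norm[OF K] power_mult_distrib)
  have ip: "(\<integral>x. K x \<bullet> (- ?c *\<^sub>R g x) \<partial>lborel) = - ?c * Re (\<integral>x. K x * cnj (g x) \<partial>lborel)"
  proof -
    have "K x \<bullet> g x = Re (K x * cnj (g x))" for x
      by (simp add: inner_complex_def)
    then have "(\<integral>x. K x \<bullet> g x \<partial>lborel) = Re (\<integral>x. K x * cnj (g x) \<partial>lborel)"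
      using integral_Re[OF integrable_mult_L2[OF KL L2_cnj[OF g(1)]]] by (simp only:)
    then show ?thesis by (simp only: inner_scaleR_right integral_mult_right_zero)
  qed
  have "(L2_norm (\<lambda>x. K x + (- ?c) *\<^sub>R g x))\<^sup>2 = 0"
    unfolding L2_norm_add_power2[OF KL L2_scaleR[OF g(1)]] L2_norm_scaleR ip Kg K2 H2 g(2)
    by (simp add: power_mult_distrib power2_eq_square)
  then have "AE x in lborel. K x + (- ?c) *\<^sub>R g x = 0"
    unfolding power2_eq_square mult_eq_0_iff disj_absorb
    by (rule iffD1[OF L2_norm_eq_0[OF L2_add[OF KL L2_scaleR[OF g(1)]]]])
  then have "AE x in lborel. K x = complex_of_real ?c * G (- x)"
    by eventually_elim (simp add: g_def scaleR_conv_of_real)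
  moreover have "(\<lambda>x. complex_of_real ?c * G (- x)) \<in> borel_measurable lborel"
    using L2_D(1)[OF L2_cmult[OF g(1)]] by (simp add: g_def)
  ultimately show ?thesis
    using L2_D(1)[OF L(2)] by (intro fourier_cong[OF K]) auto
qed

subsection \<open>Bounded multipliers\<close>

lemma fourier_surj:
  assumes "G \<in> L2"
  obtains g where "is_fourier g G"
proof -
  define G' where "G' \<xi> = complex_of_real (1 / plancherel_const) * G (- \<xi>)" for \<xi>
  have "G' \<in> L2" unfolding G'_def[abs_def]
    by (intro L2_cmult lborel_preserving_L2(1)[OF lborel_preserving_uminus] assms)
  then obtain H where "is_fourier G' H" using fourier_exists by blast
  from fourier_inversion[OF this] have "is_fourier H G"
    using plancherel_const_pos by (simp add: G'_def)
  then show ?thesis by (rule that)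
qed

text \<open>Surjectivity of the transform makes the choice in the definition of \<^const>\<open>multiplier\<close> a choice
  from a nonempty set, and uniqueness of the transform makes it independent of the transform of \<open>u\<close>
  used there.\<close>

lemma multiplier_fourier:
  assumes m: "m \<in> borel_measurable borel" "\<And>\<xi>. cmod (m \<xi>) \<le> C"
    and F: "is_fourier u F"
  shows "is_fourier (multiplier m u) (\<lambda>\<xi>. m \<xi> * F \<xi>)"
proof -
  have "(\<lambda>\<xi>. m \<xi> * F \<xi>) \<in> L2" by (rule L2_mult_bounded[OF fourier_L2(2)[OF F] m])
  then obtain g where "is_fourier g (\<lambda>\<xi>. m \<xi> * F \<xi>)" by (rule fourier_surj)
  then have "\<exists>g. is_multiplier m u g" using F unfolding is_multiplier_def by blast
  then have "is_multiplier m u (multiplier m u)" unfolding multiplier_def by (rule someI_ex)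
  then obtain G where G: "is_fourier u G" "is_fourier (multiplier m u) (\<lambda>\<xi>. m \<xi> * G \<xi>)"
    unfolding is_multiplier_def by blast
  have "AE \<xi> in lborel. G \<xi> = F \<xi>" by (rule fourier_unique[OF G(1) F]) simp
  then have "AE \<xi> in lborel. m \<xi> * G \<xi> = m \<xi> * F \<xi>" by eventually_elim simp
  then show ?thesis
    by (rule fourier_cong[OF G(2) L2_D(1)[OF fourier_L2(1)[OF G(2)]] AE_I2[OF refl]
          L2_D(1)[OF \<open>(\<lambda>\<xi>. m \<xi> * F \<xi>) \<in> L2\<close>]])
qed

section \<open>Fourier transforms of test functions as test functions\<close>

lemma test_fourier:
  assumes "\<psi> \<in> test_functions"
  shows "is_fourier \<psi> (FT \<psi>)" "FT \<psi> \<in> L2"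
  using fourier_L1[OF test_integrable test_L2] fourier_L2(2) assms by blast+

lemma has_derivative_inner_of_real:
  "((\<lambda>\<xi>::real^3. complex_of_real (\<xi> \<bullet> x)) has_derivative (\<lambda>h. complex_of_real (h \<bullet> x))) (at \<xi>)"
  by (intro bounded_linear_imp_has_derivative bounded_linear_compose[OF bounded_linear_of_real]
      bounded_linear_inner_left)

lemma has_derivative_character:
  "((\<lambda>\<xi>. c * exp (- \<i> * complex_of_real (\<xi> \<bullet> x))) has_derivative
    (\<lambda>h. c * (exp (- \<i> * complex_of_real (\<xi> \<bullet> x)) * (- \<i> * complex_of_real (h \<bullet> x))))) (at (\<xi>::real^3))"
proof -
  have 1: "((\<lambda>\<xi>. - \<i> * complex_of_real (\<xi> \<bullet> x)) has_derivative (\<lambda>h. - \<i> * complex_of_real (h \<bullet> x))) (at \<xi>)"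
    by (rule has_derivative_mult_right[OF has_derivative_inner_of_real])
  have "(exp has_derivative (*) (exp (- \<i> * complex_of_real (\<xi> \<bullet> x)))) (at (- \<i> * complex_of_real (\<xi> \<bullet> x)))"
    using DERIV_exp has_field_derivative_def by blast
  from has_derivative_mult_right[OF has_derivative_compose[OF 1 this], of c] show ?thesis by simp
qed

lemma partial_deriv_character:
  "partial_deriv j (\<lambda>\<xi>. c * exp (- \<i> * complex_of_real (\<xi> \<bullet> x))) \<xi>
    = (c * (- \<i> * complex_of_real (x $ j))) * exp (- \<i> * complex_of_real (\<xi> \<bullet> x))"
  by (subst partial_deriv_eq[OF has_derivative_character]) (simp add: inner_axis')

lemma smooth_character: "smooth (\<lambda>\<xi>. c * exp (- \<i> * complex_of_real (\<xi> \<bullet> x)))"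
proof (rule smooth_coinduct[where P = "\<lambda>\<phi>. \<exists>c. \<phi> = (\<lambda>\<xi>. c * exp (- \<i> * complex_of_real (\<xi> \<bullet> x)))"])
  fix \<phi> j assume "\<exists>c. \<phi> = (\<lambda>\<xi>. c * exp (- \<i> * complex_of_real (\<xi> \<bullet> x)))"
  then obtain c where c: "\<phi> = (\<lambda>\<xi>. c * exp (- \<i> * complex_of_real (\<xi> \<bullet> x)))" ..
  have "partial_deriv j \<phi> = (\<lambda>\<xi>. (c * (- \<i> * complex_of_real (x $ j))) * exp (- \<i> * complex_of_real (\<xi> \<bullet> x)))"
    unfolding c by (rule ext) (rule partial_deriv_character)
  then show "\<exists>c. partial_deriv j \<phi> = (\<lambda>\<xi>. c * exp (- \<i> * complex_of_real (\<xi> \<bullet> x)))" by (rule exI)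
next
  fix \<phi> y assume "\<exists>c. \<phi> = (\<lambda>\<xi>. c * exp (- \<i> * complex_of_real (\<xi> \<bullet> x)))"
  then show "\<phi> differentiable (at y)" using differentiableI[OF has_derivative_character] by blast
qed blast

lemma FT_partial:
  assumes \<psi>: "\<psi> \<in> test_functions"
  shows "FT (partial_deriv j \<psi>) x = \<i> * complex_of_real (x $ j) * FT \<psi> x"
proof -
  have "FT (partial_deriv j \<psi>) x = (\<integral>\<xi>. (1 * exp (- \<i> * complex_of_real (\<xi> \<bullet> x))) * partial_deriv j \<psi> \<xi> \<partial>lborel)"
    by (simp add: FT_def)
  also have "\<dots> = - (\<integral>\<xi>. partial_deriv j (\<lambda>\<xi>. 1 * exp (- \<i> * complex_of_real (\<xi> \<bullet> x))) \<xi> * \<psi> \<xi> \<partial>lborel)"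
    by (rule integral_by_parts[OF \<psi> smooth_character])
  also have "\<dots> = - (\<integral>\<xi>. (- \<i> * complex_of_real (x $ j)) * (exp (- \<i> * complex_of_real (\<xi> \<bullet> x)) * \<psi> \<xi>) \<partial>lborel)"
    unfolding partial_deriv_character by (simp add: mult.assoc)
  also have "\<dots> = \<i> * complex_of_real (x $ j) * FT \<psi> x"
    unfolding integral_mult_right_zero FT_def by simp
  finally show ?thesis .
qed

lemma test_coord_mult:
  "\<psi> \<in> test_functions \<Longrightarrow> (\<lambda>\<xi>. c * complex_of_real (\<xi> $ j) * \<psi> \<xi>) \<in> test_functions"
  by (intro test_mult_smooth smooth_mult smooth_const smooth_coord)

lemma test_norm_power2_mult:
  assumes "\<psi> \<in> test_functions"
  shows "(\<lambda>\<xi>. complex_of_real ((norm \<xi>)\<^sup>2) * \<psi> \<xi>) \<in> test_functions"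
proof -
  have "complex_of_real ((norm \<xi>)\<^sup>2) = (\<Sum>j\<in>UNIV. complex_of_real (\<xi> $ j) * complex_of_real (\<xi> $ j))" for \<xi> :: "real^3"
    unfolding power2_norm_eq_inner inner_vec_def by simp
  then have "smooth (\<lambda>\<xi>::real^3. complex_of_real ((norm \<xi>)\<^sup>2))"
    using smooth_sum[of UNIV "\<lambda>j \<xi>. complex_of_real (\<xi> $ j) * complex_of_real (\<xi> $ j)"]
    by (simp add: smooth_mult smooth_coord)
  then show ?thesis by (rule test_mult_smooth(1)[OF assms])
qed

text \<open>Differentiation under the integral sign, from \<open>|e\<^sup>-\<^sup>i\<^sup>s - 1 + is| \<le> s\<^sup>2\<close>.\<close>

lemma has_derivative_FT:
  assumes \<psi>: "\<psi> \<in> test_functions"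
  shows "(FT \<psi> has_derivative (\<lambda>h. \<Sum>j\<in>UNIV. h $ j *\<^sub>R FT (\<lambda>\<xi>. (- \<i>) * complex_of_real (\<xi> $ j) * \<psi> \<xi>) x)) (at x)"
proof -
  let ?e = "\<lambda>x \<xi>. exp (- \<i> * complex_of_real (\<xi> \<bullet> x))"
  let ?D = "\<lambda>h. \<Sum>j\<in>UNIV. h $ j *\<^sub>R FT (\<lambda>\<xi>. (- \<i>) * complex_of_real (\<xi> $ j) * \<psi> \<xi>) x"
  define C where "C = (\<integral>\<xi>. cmod (complex_of_real ((norm \<xi>)\<^sup>2) * \<psi> \<xi>) \<partial>lborel)"
  have i0: "integrable lborel (\<lambda>\<xi>. ?e y \<xi> * \<psi> \<xi>)" for y
    by (rule integrable_character_mult[OF test_integrable[OF \<psi>]])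
  have i2: "integrable lborel (\<lambda>\<xi>. cmod (complex_of_real ((norm \<xi>)\<^sup>2) * \<psi> \<xi>))"
    by (intro integrable_norm test_integrable test_norm_power2_mult \<psi>)
  have ij: "integrable lborel (\<lambda>\<xi>. ?e x \<xi> * ((- \<i>) * complex_of_real (\<xi> $ j) * \<psi> \<xi>))" for j
    by (rule integrable_character_mult[OF test_integrable[OF test_coord_mult[OF \<psi>]]])
  have D: "?D h = (\<integral>\<xi>. ?e x \<xi> * (- \<i> * complex_of_real (\<xi> \<bullet> h)) * \<psi> \<xi> \<partial>lborel)" 
    and iD: "integrable lborel (\<lambda>\<xi>. ?e x \<xi> * (- \<i> * complex_of_real (\<xi> \<bullet> h)) * \<psi> \<xi>)" for h
  proof -
    have eq: "?e x \<xi> * (- \<i> * complex_of_real (\<xi> \<bullet> h)) * \<psi> \<xi>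
        = (\<Sum>j\<in>UNIV. h $ j *\<^sub>R (?e x \<xi> * ((- \<i>) * complex_of_real (\<xi> $ j) * \<psi> \<xi>)))" for \<xi>
      by (simp add: inner_vec_def scaleR_conv_of_real sum_distrib_left sum_distrib_right sum_negf mult_ac)
    show "integrable lborel (\<lambda>\<xi>. ?e x \<xi> * (- \<i> * complex_of_real (\<xi> \<bullet> h)) * \<psi> \<xi>)"
      unfolding eq by (intro Bochner_Integration.integrable_sum integrable_scaleR_right ij)
    show "?D h = (\<integral>\<xi>. ?e x \<xi> * (- \<i> * complex_of_real (\<xi> \<bullet> h)) * \<psi> \<xi> \<partial>lborel)"
      unfolding eq
      by (subst Bochner_Integration.integral_sum) (intro integrable_scaleR_right ij, simp add: FT_def)
  qed
  have bl: "bounded_linear ?D"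
    by (intro bounded_linear_sum bounded_linear_compose[OF bounded_linear_scaleR_left bounded_linear_vec_nth])
  have est: "norm (FT \<psi> (x + h) - FT \<psi> x - ?D h) \<le> (norm h)\<^sup>2 * C" for h
  proof -
    have "FT \<psi> (x + h) - FT \<psi> x - ?D h
        = (\<integral>\<xi>. ?e (x + h) \<xi> * \<psi> \<xi> - ?e x \<xi> * \<psi> \<xi> - ?e x \<xi> * (- \<i> * complex_of_real (\<xi> \<bullet> h)) * \<psi> \<xi> \<partial>lborel)"
      unfolding D unfolding FT_def Bochner_Integration.integral_diff[OF Bochner_Integration.integrable_diff[OF i0 i0] iD]
        Bochner_Integration.integral_diff[OF i0 i0] ..
    also have "norm \<dots> \<le> (\<integral>\<xi>. (norm h)\<^sup>2 * cmod (complex_of_real ((norm \<xi>)\<^sup>2) * \<psi> \<xi>) \<partial>lborel)"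
    proof (rule order_trans[OF integral_norm_bound integral_mono])
      fix \<xi> :: "real^3"
      let ?s = "\<xi> \<bullet> h"
      have "?e (x + h) \<xi> * \<psi> \<xi> - ?e x \<xi> * \<psi> \<xi> - ?e x \<xi> * (- \<i> * complex_of_real ?s) * \<psi> \<xi>
          = ?e x \<xi> * \<psi> \<xi> * (iexp (- ?s) - (\<Sum>k\<le>1. (\<i> * complex_of_real (- ?s)) ^ k / fact k))"
        by (simp add: inner_add_right algebra_simps exp_diff exp_minus flip: exp_add,
            simp add: divide_inverse)
      moreover have "cmod (iexp (- ?s) - (\<Sum>k\<le>1. (\<i> * complex_of_real (- ?s)) ^ k / fact k)) \<le> \<bar>- ?s\<bar> ^ Suc 1 / fact (Suc 1)"
        by (rule iexp_approx1)
      moreover have "\<bar>- ?s\<bar> ^ Suc 1 / fact (Suc 1) \<le> (norm h)\<^sup>2 * (norm \<xi>)\<^sup>2"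
      proof -
        have "\<bar>?s\<bar>\<^sup>2 \<le> (norm \<xi> * norm h)\<^sup>2" by (intro power_mono Cauchy_Schwarz_ineq2) simp
        moreover have "\<bar>- ?s\<bar> ^ Suc 1 / fact (Suc 1) \<le> \<bar>?s\<bar>\<^sup>2" by (simp add: power2_eq_square)
        ultimately show ?thesis unfolding power_mult_distrib by (simp only: mult.commute)
      qed
      ultimately show "norm (?e (x + h) \<xi> * \<psi> \<xi> - ?e x \<xi> * \<psi> \<xi> - ?e x \<xi> * (- \<i> * complex_of_real ?s) * \<psi> \<xi>)
          \<le> (norm h)\<^sup>2 * cmod (complex_of_real ((norm \<xi>)\<^sup>2) * \<psi> \<xi>)"
        using mult_left_mono[of "cmod (iexp (- ?s) - (\<Sum>k\<le>1. (\<i> * complex_of_real (- ?s)) ^ k / fact k))"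
            "(norm h)\<^sup>2 * (norm \<xi>)\<^sup>2" "cmod (\<psi> \<xi>)"]
        by (simp add: norm_mult norm_power mult_ac)
    qed (use i2 i0 iD in auto)
    also have "\<dots> = (norm h)\<^sup>2 * C" by (simp add: C_def)
    finally show ?thesis .
  qed
  have "(\<lambda>h. norm (FT \<psi> (x + h) - FT \<psi> x - ?D h) / norm h) \<midarrow>0\<rightarrow> 0"
  proof (rule Lim_null_comparison)
    show "\<forall>\<^sub>F h in at 0. norm (norm (FT \<psi> (x + h) - FT \<psi> x - ?D h) / norm h) \<le> norm h * C"
    proof (intro always_eventually allI)
      fix h :: "real^3"
      show "norm (norm (FT \<psi> (x + h) - FT \<psi> x - ?D h) / norm h) \<le> norm h * C"
        using est[of h] by (cases "h = 0") (simp_all add: divide_le_eq power2_eq_square mult_ac)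
    qed
    show "(\<lambda>h. norm h * C) \<midarrow>0\<rightarrow> 0"
      by (rule tendsto_eq_intros refl | simp)+
  qed
  then show ?thesis using bl by (simp add: has_derivative_at)
qed

lemma partial_deriv_FT:
  assumes "\<psi> \<in> test_functions"
  shows "partial_deriv j (FT \<psi>) = FT (\<lambda>\<xi>. (- \<i>) * complex_of_real (\<xi> $ j) * \<psi> \<xi>)"
proof
  fix x
  show "partial_deriv j (FT \<psi>) x = FT (\<lambda>\<xi>. (- \<i>) * complex_of_real (\<xi> $ j) * \<psi> \<xi>) x"
    by (subst partial_deriv_eq[OF has_derivative_FT[OF assms]])
      (simp add: axis_def if_distrib[of "\<lambda>a. a *\<^sub>R _"] sum.delta cong: if_cong)
qed

lemma smooth_FT:
  assumes "\<psi> \<in> test_functions"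
  shows "smooth (FT \<psi>)"
proof (rule smooth_coinduct[where P = "\<lambda>\<phi>. \<exists>\<psi>\<in>test_functions. \<phi> = FT \<psi>"])
  fix \<phi> j assume "\<exists>\<psi>\<in>test_functions. \<phi> = FT \<psi>"
  then show "\<exists>\<psi>\<in>test_functions. partial_deriv j \<phi> = FT \<psi>"
    using partial_deriv_FT test_coord_mult by blast
next
  fix \<phi> x assume "\<exists>\<psi>\<in>test_functions. \<phi> = FT \<psi>"
  then show "\<phi> differentiable (at x)" using differentiableI[OF has_derivative_FT] by blast
qed (rule bexI[OF refl assms])

lemma laplacian_FT:
  assumes \<psi>: "\<psi> \<in> test_functions"
  shows "laplacian (FT \<psi>) x = - FT (\<lambda>\<xi>. complex_of_real ((norm \<xi>)\<^sup>2) * \<psi> \<xi>) x"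
proof -
  note c = test_coord_mult[OF \<psi>]
  have ii: "\<i> * (\<i> * z) = - z" for z by (simp flip: mult.assoc)
  have eq: "complex_of_real ((norm \<xi>)\<^sup>2) * \<psi> \<xi>
      = (\<Sum>j\<in>UNIV. - ((- \<i>) * complex_of_real (\<xi> $ j) * ((- \<i>) * complex_of_real (\<xi> $ j) * \<psi> \<xi>)))" for \<xi> :: "real^3"
    unfolding power2_norm_eq_inner inner_vec_def
    by (simp add: sum_distrib_right sum_distrib_left ii mult_ac)
  let ?H = "\<lambda>j \<xi>. (- \<i>) * complex_of_real (\<xi> $ j) * ((- \<i>) * complex_of_real (\<xi> $ j) * \<psi> \<xi>)"
  have "FT (\<lambda>\<xi>. \<Sum>j\<in>UNIV. - ?H j \<xi>) x = (\<Sum>j\<in>UNIV. FT (\<lambda>\<xi>. - ?H j \<xi>) x)"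
    unfolding FT_def sum_distrib_left
    by (rule Bochner_Integration.integral_sum, rule integrable_character_mult,
        rule Bochner_Integration.integrable_minus, rule test_integrable, rule test_coord_mult, rule c)
  also have "\<dots> = (\<Sum>j\<in>UNIV. - FT (?H j) x)"
    by (intro sum.cong refl) (simp only: FT_def mult_minus_right Bochner_Integration.integral_minus)
  finally show ?thesis
    unfolding laplacian_def eq partial_deriv_FT[OF \<psi>] partial_deriv_FT[OF c] by (simp only: sum_negf minus_minus)
qed

text \<open>The factor \<open>\<xi>\<^sub>1\<close> produced by \<open>\<partial>\<^sub>x\<close> commutes with the derivative \<open>\<partial>\<^sub>2\<close> produced by \<open>y\<close>; this is why the
  shear term becomes the vector field \<open>\<xi>\<^sub>1 \<partial>\<^sub>2\<close> without an additional term of order zero.\<close>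

lemma shear_FT:
  assumes \<psi>: "\<psi> \<in> test_functions"
  shows "complex_of_real (x $ 2) * partial_deriv 1 (FT \<psi>) x = - FT (\<lambda>\<xi>. complex_of_real (\<xi> $ 1) * partial_deriv 2 \<psi> \<xi>) x"
proof -
  let ?\<eta> = "\<lambda>\<xi>. (- \<i>) * complex_of_real (\<xi> $ 1) * \<psi> \<xi>"
  have "partial_deriv 2 ?\<eta> \<xi> = (- \<i>) * (complex_of_real (\<xi> $ 1) * partial_deriv 2 \<psi> \<xi>)" for \<xi>
    unfolding mult.assoc
    by (simp only: partial_deriv_cmult[OF smooth_mult[OF smooth_coord test_smooth[OF \<psi>]]]
        partial_deriv_mult[OF smooth_coord test_smooth[OF \<psi>]] partial_deriv_coord) simp
  then have "partial_deriv 2 ?\<eta> = (\<lambda>\<xi>. (- \<i>) * (complex_of_real (\<xi> $ 1) * partial_deriv 2 \<psi> \<xi>))" by blast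
  then have E: "(- \<i>) * FT (\<lambda>\<xi>. complex_of_real (\<xi> $ 1) * partial_deriv 2 \<psi> \<xi>) x = \<i> * complex_of_real (x $ 2) * FT ?\<eta> x"
    using FT_partial[OF test_coord_mult[OF \<psi>], of 2 "- \<i>" 1 x] by (simp only: FT_cmult)
  have "complex_of_real (x $ 2) * FT ?\<eta> x = (- \<i>) * (\<i> * complex_of_real (x $ 2) * FT ?\<eta> x)"
    by (simp add: mult.assoc[symmetric])
  also have "\<dots> = - FT (\<lambda>\<xi>. complex_of_real (\<xi> $ 1) * partial_deriv 2 \<psi> \<xi>) x"
    unfolding E[symmetric] by (simp add: mult.assoc[symmetric])
  finally show ?thesis unfolding partial_deriv_FT[OF \<psi>] .
qed

subsection \<open>Cutoffs\<close>

text \<open>Dilations of one test function with value 1 at the origin. Multiplying the gradient by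
  \<open>|x|\<close> is scale invariant, hence bounded, and tends to zero because it vanishes at the origin.\<close>

lemma cutoff_sequence:
  obtains \<kappa> :: "nat \<Rightarrow> real^3 \<Rightarrow> complex" and C :: real
  where "\<And>n. \<kappa> n \<in> test_functions" "C > 0"
    "\<And>n x. cmod (\<kappa> n x) \<le> C" "\<And>x. (\<lambda>n. \<kappa> n x) \<longlonglongrightarrow> 1"
    "\<And>n j x. cmod (partial_deriv j (\<kappa> n) x) \<le> C" "\<And>j x. (\<lambda>n. partial_deriv j (\<kappa> n) x) \<longlonglongrightarrow> 0"
    "\<And>n i j x. cmod (complex_of_real (x $ i) * partial_deriv j (\<kappa> n) x) \<le> C"
    "\<And>n j k x. cmod (partial_deriv j (partial_deriv k (\<kappa> n)) x) \<le> C"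
    "\<And>j k x. (\<lambda>n. partial_deriv j (partial_deriv k (\<kappa> n)) x) \<longlonglongrightarrow> 0"
proof -
  define \<theta> :: "real^3 \<Rightarrow> complex" where "\<theta> x = (\<Prod>j\<in>UNIV. complex_of_real (exp 2) *
      (complex_of_real (flat_exp [:1:] (1 * x $ j + 1)) * complex_of_real (flat_exp [:1:] (- 1 * x $ j + 1))))" for x
  \<comment> \<open>each coordinate contributes \<open>e\<^sup>2 e\<^sup>-\<^sup>1 e\<^sup>-\<^sup>1 = 1\<close> at the origin\<close>
  have \<theta>0: "\<theta> 0 = 1"
    by (simp add: \<theta>_def flat_exp_def exp_of_real flip: of_real_mult exp_add)
  have \<theta>: "\<theta> \<in> test_functions"
  proof -
    have "smooth \<theta>" unfolding \<theta>_def[abs_def] by (intro smooth_prod smooth_mult smooth_const smooth_flat_exp)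
    moreover have "\<theta> x = 0" if "3 < norm x" for x
    proof -
      have "\<exists>j. 1 < \<bar>x $ j\<bar>"
      proof (rule ccontr)
        assume "\<not> ?thesis"
        then have "(\<Sum>j\<in>UNIV. \<bar>x $ j\<bar>) \<le> (\<Sum>j\<in>(UNIV::3 set). 1)" by (intro sum_mono) (auto simp: not_less)
        then show False using norm_le_l1_cart[of x] that by simp
      qed
      then obtain j where "1 < \<bar>x $ j\<bar>" ..
      then have "flat_exp [:1:] (1 * x $ j + 1) = 0 \<or> flat_exp [:1:] (- 1 * x $ j + 1) = 0"
        by (auto simp: flat_exp_def)
      then show ?thesis unfolding \<theta>_def by (intro prod_zero) (auto intro!: bexI[of _ j])
    qed
    ultimately show ?thesis by (auto simp: test_function_iff)
  qed
  define k where "k n = 1 / real (Suc n)" for n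
  have k: "k n > 0" "k n \<le> 1" for n by (auto simp: k_def)
  have k0: "k \<longlonglongrightarrow> 0" unfolding k_def by (rule LIMSEQ_Suc[OF lim_1_over_n])
  define dil where "dil n x = k n *\<^sub>R x" for n and x :: "real^3"
  have lin: "linear (dil n)" for n unfolding dil_def by (rule linearI) (auto simp: algebra_simps)
  define \<kappa> where "\<kappa> n x = \<theta> (0 + dil n x)" for n x
  have pd: "partial_deriv j (\<lambda>x. \<phi> (0 + dil n x)) = (\<lambda>x. complex_of_real (k n) * partial_deriv j \<phi> (0 + dil n x))"
    if "smooth \<phi>" for \<phi> n j
  proof
    fix x
    have c: "dil n (axis j 1) $ l = (if l = j then k n else 0)" for l
      by (simp add: dil_def axis_def)
    have "partial_deriv j (\<lambda>x. \<phi> (0 + dil n x)) x = k n *\<^sub>R partial_deriv j \<phi> (0 + dil n x)"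
      unfolding partial_deriv_affine[OF that lin] c
      by (simp add: if_distrib[of "\<lambda>a. a *\<^sub>R _"] sum.delta cong: if_cong)
    then show "partial_deriv j (\<lambda>x. \<phi> (0 + dil n x)) x = complex_of_real (k n) * partial_deriv j \<phi> (0 + dil n x)"
      unfolding scaleR_conv_of_real[where 'a = complex] .
  qed
  have p1: "partial_deriv j (\<kappa> n) = (\<lambda>x. complex_of_real (k n) * partial_deriv j \<theta> (0 + dil n x))" for j n
    unfolding \<kappa>_def by (rule pd[OF test_smooth[OF \<theta>]])
  have sm: "smooth (\<lambda>x. partial_deriv i \<theta> (0 + dil n x))" for i n
    by (rule smooth_affine[OF smooth_partial[OF test_smooth[OF \<theta>]] lin])
  have p2: "partial_deriv j (partial_deriv i (\<kappa> n)) = (\<lambda>x. complex_of_real (k n) * (complex_of_real (k n) * partial_deriv j (partial_deriv i \<theta>) (0 + dil n x)))" for i j n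
    unfolding p1 by (rule ext)
      (simp only: partial_deriv_cmult[OF sm] pd[OF smooth_partial[OF test_smooth[OF \<theta>]]])
  have T: "\<theta> \<in> test_functions" "partial_deriv j \<theta> \<in> test_functions" "partial_deriv i (partial_deriv j \<theta>) \<in> test_functions"
    "(\<lambda>x. 1 * complex_of_real (x $ i) * partial_deriv j \<theta> x) \<in> test_functions" for i j
    by (intro \<theta> test_partial test_coord_mult)+
  have bd: "\<exists>b. \<forall>x. cmod (\<phi> x) \<le> b" if "\<phi> \<in> test_functions" for \<phi>
    using test_bounded[OF that] by metis
  obtain b0 where b0: "\<And>x. cmod (\<theta> x) \<le> b0" using bd[OF T(1)] by blast
  have "\<forall>j. \<exists>b. \<forall>x. cmod (partial_deriv j \<theta> x) \<le> b" using bd[OF T(2)] by blast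
  then obtain b1 where b1: "\<And>j x. cmod (partial_deriv j \<theta> x) \<le> b1 j" by metis
  have "\<forall>i j. \<exists>b. \<forall>x. cmod (partial_deriv i (partial_deriv j \<theta>) x) \<le> b" using bd[OF T(3)] by blast
  then obtain b2 where b2: "\<And>i j x. cmod (partial_deriv i (partial_deriv j \<theta>) x) \<le> b2 i j" by metis
  have "\<forall>i j. \<exists>b. \<forall>x. cmod (1 * complex_of_real (x $ i) * partial_deriv j \<theta> x) \<le> b" using bd[OF T(4)] by blast
  then obtain b3 where b3: "\<And>i j x. cmod (1 * complex_of_real (x $ i) * partial_deriv j \<theta> x) \<le> b3 i j" by metis
  define C where "C = 1 + \<bar>b0\<bar> + (\<Sum>j\<in>UNIV. \<bar>b1 j\<bar>) + (\<Sum>i\<in>UNIV. \<Sum>j\<in>UNIV. \<bar>b2 i j\<bar>) + (\<Sum>i\<in>UNIV. \<Sum>j\<in>UNIV. \<bar>b3 i j\<bar>)"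
  have s1: "\<bar>b j\<bar> \<le> (\<Sum>j\<in>UNIV. \<bar>b j\<bar>)" for b :: "3 \<Rightarrow> real" and j
    by (rule member_le_sum[of j UNIV "\<lambda>j. \<bar>b j\<bar>"]) auto
  have s2: "\<bar>b i j\<bar> \<le> (\<Sum>i\<in>UNIV. \<Sum>j\<in>UNIV. \<bar>b i j\<bar>)" for b :: "3 \<Rightarrow> 3 \<Rightarrow> real" and i j
    by (rule order_trans[OF s1[of "b i" j] member_le_sum[of i UNIV "\<lambda>i. \<Sum>j\<in>UNIV. \<bar>b i j\<bar>"]]) (auto intro: sum_nonneg)
  have n0: "0 \<le> (\<Sum>j\<in>UNIV. \<bar>b1 j\<bar>)" "0 \<le> (\<Sum>i\<in>UNIV. \<Sum>j\<in>UNIV. \<bar>b2 i j\<bar>)" "0 \<le> (\<Sum>i\<in>UNIV. \<Sum>j\<in>UNIV. \<bar>b3 i j\<bar>)"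
    by (auto intro!: sum_nonneg)
  have c0: "cmod (\<theta> x) \<le> C" for x using b0[of x] n0 unfolding C_def by linarith
  have c1: "cmod (partial_deriv j \<theta> x) \<le> C" for j x
    using b1[of j x] s1[of b1 j] n0 unfolding C_def by linarith
  have c2: "cmod (partial_deriv i (partial_deriv j \<theta>) x) \<le> C" for i j x
    using b2[of i j x] s2[of b2 i j] n0 unfolding C_def by linarith
  have c3: "cmod (1 * complex_of_real (x $ i) * partial_deriv j \<theta> x) \<le> C" for i j x
    using b3[of x i j] s2[of b3 i j] n0 unfolding C_def by linarith
  have C: "C > 0" using n0 unfolding C_def by linarith
  have kk: "cmod (complex_of_real (k n) * z) \<le> cmod z" for n z
    using k[of n] by (simp add: norm_mult mult_left_le_one_le)
  have kz: "(\<lambda>n. complex_of_real (k n) * z n) \<longlonglongrightarrow> 0" if "\<And>n. cmod (z n) \<le> C" for z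
  proof (rule Lim_null_comparison[OF always_eventually])
    show "(\<lambda>n. k n * C) \<longlonglongrightarrow> 0" using tendsto_mult_left_zero[OF k0] by simp
    show "\<forall>n. norm (complex_of_real (k n) * z n) \<le> k n * C"
      using that k by (simp add: norm_mult mult_left_mono less_imp_le)
  qed
  show ?thesis
  proof (rule that[of \<kappa> C])
    show "\<kappa> n \<in> test_functions" for n
      unfolding \<kappa>_def
    proof (rule test_affine[OF \<theta> lin])
      show "norm x \<le> real (Suc n) * (1 + norm (0 + dil n x))" for x
        using k[of n] by (simp add: dil_def k_def field_simps)
    qed simp
    show "(\<lambda>n. \<kappa> n x) \<longlonglongrightarrow> 1" for x
    proof -
      have "isCont \<theta> 0"
        using smooth_continuous[OF test_smooth[OF \<theta>], of UNIV] by (simp add: continuous_on_eq_continuous_at)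
      moreover have "(\<lambda>n. 0 + dil n x) \<longlonglongrightarrow> 0"
        unfolding dil_def using tendsto_scaleR[OF k0 tendsto_const[of x]] by simp
      ultimately show ?thesis unfolding \<kappa>_def using isCont_tendsto_compose \<theta>0 by fastforce
    qed
    show "cmod (complex_of_real (x $ i) * partial_deriv j (\<kappa> n) x) \<le> C" for n i j x
      using c3[of "dil n x" i j] by (simp add: p1 dil_def mult_ac)
    show "cmod (partial_deriv j (\<kappa> n) x) \<le> C" for n j x
      unfolding p1 by (rule order_trans[OF kk c1])
    show "cmod (partial_deriv j (partial_deriv i (\<kappa> n)) x) \<le> C" for n i j x
      unfolding p2 by (rule order_trans[OF kk order_trans[OF kk c2]])
    show "(\<lambda>n. partial_deriv j (\<kappa> n) x) \<longlonglongrightarrow> 0" for j x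
      unfolding p1 by (rule kz[OF c1])
    show "(\<lambda>n. partial_deriv j (partial_deriv i (\<kappa> n)) x) \<longlonglongrightarrow> 0" for i j x
      unfolding p2 by (rule kz[OF order_trans[OF kk c2]])
  qed (use C c0 in \<open>auto simp: \<kappa>_def\<close>)
qed

subsection \<open>The weak identities for Fourier transforms of test functions\<close>

lemma laplacian_mult:
  assumes \<phi>: "smooth \<phi>" and \<psi>: "smooth \<psi>"
  shows "laplacian (\<lambda>x. \<psi> x * \<phi> x) x
    = \<psi> x * laplacian \<phi> x + (\<Sum>j\<in>UNIV. 2 * (partial_deriv j \<psi> x * partial_deriv j \<phi> x) + partial_deriv j (partial_deriv j \<psi>) x * \<phi> x)"
proof -
  have 1: "partial_deriv j (\<lambda>x. \<psi> x * \<phi> x) = (\<lambda>x. \<psi> x * partial_deriv j \<phi> x + partial_deriv j \<psi> x * \<phi> x)" for j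
    by (rule ext) (rule partial_deriv_mult[OF \<psi> \<phi>])
  have "partial_deriv j (partial_deriv j (\<lambda>x. \<psi> x * \<phi> x)) x
      = \<psi> x * partial_deriv j (partial_deriv j \<phi>) x
        + (2 * (partial_deriv j \<psi> x * partial_deriv j \<phi> x) + partial_deriv j (partial_deriv j \<psi>) x * \<phi> x)" for j
    unfolding 1
    by (simp add: partial_deriv_add partial_deriv_mult smooth_mult smooth_partial \<phi> \<psi>)
  then show ?thesis by (simp add: laplacian_def sum.distrib sum_distrib_left)
qed

lemma cutoff_pairing_tendsto:
  fixes u v :: "real^3 \<Rightarrow> complex"
  assumes u: "u \<in> L2" and v: "v \<in> L2" and m: "\<And>n. \<kappa> n \<in> borel_measurable borel"
    and le: "\<And>n x. cmod (\<kappa> n x) \<le> C" and lim: "\<And>x. (\<lambda>n::nat. \<kappa> n x) \<longlonglongrightarrow> 1"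
  shows "(\<lambda>n. \<integral>x. u x * (\<kappa> n x * v x) \<partial>lborel) \<longlonglongrightarrow> (\<integral>x. u x * v x \<partial>lborel)"
proof (rule integral_dominated_convergence[where w = "\<lambda>x. C * (norm (u x) * norm (v x))"])
  show "AE x in lborel. (\<lambda>n. u x * (\<kappa> n x * v x)) \<longlonglongrightarrow> u x * v x"
  proof (rule AE_I2)
    fix x show "(\<lambda>n. u x * (\<kappa> n x * v x)) \<longlonglongrightarrow> u x * v x"
      using tendsto_mult[OF tendsto_const[of "u x"] tendsto_mult[OF lim[of x] tendsto_const[of "v x"]]] by simp
  qed
  show "AE x in lborel. norm (u x * (\<kappa> n x * v x)) \<le> C * (norm (u x) * norm (v x))" for n
  proof (rule AE_I2)
    fix x show "norm (u x * (\<kappa> n x * v x)) \<le> C * (norm (u x) * norm (v x))"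
      using mult_right_mono[OF le[of n x], of "norm (u x) * norm (v x)"] by (simp add: norm_mult mult_ac)
  qed
  show "(\<lambda>x. u x * (\<kappa> n x * v x)) \<in> borel_measurable lborel" for n
    using L2_D(3)[OF u] L2_D(3)[OF v] m by simp
qed (use integrable_norm_mult[OF u v] borel_measurable_integrable[OF integrable_mult_L2[OF u v]] in simp_all)

text \<open>The Fourier transform of a test function is smooth and rapidly decreasing but not compactly
  supported. The defining identity is applied to its products with the cutoffs; in the limit all
  terms with derivatives of the cutoffs disappear.\<close>

lemma weak_laplacian_FT:
  assumes u: "u \<in> L2" and g: "is_weak_laplacian u g" and \<psi>: "\<psi> \<in> test_functions"
  shows "(\<integral>x. g x * FT \<psi> x \<partial>lborel) = - (\<integral>x. u x * FT (\<lambda>\<xi>. complex_of_real ((norm \<xi>)\<^sup>2) * \<psi> \<xi>) x \<partial>lborel)"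
proof -
  let ?\<phi> = "FT \<psi>"
  obtain \<kappa> C where \<kappa>: "\<And>n. \<kappa> n \<in> test_functions" "(C::real) > 0"
    "\<And>n x. cmod (\<kappa> n x) \<le> C" "\<And>x. (\<lambda>n::nat. \<kappa> n x) \<longlonglongrightarrow> 1"
    "\<And>n j x. cmod (partial_deriv j (\<kappa> n) x) \<le> C" "\<And>j x. (\<lambda>n. partial_deriv j (\<kappa> n) x) \<longlonglongrightarrow> 0"
    "\<And>n j k x. cmod (partial_deriv j (partial_deriv k (\<kappa> n)) x) \<le> C"
    "\<And>j k x. (\<lambda>n. partial_deriv j (partial_deriv k (\<kappa> n)) x) \<longlonglongrightarrow> 0"
    by (rule cutoff_sequence) blast
  have gL: "g \<in> L2" using g by (simp add: is_weak_laplacian_def)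
  have sF: "smooth ?\<phi>" by (rule smooth_FT[OF \<psi>])
  have L: "?\<phi> \<in> L2" "partial_deriv j ?\<phi> \<in> L2" "laplacian ?\<phi> \<in> L2" for j
  proof -
    show "?\<phi> \<in> L2" by (rule test_fourier[OF \<psi>])
    show "partial_deriv j ?\<phi> \<in> L2" unfolding partial_deriv_FT[OF \<psi>]
      by (rule test_fourier[OF test_coord_mult[OF \<psi>]])
    show "laplacian ?\<phi> \<in> L2" using L2_minus[OF test_fourier(2)[OF test_norm_power2_mult[OF \<psi>]]]
      by (simp add: laplacian_FT[OF \<psi>, abs_def])
  qed
  have lim1: "(\<lambda>n. \<integral>x. g x * (\<kappa> n x * ?\<phi> x) \<partial>lborel) \<longlonglongrightarrow> (\<integral>x. g x * ?\<phi> x \<partial>lborel)"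
    by (rule cutoff_pairing_tendsto[OF gL L(1) test_measurable[OF \<kappa>(1)] \<kappa>(3,4)])
  have lim2: "(\<lambda>n. \<integral>x. u x * laplacian (\<lambda>x. \<kappa> n x * ?\<phi> x) x \<partial>lborel) \<longlonglongrightarrow> (\<integral>x. u x * laplacian ?\<phi> x \<partial>lborel)"
  proof (rule integral_dominated_convergence[where w = "\<lambda>x. C * (norm (u x) * norm (laplacian ?\<phi> x)
      + (\<Sum>j\<in>UNIV. 2 * (norm (u x) * norm (partial_deriv j ?\<phi> x)) + norm (u x) * norm (?\<phi> x)))"])
    show "AE x in lborel. (\<lambda>n. u x * laplacian (\<lambda>x. \<kappa> n x * ?\<phi> x) x) \<longlonglongrightarrow> u x * laplacian ?\<phi> x"
    proof (rule AE_I2)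
      fix x
      have "(\<lambda>n. u x * laplacian (\<lambda>x. \<kappa> n x * ?\<phi> x) x) \<longlonglongrightarrow> u x * (1 * laplacian ?\<phi> x +
          (\<Sum>j\<in>UNIV. 2 * (0 * partial_deriv j ?\<phi> x) + 0 * ?\<phi> x))"
        unfolding laplacian_mult[OF sF test_smooth[OF \<kappa>(1)]]
        by (intro tendsto_intros \<kappa>)
      then show "(\<lambda>n. u x * laplacian (\<lambda>x. \<kappa> n x * ?\<phi> x) x) \<longlonglongrightarrow> u x * laplacian ?\<phi> x" by simp
    qed
    show "AE x in lborel. norm (u x * laplacian (\<lambda>x. \<kappa> n x * ?\<phi> x) x) \<le> C * (norm (u x) * norm (laplacian ?\<phi> x)
      + (\<Sum>j\<in>UNIV. 2 * (norm (u x) * norm (partial_deriv j ?\<phi> x)) + norm (u x) * norm (?\<phi> x)))" for n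
    proof (rule AE_I2)
      fix x
      have "norm (laplacian (\<lambda>x. \<kappa> n x * ?\<phi> x) x) \<le> C * norm (laplacian ?\<phi> x)
          + (\<Sum>j\<in>UNIV. 2 * (C * norm (partial_deriv j ?\<phi> x)) + C * norm (?\<phi> x))"
        unfolding laplacian_mult[OF sF test_smooth[OF \<kappa>(1)]]
        by (intro order_trans[OF norm_triangle_ineq] add_mono order_trans[OF norm_sum] sum_mono)
          (auto simp: norm_mult intro!: mult_right_mono \<kappa>)
      then have "norm (u x) * norm (laplacian (\<lambda>x. \<kappa> n x * ?\<phi> x) x) \<le> norm (u x) * (C * norm (laplacian ?\<phi> x)
          + (\<Sum>j\<in>UNIV. 2 * (C * norm (partial_deriv j ?\<phi> x)) + C * norm (?\<phi> x)))"
        by (rule mult_left_mono) simp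
      also have "\<dots> = C * (norm (u x) * norm (laplacian ?\<phi> x)
          + (\<Sum>j\<in>UNIV. 2 * (norm (u x) * norm (partial_deriv j ?\<phi> x)) + norm (u x) * norm (?\<phi> x)))"
        by (simp add: algebra_simps sum_distrib_left sum.distrib)
      finally show "norm (u x * laplacian (\<lambda>x. \<kappa> n x * ?\<phi> x) x) \<le> C * (norm (u x) * norm (laplacian ?\<phi> x)
          + (\<Sum>j\<in>UNIV. 2 * (norm (u x) * norm (partial_deriv j ?\<phi> x)) + norm (u x) * norm (?\<phi> x)))"
        by (simp add: norm_mult)
    qed
    show "integrable lborel (\<lambda>x. C * (norm (u x) * norm (laplacian ?\<phi> x)
      + (\<Sum>j\<in>UNIV. 2 * (norm (u x) * norm (partial_deriv j ?\<phi> x)) + norm (u x) * norm (?\<phi> x))))"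
      by (intro integrable_mult_right Bochner_Integration.integrable_add Bochner_Integration.integrable_sum integrable_norm_mult u L)
    show "(\<lambda>x. u x * laplacian (\<lambda>x. \<kappa> n x * ?\<phi> x) x) \<in> borel_measurable lborel" for n
    proof -
      have "(\<lambda>x. laplacian (\<lambda>x. \<kappa> n x * ?\<phi> x) x) \<in> borel_measurable borel"
        unfolding laplacian_def
        by (intro borel_measurable_sum smooth_measurable smooth_partial smooth_mult sF test_smooth[OF \<kappa>(1)])
      then show ?thesis using L2_D(3)[OF u] by simp
    qed
  qed (use borel_measurable_integrable[OF integrable_mult_L2[OF u L(3)]] in simp)
  have "(\<integral>x. g x * (\<kappa> n x * ?\<phi> x) \<partial>lborel) = (\<integral>x. u x * laplacian (\<lambda>x. \<kappa> n x * ?\<phi> x) x \<partial>lborel)" for n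
    by (rule bspec[OF conjunct2[OF g[unfolded is_weak_laplacian_def]] test_mult_smooth(2)[OF \<kappa>(1) sF, of n]])
  then have "(\<integral>x. g x * ?\<phi> x \<partial>lborel) = (\<integral>x. u x * laplacian ?\<phi> x \<partial>lborel)"
    using lim1 lim2 by (simp only:) (rule LIMSEQ_unique)
  then show ?thesis by (simp add: laplacian_FT[OF \<psi>])
qed

text \<open>As before; the coefficient \<open>y\<close> is harmless because \<open>|x| |\<nabla>\<kappa>\<^sub>n|\<close> is bounded.\<close>

lemma weak_shear_FT:
  assumes u: "u \<in> L2" and g: "is_weak_shear u g" and \<psi>: "\<psi> \<in> test_functions"
  shows "(\<integral>x. g x * FT \<psi> x \<partial>lborel) = (\<integral>x. u x * FT (\<lambda>\<xi>. complex_of_real (\<xi> $ 1) * partial_deriv 2 \<psi> \<xi>) x \<partial>lborel)"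
proof -
  let ?\<phi> = "FT \<psi>"
  let ?s = "\<lambda>\<phi> x. complex_of_real (x $ 2) * partial_deriv 1 \<phi> x"
  obtain \<kappa> C where \<kappa>: "\<And>n. \<kappa> n \<in> test_functions" "(C::real) > 0"
    "\<And>n x. cmod (\<kappa> n x) \<le> C" "\<And>x. (\<lambda>n::nat. \<kappa> n x) \<longlonglongrightarrow> 1"
    "\<And>n j x. cmod (partial_deriv j (\<kappa> n) x) \<le> C" "\<And>j x. (\<lambda>n. partial_deriv j (\<kappa> n) x) \<longlonglongrightarrow> 0"
    "\<And>n i j x. cmod (complex_of_real (x $ i) * partial_deriv j (\<kappa> n) x) \<le> C"
    by (rule cutoff_sequence) blast
  have gL: "g \<in> L2" using g by (simp add: is_weak_shear_def)
  have sF: "smooth ?\<phi>" by (rule smooth_FT[OF \<psi>])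
  have L: "?\<phi> \<in> L2" by (rule test_fourier[OF \<psi>])
  have tx: "(\<lambda>\<xi>. complex_of_real (\<xi> $ 1) * partial_deriv 2 \<psi> \<xi>) \<in> test_functions"
    using test_coord_mult[OF test_partial[OF \<psi>], of 1 1 2] by simp
  have Ls: "?s ?\<phi> \<in> L2"
    unfolding shear_FT[OF \<psi>, abs_def] by (rule L2_minus[OF test_fourier(2)[OF tx]])
  have lim1: "(\<lambda>n. \<integral>x. g x * (\<kappa> n x * ?\<phi> x) \<partial>lborel) \<longlonglongrightarrow> (\<integral>x. g x * ?\<phi> x \<partial>lborel)"
    by (rule cutoff_pairing_tendsto[OF gL L test_measurable[OF \<kappa>(1)] \<kappa>(3,4)])
  have sm: "?s (\<lambda>x. \<kappa> n x * ?\<phi> x) x = \<kappa> n x * ?s ?\<phi> x + ?s (\<kappa> n) x * ?\<phi> x" for n x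
    unfolding partial_deriv_mult[OF test_smooth[OF \<kappa>(1)] sF] by (simp add: algebra_simps)
  have lim2: "(\<lambda>n. \<integral>x. u x * ?s (\<lambda>x. \<kappa> n x * ?\<phi> x) x \<partial>lborel) \<longlonglongrightarrow> (\<integral>x. u x * ?s ?\<phi> x \<partial>lborel)"
  proof (rule integral_dominated_convergence[where w = "\<lambda>x. C * (norm (u x) * norm (?s ?\<phi> x) + norm (u x) * norm (?\<phi> x))"])
    show "AE x in lborel. (\<lambda>n. u x * ?s (\<lambda>x. \<kappa> n x * ?\<phi> x) x) \<longlonglongrightarrow> u x * ?s ?\<phi> x"
    proof (rule AE_I2)
      fix x
      have "(\<lambda>n. u x * ?s (\<lambda>x. \<kappa> n x * ?\<phi> x) x) \<longlonglongrightarrow> u x * (1 * ?s ?\<phi> x + (complex_of_real (x $ 2) * 0) * ?\<phi> x)"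
        unfolding sm by (intro tendsto_mult tendsto_add tendsto_const \<kappa>)
      then show "(\<lambda>n. u x * ?s (\<lambda>x. \<kappa> n x * ?\<phi> x) x) \<longlonglongrightarrow> u x * ?s ?\<phi> x" by simp
    qed
    show "AE x in lborel. norm (u x * ?s (\<lambda>x. \<kappa> n x * ?\<phi> x) x) \<le> C * (norm (u x) * norm (?s ?\<phi> x) + norm (u x) * norm (?\<phi> x))" for n
    proof (rule AE_I2)
      fix x
      have "norm (?s (\<lambda>x. \<kappa> n x * ?\<phi> x) x) \<le> C * norm (?s ?\<phi> x) + C * norm (?\<phi> x)"
        unfolding sm by (intro order_trans[OF norm_triangle_ineq] add_mono)
          (simp_all only: norm_mult[of _ "?s ?\<phi> x"] norm_mult[of _ "?\<phi> x"], auto intro!: mult_right_mono \<kappa>)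
      then have "norm (u x) * norm (?s (\<lambda>x. \<kappa> n x * ?\<phi> x) x) \<le> norm (u x) * (C * norm (?s ?\<phi> x) + C * norm (?\<phi> x))"
        by (rule mult_left_mono) simp
      then show "norm (u x * ?s (\<lambda>x. \<kappa> n x * ?\<phi> x) x) \<le> C * (norm (u x) * norm (?s ?\<phi> x) + norm (u x) * norm (?\<phi> x))"
        by (simp add: norm_mult[of "u x"] algebra_simps)
    qed
    show "integrable lborel (\<lambda>x. C * (norm (u x) * norm (?s ?\<phi> x) + norm (u x) * norm (?\<phi> x)))"
      by (intro integrable_mult_right Bochner_Integration.integrable_add integrable_norm_mult u L Ls)
    show "(\<lambda>x. u x * ?s (\<lambda>x. \<kappa> n x * ?\<phi> x) x) \<in> borel_measurable lborel" for n
    proof -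
      have "(\<lambda>x. ?s (\<lambda>x. \<kappa> n x * ?\<phi> x) x) \<in> borel_measurable borel"
        by (intro smooth_measurable smooth_partial smooth_mult smooth_coord sF test_smooth[OF \<kappa>(1)])
      then show ?thesis using L2_D(3)[OF u] by simp
    qed
  qed (use borel_measurable_integrable[OF integrable_mult_L2[OF u Ls]] in simp)
  have "(\<integral>x. g x * (\<kappa> n x * ?\<phi> x) \<partial>lborel) = - (\<integral>x. u x * ?s (\<lambda>x. \<kappa> n x * ?\<phi> x) x \<partial>lborel)" for n
    by (rule bspec[OF conjunct2[OF g[unfolded is_weak_shear_def]] test_mult_smooth(2)[OF \<kappa>(1) sF, of n]])
  then have "(\<integral>x. g x * ?\<phi> x \<partial>lborel) = - (\<integral>x. u x * ?s ?\<phi> x \<partial>lborel)"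
    using lim1 tendsto_minus[OF lim2] by (simp only:) (rule LIMSEQ_unique)
  then show ?thesis by (simp add: shear_FT[OF \<psi>])
qed

section \<open>Transport along the shear and the energy identity\<close>

lemma L2_norm_le_dual:
  assumes h: "h \<in> L2" and C: "C \<ge> 0" and le: "\<And>\<psi>. \<psi> \<in> test_functions \<Longrightarrow> cmod (\<integral>x. h x * \<psi> x \<partial>lborel) \<le> C * L2_norm \<psi>"
  shows "L2_norm h \<le> C"
proof -
  obtain \<psi> where \<psi>: "\<And>n::nat. \<psi> n \<in> test_functions" "(\<lambda>n. L2_norm (\<lambda>x. \<psi> n x - cnj (h x))) \<longlonglongrightarrow> 0"
    by (rule test_functions_dense_seq[OF L2_cnj[OF h]]) blast
  have "(\<lambda>n. cmod (\<integral>x. h x * \<psi> n x \<partial>lborel)) \<longlonglongrightarrow> cmod (\<integral>x. h x * cnj (h x) \<partial>lborel)"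
    by (intro tendsto_norm L2_pairing_tendsto_right h L2_cnj test_L2 \<psi>)
  moreover have "(\<lambda>n. C * L2_norm (\<psi> n)) \<longlonglongrightarrow> C * L2_norm (\<lambda>x. cnj (h x))"
    by (intro tendsto_intros L2_norm_tendsto[OF test_L2 L2_cnj] \<psi> h)
  ultimately have "cmod (\<integral>x. h x * cnj (h x) \<partial>lborel) \<le> C * L2_norm (\<lambda>x. cnj (h x))"
    by (rule LIMSEQ_le) (use le \<psi>(1) in blast)
  then have "cmod (complex_of_real ((L2_norm h)\<^sup>2)) \<le> C * L2_norm h"
    unfolding integral_mult_cnj L2_norm_cnj .
  then have "L2_norm h * L2_norm h \<le> C * L2_norm h" unfolding norm_of_real by (simp add: power2_eq_square)
  then show ?thesis
  proof (cases "L2_norm h = 0")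
    case True
    then show ?thesis using C by simp
  next
    case False
    then have "L2_norm h > 0" using L2_norm_nonneg[of h] by linarith
    then show ?thesis using \<open>L2_norm h * L2_norm h \<le> C * L2_norm h\<close> by simp
  qed
qed

lemma shear_continuous_L2:
  fixes u :: "real^3 \<Rightarrow> complex"
  assumes u: "u \<in> L2"
  shows "((\<lambda>t. L2_norm (\<lambda>x. u (shear t x) - u x)) \<longlongrightarrow> 0) (at 0)"
  unfolding tendsto_at_iff_sequentially
proof (intro allI impI)
  fix X :: "nat \<Rightarrow> real" assume X: "X \<longlonglongrightarrow> 0"
  from convergent_imp_Bseq[OF convergentI[OF this]] obtain b where b: "b > 0" "\<And>n. \<bar>X n\<bar> \<le> b"
    by (auto elim!: BseqE)
  have "(\<lambda>n. L2_norm (\<lambda>x. u (shear (X n) x) - u x)) \<longlonglongrightarrow> 0"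
  proof (rule L2_transport_continuous[OF lborel_preserving_shear _ _ _ u])
    show "(\<lambda>n. shear (X n) x) \<longlonglongrightarrow> x" for x
    proof -
      have "(\<lambda>n. x + (X n * x $ 1) *\<^sub>R axis 2 1) \<longlonglongrightarrow> x + (0 * x $ 1) *\<^sub>R axis 2 1"
        by (intro tendsto_intros X)
      then show ?thesis by (simp add: shear_def)
    qed
    show "norm x \<le> (1 + b) * (1 + norm (shear (X n) x))" for n x
      using norm_le_shear[of x "X n"] b mult_mono[of "1 + \<bar>X n\<bar>" "1 + b" "norm (shear (X n) x)" "1 + norm (shear (X n) x)"]
      by simp
  qed (use b in simp)
  then show "((\<lambda>t. L2_norm (\<lambda>x. u (shear t x) - u x)) \<circ> X) \<longlonglongrightarrow> 0" by (simp add: o_def)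
qed

text \<open>The hypothesis says weakly that \<open>S = \<xi>\<^sub>1 \<partial>\<^sub>2 W\<close>. Moving the shear onto the test function
  turns it into a derivative in \<open>t\<close>.\<close>

lemma weak_shear_derivative_of_pairing:
  fixes W S :: "real^3 \<Rightarrow> complex"
  assumes W: "W \<in> L2" and S: "S \<in> L2"
    and weak: "\<And>\<psi>. \<psi> \<in> test_functions \<Longrightarrow>
      (\<integral>x. W x * (complex_of_real (x $ 1) * partial_deriv 2 \<psi> x) \<partial>lborel) = - (\<integral>x. S x * \<psi> x \<partial>lborel)"
    and \<psi>: "\<psi> \<in> test_functions"
  shows "((\<lambda>t. \<integral>x. W (shear t x) * \<psi> x \<partial>lborel) has_vector_derivative (\<integral>x. S (shear t x) * \<psi> x \<partial>lborel)) (at t)"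
proof -
  have [measurable]: "W \<in> borel_measurable borel" "S \<in> borel_measurable borel" "\<psi> \<in> borel_measurable borel"
    using L2_D(3)[OF W] L2_D(3)[OF S] test_measurable[OF \<psi>] by auto
  have move: "(\<integral>x. U (shear s x) * \<psi> x \<partial>lborel) = (\<integral>x. U x * \<psi> (shear (- s) x) \<partial>lborel)"
    if [measurable]: "U \<in> borel_measurable borel" for U :: "real^3 \<Rightarrow> complex" and s
    using lborel_preserving_integral[OF lborel_preserving_shear, of "\<lambda>y. U y * \<psi> (shear (- s) y)" s]
    by (simp add: shear_shear)
  define \<psi>t where "\<psi>t = (\<lambda>x. \<psi> (shear (- t) x))"
  have \<psi>t: "\<psi>t \<in> test_functions" unfolding \<psi>t_def by (rule test_shear[OF \<psi>])
  let ?p = "\<lambda>t. \<integral>x. W (shear t x) * \<psi> x \<partial>lborel"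
  let ?D = "\<integral>x. S (shear t x) * \<psi> x \<partial>lborel"
  define X :: "real^3 \<Rightarrow> real^3" where "X x = (- (x $ 1)) *\<^sub>R axis 2 1" for x
  have sX: "shear (- h) x = x + h *\<^sub>R X x" for h x by (simp add: shear_def X_def)
  have "(\<lambda>h. norm (?p (t + h) - ?p t - h *\<^sub>R ?D) / norm h) \<midarrow>0\<rightarrow> 0"
    unfolding tendsto_at_iff_sequentially
  proof (intro allI impI)
    fix h :: "nat \<Rightarrow> real" assume hn: "\<forall>i. h i \<in> UNIV - {0}" and h0: "h \<longlonglongrightarrow> 0"
    from convergent_imp_Bseq[OF convergentI[OF h0]] obtain b where b: "b > 0" "\<And>n. \<bar>h n\<bar> \<le> b"
      by (auto elim!: BseqE)
    have h: "h n \<noteq> 0" for n using hn by auto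
    have X1: "norm (X x) \<le> (1 + b) * (1 + norm x)" for x
    proof -
      have "norm (X x) \<le> norm x" using component_le_norm_cart[of x 1] by (simp add: X_def)
      also have "\<dots> \<le> (1 + b) * (1 + norm x)" using b by (simp add: algebra_simps)
      finally show ?thesis .
    qed
    have X2: "norm x \<le> (1 + b) * (1 + norm (x + h n *\<^sub>R X x))" for n x
      using norm_le_shear[of x "- h n"] b mult_mono[of "1 + \<bar>h n\<bar>" "1 + b" "norm (shear (- h n) x)" "1 + norm (shear (- h n) x)"]
      by (simp add: sX)
    have "1 + b > 0" using b by simp
    note q = test_flow_quotient[OF \<psi>t X1 this h h0 X2]
    obtain B R where B: "\<And>n x. cmod ((\<psi>t (x + h n *\<^sub>R X x) - \<psi>t x) / complex_of_real (h n)) \<le> B * indicator (cball 0 R) x"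
      "\<And>x. (\<lambda>n. (\<psi>t (x + h n *\<^sub>R X x) - \<psi>t x) / complex_of_real (h n)) \<longlonglongrightarrow> (\<Sum>j\<in>UNIV. X x $ j *\<^sub>R partial_deriv j \<psi>t x)"
      using q by blast
    have lim: "(\<Sum>j\<in>UNIV. X x $ j *\<^sub>R partial_deriv j \<psi>t x) = - (complex_of_real (x $ 1) * partial_deriv 2 \<psi>t x)" for x
    proof -
      have c: "X x $ j = (if j = 2 then - (x $ 1) else 0)" for j by (simp add: X_def axis_def)
      have "(\<Sum>j\<in>UNIV. X x $ j *\<^sub>R partial_deriv j \<psi>t x) = (- (x $ 1)) *\<^sub>R partial_deriv 2 \<psi>t x"
        unfolding c by (simp add: if_distrib[of "\<lambda>a. a *\<^sub>R _"] sum.delta cong: if_cong)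
      then show ?thesis unfolding scaleR_conv_of_real[where 'a = complex] by simp
    qed
    have [measurable]: "\<psi>t \<in> borel_measurable borel" "partial_deriv 2 \<psi>t \<in> borel_measurable borel"
      using test_measurable[OF \<psi>t] test_measurable[OF test_partial[OF \<psi>t]] by auto
    have "(\<lambda>n. \<integral>x. W x * ((\<psi>t (shear (- h n) x) - \<psi>t x) / complex_of_real (h n)) \<partial>lborel)
        \<longlonglongrightarrow> (\<integral>x. W x * (- (complex_of_real (x $ 1) * partial_deriv 2 \<psi>t x)) \<partial>lborel)"
    proof (rule integral_dominated_convergence[where w = "\<lambda>x. norm (W x) * norm (B * indicator (cball 0 R) x :: real)"])
      show "integrable lborel (\<lambda>x. norm (W x) * norm (B * indicator (cball 0 R) x :: real))"
        by (rule integrable_norm_mult[OF W indicator_cball_L2])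
      show "AE x in lborel. (\<lambda>n. W x * ((\<psi>t (shear (- h n) x) - \<psi>t x) / complex_of_real (h n)))
          \<longlonglongrightarrow> W x * (- (complex_of_real (x $ 1) * partial_deriv 2 \<psi>t x))"
        unfolding sX using B(2) by (intro AE_I2 tendsto_mult tendsto_const) (simp add: lim)
      show "AE x in lborel. norm (W x * ((\<psi>t (shear (- h n) x) - \<psi>t x) / complex_of_real (h n)))
          \<le> norm (W x) * norm (B * indicator (cball 0 R) x :: real)" for n
        unfolding sX norm_mult[of "W _"]
        by (intro AE_I2 mult_left_mono order_trans[OF B(1)]) auto
    qed measurable
    also have "(\<integral>x. W x * (- (complex_of_real (x $ 1) * partial_deriv 2 \<psi>t x)) \<partial>lborel) = (\<integral>x. S x * \<psi>t x \<partial>lborel)"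
      using weak[OF \<psi>t] by simp
    also have "\<dots> = ?D" unfolding \<psi>t_def by (rule move[symmetric]) measurable
    finally have conv: "(\<lambda>n. \<integral>x. W x * ((\<psi>t (shear (- h n) x) - \<psi>t x) / complex_of_real (h n)) \<partial>lborel) \<longlonglongrightarrow> ?D" .
    have quot: "(\<integral>x. W x * ((\<psi>t (shear (- h n) x) - \<psi>t x) / complex_of_real (h n)) \<partial>lborel) = (?p (t + h n) - ?p t) / complex_of_real (h n)" for n
    proof -
      have a: "\<psi>t (shear (- h n) x) = \<psi> (shear (- (t + h n)) x)" for x
        by (simp add: \<psi>t_def shear_shear add.commute)
      have i: "integrable lborel (\<lambda>x. W x * \<psi> (shear s x))" for s
        by (intro integrable_mult_L2 W test_L2 test_shear \<psi>)
      have "(?p (t + h n) - ?p t) / complex_of_real (h n)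
          = (\<integral>x. (W x * \<psi> (shear (- (t + h n)) x) - W x * \<psi> (shear (- t) x)) / complex_of_real (h n) \<partial>lborel)"
        unfolding move[OF \<open>W \<in> borel_measurable borel\<close>] integral_divide_zero
        by (subst Bochner_Integration.integral_diff[OF i i]) simp
      also have "\<dots> = (\<integral>x. W x * ((\<psi>t (shear (- h n) x) - \<psi>t x) / complex_of_real (h n)) \<partial>lborel)"
        unfolding a by (simp add: \<psi>t_def right_diff_distrib)
      finally show ?thesis by (rule sym)
    qed
    have "norm (?p (t + h n) - ?p t - h n *\<^sub>R ?D) / norm (h n) = norm ((?p (t + h n) - ?p t) / complex_of_real (h n) - ?D)" for n
    proof -
      have "(?p (t + h n) - ?p t) / complex_of_real (h n) - ?D = (?p (t + h n) - ?p t - h n *\<^sub>R ?D) / complex_of_real (h n)"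
        using h[of n] by (simp add: scaleR_conv_of_real diff_divide_distrib)
      then show ?thesis by (simp add: norm_divide)
    qed
    moreover have "(\<lambda>n. norm ((?p (t + h n) - ?p t) / complex_of_real (h n) - ?D)) \<longlonglongrightarrow> 0"
      using conv unfolding quot by (intro tendsto_norm_zero LIM_zero)
    ultimately show "((\<lambda>h. norm (?p (t + h) - ?p t - h *\<^sub>R ?D) / norm h) \<circ> h) \<longlonglongrightarrow> 0"
      by (simp only: o_def)
  qed
  then show ?thesis
    unfolding has_vector_derivative_def has_derivative_at by (simp add: bounded_linear_scaleR_left)
qed

text \<open>The mean value inequality for the pairings with test functions bounds the error by the modulus of
  continuity of \<open>t \<mapsto> S \<circ> shear t\<close> times the norm of the test function. By duality the difference quotients
  converge in norm.\<close>

lemma shear_difference_quotient: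
  fixes W S :: "real^3 \<Rightarrow> complex"
  assumes W: "W \<in> L2" and S: "S \<in> L2"
    and weak: "\<And>\<psi>. \<psi> \<in> test_functions \<Longrightarrow>
      (\<integral>x. W x * (complex_of_real (x $ 1) * partial_deriv 2 \<psi> x) \<partial>lborel) = - (\<integral>x. S x * \<psi> x \<partial>lborel)"
  shows "(\<lambda>n. L2_norm (\<lambda>x. real (Suc n) *\<^sub>R (W (shear (1 / real (Suc n)) x) - W x) - S x)) \<longlonglongrightarrow> 0"
proof (rule LIMSEQ_I)
  fix e :: real assume e: "e > 0"
  have "\<forall>\<^sub>F t in at 0. dist (L2_norm (\<lambda>x. S (shear t x) - S x)) 0 < e / 2"
    by (rule tendstoD[OF shear_continuous_L2[OF S]]) (use e in simp)
  then obtain \<delta> where \<delta>: "\<delta> > 0" "\<And>t. t \<noteq> 0 \<Longrightarrow> \<bar>t\<bar> < \<delta> \<Longrightarrow> L2_norm (\<lambda>x. S (shear t x) - S x) < e / 2"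
    unfolding eventually_at by (auto simp: dist_real_def)
  have \<delta>': "L2_norm (\<lambda>x. S (shear t x) - S x) \<le> e / 2" if "0 \<le> t" "t < \<delta>" for t
    using \<delta>(2)[of t] that e by (cases "t = 0") auto
  have main: "L2_norm (\<lambda>x. W (shear t x) - W x - t *\<^sub>R S x) \<le> t * (e / 2)" if t: "0 < t" "t < \<delta>" for t
  proof (rule L2_norm_le_dual)
    have sh: "(\<lambda>x. u (shear s x)) \<in> L2" if "u \<in> L2" for u :: "real^3 \<Rightarrow> complex" and s
      by (rule lborel_preserving_L2(1)[OF lborel_preserving_shear that])
    show "(\<lambda>x. W (shear t x) - W x - t *\<^sub>R S x) \<in> L2"
      by (intro L2_diff L2_scaleR sh W S)
    show "0 \<le> t * (e / 2)" using t e by simp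
    fix \<psi> assume \<psi>: "\<psi> \<in> test_functions"
    have i: "integrable lborel (\<lambda>x. u x * \<psi> x)" if "u \<in> L2" for u
      by (rule integrable_mult_L2[OF that test_L2[OF \<psi>]])
    let ?p = "\<lambda>t. \<integral>x. W (shear t x) * \<psi> x \<partial>lborel"
    let ?d = "\<lambda>t. \<integral>x. S (shear t x) * \<psi> x \<partial>lborel"
    let ?q = "\<lambda>s. ?p s - s *\<^sub>R ?d 0"
    have "norm (?q t - ?q 0) \<le> (e / 2 * L2_norm \<psi>) * norm (t - 0)"
    proof (rule differentiable_bound[of "{0..t}" ?q "\<lambda>s h. h *\<^sub>R (?d s - ?d 0)"])
      show "(?q has_derivative (\<lambda>h. h *\<^sub>R (?d s - ?d 0))) (at s within {0..t})" for s
      proof -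
        have "(?p has_derivative (\<lambda>h. h *\<^sub>R ?d s)) (at s within {0..t})"
          using weak_shear_derivative_of_pairing[OF W S weak \<psi>, of s]
          unfolding has_vector_derivative_def by (rule has_derivative_at_withinI)
        moreover have "((\<lambda>s. s *\<^sub>R ?d 0) has_derivative (\<lambda>h. h *\<^sub>R ?d 0)) (at s within {0..t})"
          by (rule has_derivative_scaleR_left[OF has_derivative_ident])
        ultimately have "(?q has_derivative (\<lambda>h. h *\<^sub>R ?d s - h *\<^sub>R ?d 0)) (at s within {0..t})"
          by (rule has_derivative_diff)
        then show ?thesis by (simp only: scaleR_diff_right)
      qed
      show "onorm (\<lambda>h. h *\<^sub>R (?d s - ?d 0)) \<le> e / 2 * L2_norm \<psi>" if s: "s \<in> {0..t}" for s
      proof (rule onorm_le)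
        fix h :: real
        have "?d s - ?d 0 = (\<integral>x. (S (shear s x) - S x) * \<psi> x \<partial>lborel)"
          unfolding left_diff_distrib by (subst Bochner_Integration.integral_diff[OF i[OF sh[OF S]] i[OF S]]) simp
        also have "norm \<dots> \<le> L2_norm (\<lambda>x. S (shear s x) - S x) * L2_norm \<psi>"
          by (intro Cauchy_Schwarz_mult L2_diff sh S test_L2 \<psi>)
        also have "\<dots> \<le> e / 2 * L2_norm \<psi>"
          using s t by (intro mult_right_mono \<delta>') auto
        finally show "norm (h *\<^sub>R (?d s - ?d 0)) \<le> e / 2 * L2_norm \<psi> * norm h"
          using mult_left_mono[of "norm (?d s - ?d 0)" "e / 2 * L2_norm \<psi>" "\<bar>h\<bar>"] by (simp add: mult.commute)
      qed
    qed (use t in auto)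
    moreover have "?q t - ?q 0 = (\<integral>x. (W (shear t x) - W x - t *\<^sub>R S x) * \<psi> x \<partial>lborel)"
    proof -
      have "(\<integral>x. (W (shear t x) - W x - t *\<^sub>R S x) * \<psi> x \<partial>lborel)
          = (\<integral>x. W (shear t x) * \<psi> x - W x * \<psi> x - t *\<^sub>R (S x * \<psi> x) \<partial>lborel)"
        by (simp add: algebra_simps)
      also have "\<dots> = ?p t - (\<integral>x. W x * \<psi> x \<partial>lborel) - t *\<^sub>R (\<integral>x. S x * \<psi> x \<partial>lborel)"
        by (simp add: i sh W S)
      finally show ?thesis by simp
    qed
    ultimately show "cmod (\<integral>x. (W (shear t x) - W x - t *\<^sub>R S x) * \<psi> x \<partial>lborel) \<le> t * (e / 2) * L2_norm \<psi>"
      using t by (simp add: mult_ac)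
  qed
  obtain N where N: "1 / real (Suc N) < \<delta>" using nat_approx_posE[OF \<delta>(1)] .
  have "L2_norm (\<lambda>x. real (Suc n) *\<^sub>R (W (shear (1 / real (Suc n)) x) - W x) - S x) < e" if "n \<ge> N" for n
  proof -
    let ?t = "1 / real (Suc n)"
    have "?t \<le> 1 / real (Suc N)" using that by (simp add: frac_le)
    then have t: "0 < ?t" "?t < \<delta>" using N by auto
    have "(\<lambda>x. real (Suc n) *\<^sub>R (W (shear ?t x) - W x) - S x) = (\<lambda>x. real (Suc n) *\<^sub>R (W (shear ?t x) - W x - ?t *\<^sub>R S x))"
      by (auto simp del: of_nat_Suc simp: scaleR_diff_right)
    then have "L2_norm (\<lambda>x. real (Suc n) *\<^sub>R (W (shear ?t x) - W x) - S x) = real (Suc n) * L2_norm (\<lambda>x. W (shear ?t x) - W x - ?t *\<^sub>R S x)"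
      by (simp only: L2_norm_scaleR abs_of_nat)
    also have "\<dots> \<le> real (Suc n) * (?t * (e / 2))" by (intro mult_left_mono main t) simp
    also have "\<dots> = e / 2" by (simp del: of_nat_Suc)
    finally show ?thesis using e by simp
  qed
  then show "\<exists>N. \<forall>n\<ge>N. norm (L2_norm (\<lambda>x. real (Suc n) *\<^sub>R (W (shear (1 / real (Suc n)) x) - W x) - S x) - 0) < e"
    by (intro exI[of _ N]) (simp del: of_nat_Suc)
qed

text \<open>The product rule \<open>2 Re(\<xi>\<^sub>1 \<partial>\<^sub>2 W \<cdot> cnj W) = \<xi>\<^sub>1 \<partial>\<^sub>2 |W|\<^sup>2\<close>, integrated against a bounded weight:
  both sides are limits of the same difference quotients.\<close>

lemma shear_energy_identity:
  fixes W S :: "real^3 \<Rightarrow> complex" and w dw :: "real^3 \<Rightarrow> real"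
  assumes W: "W \<in> L2" and S: "S \<in> L2"
    and weak: "\<And>\<psi>. \<psi> \<in> test_functions \<Longrightarrow>
      (\<integral>x. W x * (complex_of_real (x $ 1) * partial_deriv 2 \<psi> x) \<partial>lborel) = - (\<integral>x. S x * \<psi> x \<partial>lborel)"
    and w [measurable]: "w \<in> borel_measurable borel" "dw \<in> borel_measurable borel"
    and B: "\<And>x. \<bar>w x\<bar> \<le> B" "\<And>x. \<bar>dw x\<bar> \<le> B"
    and der: "AE x in lborel. \<forall>t. ((\<lambda>t. w (shear t x)) has_real_derivative dw (shear t x)) (at t)"
  shows "2 * (\<integral>x. w x * (S x \<bullet> W x) \<partial>lborel) = - (\<integral>x. dw x * (norm (W x))\<^sup>2 \<partial>lborel)"
proof -
  define k where "k n = 1 / real (Suc n)" for n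
  have k: "k n > 0" for n by (simp add: k_def)
  have k0: "k \<longlonglongrightarrow> 0" unfolding k_def by (rule LIMSEQ_Suc[OF lim_1_over_n])
  have [measurable]: "W \<in> borel_measurable borel" "S \<in> borel_measurable borel"
    using L2_D(3)[OF W] L2_D(3)[OF S] by auto
  have Wn: "(\<lambda>x. W (shear t x)) \<in> L2" for t
    by (rule lborel_preserving_L2(1)[OF lborel_preserving_shear W])
  define Q where "Q n x = real (Suc n) *\<^sub>R (W (shear (k n) x) - W x)" for n x
  have Q: "Q n \<in> L2" for n unfolding Q_def[abs_def] by (intro L2_scaleR L2_diff Wn W)
  have Qlim: "(\<lambda>n. L2_norm (\<lambda>x. Q n x - S x)) \<longlonglongrightarrow> 0"
    unfolding Q_def k_def by (rule shear_difference_quotient[OF W S weak])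
  define R where "R n x = complex_of_real (w x) * (W (shear (k n) x) + W x)" for n x
  have wL: "(\<lambda>x. complex_of_real (w x) * u x) \<in> L2" if "u \<in> L2" for u
    by (rule L2_mult_bounded[OF that, where C = B]) (use B in auto)
  have R: "R n \<in> L2" for n unfolding R_def[abs_def] by (intro wL L2_add Wn W)
  have Rlim: "(\<lambda>n. L2_norm (\<lambda>x. R n x - complex_of_real (w x) * (2 * W x))) \<longlonglongrightarrow> 0"
  proof (rule Lim_null_comparison[OF always_eventually])
    have "((\<lambda>n. L2_norm (\<lambda>x. W (shear (k n) x) - W x))) \<longlonglongrightarrow> 0"
      using shear_continuous_L2[OF W] k0 k unfolding tendsto_at_iff_sequentially
      by (auto simp: o_def less_imp_neq[THEN not_sym])
    then show "(\<lambda>n. B * L2_norm (\<lambda>x. W (shear (k n) x) - W x)) \<longlonglongrightarrow> 0" by (rule tendsto_mult_right_zero)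
    have B0: "0 \<le> B" using B(1)[of 0] by linarith
    have "L2_norm (\<lambda>x. R n x - complex_of_real (w x) * (2 * W x)) \<le> L2_norm (\<lambda>x. B *\<^sub>R (W (shear (k n) x) - W x))" for n
    proof (rule L2_norm_mono)
      show "(\<lambda>x. B *\<^sub>R (W (shear (k n) x) - W x)) \<in> L2" by (intro L2_scaleR L2_diff Wn W)
      show "(\<lambda>x. R n x - complex_of_real (w x) * (2 * W x)) \<in> borel_measurable lborel" unfolding R_def by measurable
      show "norm (R n x - complex_of_real (w x) * (2 * W x)) \<le> norm (B *\<^sub>R (W (shear (k n) x) - W x))" for x
      proof -
        have "R n x - complex_of_real (w x) * (2 * W x) = complex_of_real (w x) * (W (shear (k n) x) - W x)"
          by (simp add: R_def algebra_simps)
        then show ?thesis using B0 mult_right_mono[OF B(1)[of x]] by (simp add: norm_mult)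
      qed
    qed
    then show "\<forall>n. norm (L2_norm (\<lambda>x. R n x - complex_of_real (w x) * (2 * W x))) \<le> B * L2_norm (\<lambda>x. W (shear (k n) x) - W x)"
      using B0 by (simp add: L2_norm_scaleR)
  qed
  have cq: "L2_norm (\<lambda>x. cnj (Q n x) - cnj (S x)) = L2_norm (\<lambda>x. Q n x - S x)" for n
    by (simp add: L2_norm_def flip: complex_cnj_diff)
  have "(\<lambda>n. \<integral>x. cnj (Q n x) * R n x \<partial>lborel) \<longlonglongrightarrow> (\<integral>x. cnj (S x) * (complex_of_real (w x) * (2 * W x)) \<partial>lborel)"
    by (intro L2_pairing_tendsto L2_cnj Q R S wL L2_cmult W Rlim) (simp add: cq Qlim)
  then have lim1: "(\<lambda>n. Re (\<integral>x. cnj (Q n x) * R n x \<partial>lborel)) \<longlonglongrightarrow> Re (\<integral>x. cnj (S x) * (complex_of_real (w x) * (2 * W x)) \<partial>lborel)"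
    by (rule tendsto_Re)
  have end1: "Re (\<integral>x. cnj (S x) * (complex_of_real (w x) * (2 * W x)) \<partial>lborel) = 2 * (\<integral>x. w x * (S x \<bullet> W x) \<partial>lborel)"
  proof -
    have "Re (cnj (S x) * (complex_of_real (w x) * (2 * W x))) = 2 * (w x * (S x \<bullet> W x))" for x
      by (simp add: inner_complex_def algebra_simps)
    then show ?thesis
      by (subst integral_Re[symmetric]) (intro integrable_mult_L2 L2_cnj S wL L2_cmult W, simp)
  qed
  have quot: "Re (\<integral>x. cnj (Q n x) * R n x \<partial>lborel) = (\<integral>x. ((w (shear (- k n) x) - w x) / k n) * (norm (W x))\<^sup>2 \<partial>lborel)" for n
  proof -
    have i1: "integrable lborel (\<lambda>x. w x * (norm (u x))\<^sup>2)" if "u \<in> L2" for u :: "real^3 \<Rightarrow> complex"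
    proof (rule Bochner_Integration.integrable_bound[where f = "\<lambda>x. B * (norm (u x))\<^sup>2"])
      show "AE x in lborel. norm (w x * (norm (u x))\<^sup>2) \<le> norm (B * (norm (u x))\<^sup>2)"
        using B(1) by (intro AE_I2) (auto simp: abs_mult intro!: mult_right_mono order_trans[OF B(1) abs_ge_self])
    qed (use L2_D[OF that] in auto)
    have "Re (cnj (Q n x) * R n x) = real (Suc n) * (w x * (norm (W (shear (k n) x)))\<^sup>2 - w x * (norm (W x))\<^sup>2)" for x
    proof -
      have "(norm a)\<^sup>2 - (norm b)\<^sup>2 = Re (cnj (a - b) * (a + b))" for a b :: complex
        unfolding cmod_power2 by (simp add: power2_eq_square algebra_simps)
      note e = this[of "W (shear (k n) x)" "W x"]
      have "Re (cnj (Q n x) * R n x) = real (Suc n) * (w x * Re (cnj (W (shear (k n) x) - W x) * (W (shear (k n) x) + W x)))"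
        by (simp add: Q_def R_def algebra_simps del: of_nat_Suc)
      then show ?thesis unfolding e[symmetric] right_diff_distrib .
    qed
    then have "Re (\<integral>x. cnj (Q n x) * R n x \<partial>lborel)
        = (\<integral>x. real (Suc n) * (w x * (norm (W (shear (k n) x)))\<^sup>2 - w x * (norm (W x))\<^sup>2) \<partial>lborel)"
      by (subst integral_Re[symmetric]) (intro integrable_mult_L2 L2_cnj Q R, simp only:)
    also have "\<dots> = real (Suc n) * ((\<integral>x. w x * (norm (W (shear (k n) x)))\<^sup>2 \<partial>lborel) - (\<integral>x. w x * (norm (W x))\<^sup>2 \<partial>lborel))"
      by (simp only: integral_mult_right_zero Bochner_Integration.integral_diff[OF i1[OF Wn] i1[OF W]])
    also have "(\<integral>x. w x * (norm (W (shear (k n) x)))\<^sup>2 \<partial>lborel) = (\<integral>x. w (shear (- k n) x) * (norm (W x))\<^sup>2 \<partial>lborel)"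
      using lborel_preserving_integral[OF lborel_preserving_shear, of "\<lambda>x. w (shear (- k n) x) * (norm (W x))\<^sup>2" "k n"]
      by (simp add: shear_shear)
    also have "real (Suc n) * ((\<integral>x. w (shear (- k n) x) * (norm (W x))\<^sup>2 \<partial>lborel) - (\<integral>x. w x * (norm (W x))\<^sup>2 \<partial>lborel))
        = (\<integral>x. real (Suc n) * (w (shear (- k n) x) * (norm (W x))\<^sup>2 - w x * (norm (W x))\<^sup>2) \<partial>lborel)"
    proof -
      have i2: "integrable lborel (\<lambda>x. w (shear (- k n) x) * (norm (W x))\<^sup>2)"
      proof (rule Bochner_Integration.integrable_bound[where f = "\<lambda>x. B * (norm (W x))\<^sup>2"])
        show "AE x in lborel. norm (w (shear (- k n) x) * (norm (W x))\<^sup>2) \<le> norm (B * (norm (W x))\<^sup>2)"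
          by (intro AE_I2) (auto simp: abs_mult intro!: mult_right_mono order_trans[OF B(1) abs_ge_self])
      qed (use L2_D[OF W] in auto)
      show ?thesis
        by (simp only: integral_mult_right_zero Bochner_Integration.integral_diff[OF i2 i1[OF W]])
    qed
    also have "\<dots> = (\<integral>x. ((w (shear (- k n) x) - w x) / k n) * (norm (W x))\<^sup>2 \<partial>lborel)"
      by (intro Bochner_Integration.integral_cong refl) (simp add: k_def algebra_simps)
    finally show ?thesis .
  qed
  have lim2: "(\<lambda>n. \<integral>x. ((w (shear (- k n) x) - w x) / k n) * (norm (W x))\<^sup>2 \<partial>lborel) \<longlonglongrightarrow> (\<integral>x. - dw x * (norm (W x))\<^sup>2 \<partial>lborel)"
  proof (rule integral_dominated_convergence[where w = "\<lambda>x. B * (norm (W x))\<^sup>2"])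
    show "AE x in lborel. (\<lambda>n. ((w (shear (- k n) x) - w x) / k n) * (norm (W x))\<^sup>2) \<longlonglongrightarrow> - dw x * (norm (W x))\<^sup>2"
      using der
    proof eventually_elim
      case (elim x)
      have "((\<lambda>t. w (shear t x)) has_real_derivative dw x) (at 0)" using elim[rule_format, of 0] by simp
      then have "((\<lambda>h. (w (shear h x) - w x) / h) \<longlongrightarrow> dw x) (at 0)" by (simp add: DERIV_def)
      then have "(\<lambda>n. (w (shear (- k n) x) - w x) / (- k n)) \<longlonglongrightarrow> dw x"
        unfolding tendsto_at_iff_sequentially
        using k tendsto_minus[OF k0] by (auto simp: o_def less_imp_neq[THEN not_sym] dest!: spec[of _ "\<lambda>n. - k n"])
      from tendsto_mult[OF tendsto_minus[OF this] tendsto_const] show ?case by simp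
    qed
    show "AE x in lborel. norm (((w (shear (- k n) x) - w x) / k n) * (norm (W x))\<^sup>2) \<le> B * (norm (W x))\<^sup>2" for n
      using der
    proof eventually_elim
      case (elim x)
      have "norm (w (shear (- k n) x) - w (shear 0 x)) \<le> B * norm (- k n - 0)"
        by (rule field_differentiable_bound[of UNIV "\<lambda>t. w (shear t x)" "\<lambda>t. dw (shear t x)"])
          (use elim B(2) in auto)
      then have "\<bar>(w (shear (- k n) x) - w x) / k n\<bar> \<le> B" using k[of n] by (simp add: divide_le_eq)
      then have "\<bar>(w (shear (- k n) x) - w x) / k n\<bar> * (norm (W x))\<^sup>2 \<le> B * (norm (W x))\<^sup>2"
        by (rule mult_right_mono) simp
      then show ?case by (simp only: real_norm_def abs_mult abs_power2)
    qed
  qed (use L2_D(2)[OF W] in \<open>simp_all\<close>)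
  have "2 * (\<integral>x. w x * (S x \<bullet> W x) \<partial>lborel) = (\<integral>x. - dw x * (norm (W x))\<^sup>2 \<partial>lborel)"
    using lim1 lim2 unfolding quot end1 by (rule LIMSEQ_unique)
  then show ?thesis by simp
qed

section \<open>Uniqueness for the transport equation with a diffusive symbol\<close>

text \<open>The weight is \<open>w = exp (\<sigma> q(\<xi>\<^sub>2) / \<xi>\<^sub>1 - Q / |\<xi>\<^sub>1|)\<close> with a bounded increasing function \<open>q\<close>, so that
  \<open>\<xi>\<^sub>1 \<partial>\<^sub>2 w = \<sigma> q' w\<close>; the function \<open>dq\<close> is \<open>q'\<close>. The diffusion contributes \<open>2 (\<nu> \<xi>\<^sub>2\<^sup>2 - K)\<close> to the energy estimate, which is
  positive for large \<open>\<xi>\<^sub>2\<close> only, and \<open>q'\<close> compensates on the remaining interval. With \<open>Q = sup |q|\<close> the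
  last term in the exponent keeps \<open>w\<close> bounded near \<open>\<xi>\<^sub>1 = 0\<close>.\<close>

lemma bounded_shear_weight:
  fixes K \<nu> \<sigma> :: real
  assumes \<nu>: "\<nu> > 0" and \<sigma>: "\<sigma> = 1 \<or> \<sigma> = -1" and K: "K \<ge> 0"
  obtains w dq :: "real^3 \<Rightarrow> real" and B :: real
  where "w \<in> borel_measurable borel" "dq \<in> borel_measurable borel"
    "\<And>x. 0 < w x" "\<And>x. w x \<le> 1" "\<And>x. 0 \<le> dq x" "\<And>x. dq x \<le> B"
    "\<And>x. 2 * (\<nu> * (x $ 2)\<^sup>2 - K) + dq x \<ge> 2"
    "\<And>x t. x $ 1 \<noteq> 0 \<Longrightarrow> ((\<lambda>t. w (shear t x)) has_real_derivative \<sigma> * dq (shear t x) * w (shear t x)) (at t)"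
proof -
  \<comment> \<open>with \<open>q = c arctan\<close> this gives \<open>q' \<ge> 2 K + 2\<close> on the interval where \<open>\<nu> \<xi>\<^sub>2\<^sup>2 < K + 1\<close>\<close>
  define c where "c = (2 * K + 2) * (1 + (K + 1) / \<nu>)"
  have K': "2 * K + 2 > 0" "(K + 1) / \<nu> \<ge> 0" using K \<nu> by auto
  then have c: "c > 0" unfolding c_def by (intro mult_pos_pos) linarith+
  define Q where "Q = c * (pi / 2)"
  define w :: "real^3 \<Rightarrow> real" where "w x = exp (\<sigma> * c * arctan (x $ 2) / x $ 1 - Q / \<bar>x $ 1\<bar>)" for x
  define dq :: "real^3 \<Rightarrow> real" where "dq x = c / (1 + (x $ 2)\<^sup>2)" for x
  have pos: "1 + b\<^sup>2 > 0" for b :: real by (simp add: add_pos_nonneg)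
  have wm: "w \<in> borel_measurable borel"
  proof -
    have [measurable]: "arctan \<in> borel_measurable borel"
      by (intro borel_measurable_continuous_onI continuous_on_arctan continuous_on_id)
    show ?thesis unfolding w_def[abs_def] by measurable
  qed
  have w1: "w x \<le> 1" for x
  proof -
    have "\<bar>\<sigma> * c * arctan (x $ 2)\<bar> \<le> Q"
      using \<sigma> c arctan_bounded[of "x $ 2"] by (auto simp: Q_def abs_mult intro!: mult_left_mono)
    then have "\<bar>\<sigma> * c * arctan (x $ 2) / x $ 1\<bar> \<le> Q / \<bar>x $ 1\<bar>"
      unfolding abs_divide by (rule divide_right_mono) simp
    then show ?thesis unfolding w_def by (subst exp_le_one_iff) linarith
  qed
  have ineq: "2 * (\<nu> * b\<^sup>2 - K) + c / (1 + b\<^sup>2) \<ge> 2" for b :: real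
  proof (cases "b\<^sup>2 \<ge> (K + 1) / \<nu>")
    case True
    then have "\<nu> * b\<^sup>2 \<ge> K + 1" using \<nu> by (simp add: field_simps)
    then have "2 * (\<nu> * b\<^sup>2 - K) \<ge> 2" by simp
    moreover have "c / (1 + b\<^sup>2) \<ge> 0" using c pos[of b] by simp
    ultimately show ?thesis by simp
  next
    case False
    have "c / (1 + b\<^sup>2) \<ge> c / (1 + (K + 1) / \<nu>)"
      using False c pos[of b] by (intro divide_left_mono mult_pos_pos) (auto intro!: add_pos_nonneg simp: K \<nu> less_imp_le)
    also have "c / (1 + (K + 1) / \<nu>) = 2 * K + 2"
    proof -
      have "1 + (K + 1) / \<nu> > 0" using K' by linarith
      then show ?thesis by (simp add: c_def)
    qed
    finally have "c / (1 + b\<^sup>2) \<ge> 2 * K + 2" .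
    moreover have "2 * (\<nu> * b\<^sup>2 - K) \<ge> - 2 * K" using \<nu> by simp
    ultimately show ?thesis by simp
  qed
  have der: "((\<lambda>t. w (shear t x)) has_real_derivative \<sigma> * dq (shear t x) * w (shear t x)) (at t)"
    if x: "x $ 1 \<noteq> 0" for x t
  proof -
    have e: "1 + (x $ 2 + t * x $ 1)\<^sup>2 \<noteq> 0" using pos[of "x $ 2 + t * x $ 1"] by simp
    have "((\<lambda>t. exp (\<sigma> * c * arctan (x $ 2 + t * x $ 1) / x $ 1 - Q / \<bar>x $ 1\<bar>)) has_real_derivative
        exp (\<sigma> * c * arctan (x $ 2 + t * x $ 1) / x $ 1 - Q / \<bar>x $ 1\<bar>) *
          (\<sigma> * c * (inverse (1 + (x $ 2 + t * x $ 1)\<^sup>2) * x $ 1) / x $ 1)) (at t)"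
      using x by (auto intro!: derivative_eq_intros)
    moreover have "exp (\<sigma> * c * arctan (x $ 2 + t * x $ 1) / x $ 1 - Q / \<bar>x $ 1\<bar>) *
          (\<sigma> * c * (inverse (1 + (x $ 2 + t * x $ 1)\<^sup>2) * x $ 1) / x $ 1) = \<sigma> * dq (shear t x) * w (shear t x)"
      using x by (simp add: w_def dq_def divide_inverse)
    ultimately have "((\<lambda>t. exp (\<sigma> * c * arctan (x $ 2 + t * x $ 1) / x $ 1 - Q / \<bar>x $ 1\<bar>)) has_real_derivative
        \<sigma> * dq (shear t x) * w (shear t x)) (at t)"
      by (rule DERIV_cong)
    moreover have "(\<lambda>t. w (shear t x)) = (\<lambda>t. exp (\<sigma> * c * arctan (x $ 2 + t * x $ 1) / x $ 1 - Q / \<bar>x $ 1\<bar>))"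
      by (simp add: w_def)
    ultimately show ?thesis by (simp only:)
  qed
  show ?thesis
  proof (rule that[of w dq c])
    show "dq x \<le> c" for x using c by (simp add: dq_def divide_le_eq pos)
  qed (use wm w1 der ineq c pos in \<open>auto simp: w_def dq_def[abs_def] less_imp_le\<close>)
qed

text \<open>A bounded matrix costs at most a multiple of \<open>|v|\<^sup>2\<close>, which is absorbed in the constant.\<close>

lemma symbol_coercive:
  fixes v :: "3 \<Rightarrow> complex" and s :: "3 \<Rightarrow> 3 \<Rightarrow> complex" and \<mu> :: complex and a C :: real
  assumes s: "\<And>i k. cmod (s i k) \<le> C"
  shows "(\<Sum>i\<in>UNIV. ((\<mu> + complex_of_real a) * v i - (\<Sum>k\<in>UNIV. s i k * v k)) \<bullet> v i)
    \<ge> (a - (\<bar>Re \<mu>\<bar> + 3 * C)) * (\<Sum>i\<in>UNIV. (cmod (v i))\<^sup>2)"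
proof -
  have C: "C \<ge> 0" using s[of 1 1] norm_ge_zero order_trans by blast
  let ?m = "\<Sum>i\<in>UNIV. (cmod (v i))\<^sup>2"
  have m: "0 \<le> ?m" by (intro sum_nonneg) simp
  have 1: "((\<mu> + complex_of_real a) * v i - (\<Sum>k\<in>UNIV. s i k * v k)) \<bullet> v i
      \<ge> (Re \<mu> + a) * (cmod (v i))\<^sup>2 - (\<Sum>k\<in>UNIV. C * (((cmod (v k))\<^sup>2 + (cmod (v i))\<^sup>2) / 2))" for i
  proof -
    have "((\<mu> + complex_of_real a) * v i) \<bullet> v i = (Re \<mu> + a) * (cmod (v i))\<^sup>2"
      unfolding cmod_power2 by (simp add: inner_complex_def power2_eq_square algebra_simps)
    moreover have "(\<Sum>k\<in>UNIV. s i k * v k) \<bullet> v i \<le> (\<Sum>k\<in>UNIV. C * (((cmod (v k))\<^sup>2 + (cmod (v i))\<^sup>2) / 2))"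
      unfolding inner_sum_left
    proof (rule sum_mono)
      fix k :: 3
      have "(s i k * v k) \<bullet> v i \<le> cmod (s i k * v k) * cmod (v i)" by (rule norm_cauchy_schwarz)
      also have "\<dots> = cmod (s i k) * (cmod (v k) * cmod (v i))" by (simp add: norm_mult)
      also have "\<dots> \<le> C * (((cmod (v k))\<^sup>2 + (cmod (v i))\<^sup>2) / 2)"
        using sum_squares_bound[of "cmod (v k)" "cmod (v i)"] by (intro mult_mono s C) auto
      finally show "(s i k * v k) \<bullet> v i \<le> C * (((cmod (v k))\<^sup>2 + (cmod (v i))\<^sup>2) / 2)" .
    qed
    ultimately show ?thesis by (simp add: inner_diff_left)
  qed
  have "(\<Sum>i\<in>UNIV. (Re \<mu> + a) * (cmod (v i))\<^sup>2 - (\<Sum>k\<in>UNIV. C * (((cmod (v k))\<^sup>2 + (cmod (v i))\<^sup>2) / 2)))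
      = (Re \<mu> + a) * ?m - 3 * C * ?m"
    by (simp add: sum_3 algebra_simps add_divide_distrib)
  moreover have "- \<bar>Re \<mu>\<bar> * ?m \<le> Re \<mu> * ?m" by (intro mult_right_mono m) linarith
  then have "(Re \<mu> + a) * ?m - 3 * C * ?m \<ge> (a - (\<bar>Re \<mu>\<bar> + 3 * C)) * ?m"
    by (simp add: algebra_simps)
  moreover have "(\<Sum>i\<in>UNIV. ((\<mu> + complex_of_real a) * v i - (\<Sum>k\<in>UNIV. s i k * v k)) \<bullet> v i)
      \<ge> (\<Sum>i\<in>UNIV. (Re \<mu> + a) * (cmod (v i))\<^sup>2 - (\<Sum>k\<in>UNIV. C * (((cmod (v k))\<^sup>2 + (cmod (v i))\<^sup>2) / 2)))"
    by (intro sum_mono 1)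
  ultimately show ?thesis by linarith
qed

text \<open>The field is only known to be square integrable, the terms of the equation only locally so;
  the energy identity is therefore applied to \<open>\<kappa>\<^sub>n V\<close> with the cutoffs \<open>\<kappa>\<^sub>n\<close>, and the commutator
  \<open>\<xi>\<^sub>1 \<partial>\<^sub>2 \<kappa>\<^sub>n\<close> disappears in the limit. The sign \<open>\<sigma>\<close> distinguishes the equation from its adjoint: the
  hypothesis is the weak form of \<open>\<xi>\<^sub>1 \<partial>\<^sub>2 V = \<sigma> (\<mu> + \<nu> |\<xi>|\<^sup>2 - s) V\<close>.\<close>

lemma shear_diffusion_uniqueness:
  fixes V :: "3 \<Rightarrow> real^3 \<Rightarrow> complex" and s :: "3 \<Rightarrow> 3 \<Rightarrow> real^3 \<Rightarrow> complex" and \<mu> :: complex and \<nu> \<sigma> C\<^sub>s :: real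
  assumes \<nu>: "\<nu> > 0" and \<sigma>: "\<sigma> = 1 \<or> \<sigma> = -1" and V: "\<And>i. V i \<in> L2"
    and sm: "\<And>i k. s i k \<in> borel_measurable borel" and sb: "\<And>i k x. cmod (s i k x) \<le> C\<^sub>s"
    and eq: "\<And>i \<psi>. \<psi> \<in> test_functions \<Longrightarrow>
      (\<integral>x. V i x * (complex_of_real (x $ 1) * partial_deriv 2 \<psi> x) \<partial>lborel)
      = - complex_of_real \<sigma> * (\<integral>x. ((\<mu> + complex_of_real (\<nu> * (norm x)\<^sup>2)) * V i x - (\<Sum>k\<in>UNIV. s i k x * V k x)) * \<psi> x \<partial>lborel)"
  shows "AE x in lborel. V i x = 0"
proof -
  define N where "N i x = (\<mu> + complex_of_real (\<nu> * (norm x)\<^sup>2)) * V i x - (\<Sum>k\<in>UNIV. s i k x * V k x)" for i x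
  define m where "m x = (\<Sum>i\<in>UNIV. (cmod (V i x))\<^sup>2)" for x
  have Vm [measurable]: "V i \<in> borel_measurable borel" for i using L2_D(3)[OF V] .
  have [measurable]: "s i k \<in> borel_measurable borel" for i k using sm .
  have Nm [measurable]: "N i \<in> borel_measurable borel" for i unfolding N_def[abs_def] by measurable
  have m0: "0 \<le> m x" for x unfolding m_def by (intro sum_nonneg) simp
  have mi: "integrable lborel m" unfolding m_def[abs_def]
    by (intro Bochner_Integration.integrable_sum L2_D(2) V)
  have mm [measurable]: "m \<in> borel_measurable borel" using borel_measurable_integrable[OF mi] by simp
  have Cs: "C\<^sub>s \<ge> 0" using sb[of 1 1 0] norm_ge_zero order_trans by blast
  define K where "K = \<bar>Re \<mu>\<bar> + 3 * C\<^sub>s"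
  have K: "K \<ge> 0" unfolding K_def using Cs by simp
  obtain w dq :: "real^3 \<Rightarrow> real" and B :: real where
    wm [measurable]: "w \<in> borel_measurable borel" "dq \<in> borel_measurable borel"
    and w: "\<And>x. 0 < w x" "\<And>x. w x \<le> 1" and dq: "\<And>x. 0 \<le> dq x" "\<And>x. dq x \<le> B"
    and growth: "\<And>x. 2 * (\<nu> * (x $ 2)\<^sup>2 - K) + dq x \<ge> 2"
    and der: "\<And>x t. x $ 1 \<noteq> 0 \<Longrightarrow> ((\<lambda>t. w (shear t x)) has_real_derivative \<sigma> * dq (shear t x) * w (shear t x)) (at t)"
    by (rule bounded_shear_weight[OF \<nu> \<sigma> K]) blast
  have pointwise: "2 * m x \<le> 2 * (\<Sum>i\<in>UNIV. N i x \<bullet> V i x) + dq x * m x" for x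
  proof -
    have "(\<Sum>i\<in>UNIV. N i x \<bullet> V i x) \<ge> (\<nu> * (norm x)\<^sup>2 - K) * m x"
      unfolding N_def m_def K_def by (rule symbol_coercive) (rule sb)
    moreover have "(x $ 2)\<^sup>2 \<le> (norm x)\<^sup>2"
      using power_mono[OF component_le_norm_cart[of x 2], of 2] by simp
    then have "(\<nu> * (x $ 2)\<^sup>2 - K) * m x \<le> (\<nu> * (norm x)\<^sup>2 - K) * m x"
      using \<nu> m0 by (intro mult_right_mono) auto
    moreover have "2 * m x \<le> (2 * (\<nu> * (x $ 2)\<^sup>2 - K) + dq x) * m x"
      by (rule mult_right_mono[OF growth m0])
    ultimately show ?thesis by (simp add: algebra_simps)
  qed
  obtain \<kappa> C where \<kappa>: "\<And>n. \<kappa> n \<in> test_functions" "(C::real) > 0"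
    "\<And>n x. cmod (\<kappa> n x) \<le> C" "\<And>x. (\<lambda>n::nat. \<kappa> n x) \<longlonglongrightarrow> 1"
    "\<And>n j x. cmod (partial_deriv j (\<kappa> n) x) \<le> C" "\<And>j x. (\<lambda>n. partial_deriv j (\<kappa> n) x) \<longlonglongrightarrow> 0"
    "\<And>n i j x. cmod (complex_of_real (x $ i) * partial_deriv j (\<kappa> n) x) \<le> C"
    by (rule cutoff_sequence) blast
  have \<kappa>m [measurable]: "\<kappa> n \<in> borel_measurable borel" "partial_deriv j (\<kappa> n) \<in> borel_measurable borel" for n j
    using test_measurable[OF \<kappa>(1)] test_measurable[OF test_partial[OF \<kappa>(1)]] by auto
  define d where "d n x = complex_of_real (x $ 1) * partial_deriv 2 (\<kappa> n) x" for n and x :: "real^3"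
  have dm [measurable]: "d n \<in> borel_measurable borel" for n unfolding d_def[abs_def] by measurable
  have db: "cmod (d n x) \<le> C" for n x unfolding d_def by (rule \<kappa>)
  have d0: "(\<lambda>n. d n x) \<longlonglongrightarrow> 0" for x unfolding d_def by (rule tendsto_mult_right_zero[OF \<kappa>(6)])
  define W where "W n i x = \<kappa> n x * V i x" for n i x
  define S where "S n i x = complex_of_real \<sigma> * (\<kappa> n x * N i x) + d n x * V i x" for n i x
  have W: "W n i \<in> L2" for n i unfolding W_def[abs_def] by (rule L2_mult_bounded[OF V \<kappa>m(1) \<kappa>(3)])
  have \<kappa>N: "(\<lambda>x. \<kappa> n x * N i x) \<in> L2" for n i
  proof -
    obtain b where b: "\<And>x. cmod (complex_of_real ((norm x)\<^sup>2) * \<kappa> n x) \<le> b"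
      using test_bounded[OF test_norm_power2_mult[OF \<kappa>(1)[of n]]] by blast
    have "(\<lambda>x. (\<mu> * \<kappa> n x) * V i x) \<in> L2"
      by (rule L2_mult_bounded[OF V, where C = "cmod \<mu> * C"]) (measurable, simp add: norm_mult mult_left_mono \<kappa>(3))
    moreover have "(\<lambda>x. (complex_of_real \<nu> * (complex_of_real ((norm x)\<^sup>2) * \<kappa> n x)) * V i x) \<in> L2"
      by (rule L2_mult_bounded[OF V, where C = "\<bar>\<nu>\<bar> * b"])
        (measurable, unfold norm_mult[of "complex_of_real \<nu>"] norm_of_real, rule mult_left_mono[OF b abs_ge_zero])
    moreover have "(\<lambda>x. (s i k x * \<kappa> n x) * V k x) \<in> L2" for k
      by (rule L2_mult_bounded[OF V, where C = "C\<^sub>s * C"])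
        (measurable, unfold norm_mult, intro mult_mono sb \<kappa>(3) norm_ge_zero Cs)
    then have "(\<lambda>x. \<Sum>k\<in>UNIV. (s i k x * \<kappa> n x) * V k x) \<in> L2" by (intro L2_sum)
    ultimately have "(\<lambda>x. (\<mu> * \<kappa> n x) * V i x + (complex_of_real \<nu> * (complex_of_real ((norm x)\<^sup>2) * \<kappa> n x)) * V i x
        - (\<Sum>k\<in>UNIV. (s i k x * \<kappa> n x) * V k x)) \<in> L2"
      by (intro L2_diff L2_add)
    moreover have "(\<mu> * \<kappa> n x) * V i x + (complex_of_real \<nu> * (complex_of_real ((norm x)\<^sup>2) * \<kappa> n x)) * V i x
        - (\<Sum>k\<in>UNIV. (s i k x * \<kappa> n x) * V k x) = \<kappa> n x * N i x" for x
      by (simp add: N_def algebra_simps sum_distrib_left)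
    ultimately show ?thesis by simp
  qed
  have dV: "(\<lambda>x. d n x * V i x) \<in> L2" for n i by (rule L2_mult_bounded[OF V dm db])
  have S: "S n i \<in> L2" for n i unfolding S_def[abs_def] by (intro L2_add L2_cmult \<kappa>N dV)
  have weak: "(\<integral>x. W n i x * (complex_of_real (x $ 1) * partial_deriv 2 \<psi> x) \<partial>lborel) = - (\<integral>x. S n i x * \<psi> x \<partial>lborel)"
    if \<psi>: "\<psi> \<in> test_functions" for n i \<psi>
  proof -
    have t: "(\<lambda>x. \<kappa> n x * \<psi> x) \<in> test_functions" by (intro test_mult_smooth test_smooth \<kappa>(1) \<psi>)
    have t2: "(\<lambda>x. 1 * complex_of_real (x $ 1) * partial_deriv 2 (\<lambda>x. \<kappa> n x * \<psi> x) x) \<in> test_functions"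
      by (intro test_coord_mult test_partial t)
    have pw: "W n i x * (complex_of_real (x $ 1) * partial_deriv 2 \<psi> x)
        = V i x * (1 * complex_of_real (x $ 1) * partial_deriv 2 (\<lambda>x. \<kappa> n x * \<psi> x) x) - (d n x * V i x) * \<psi> x" for x
      unfolding partial_deriv_mult[OF test_smooth[OF \<kappa>(1)] test_smooth[OF \<psi>]]
      by (simp add: W_def d_def algebra_simps)
    have "(\<integral>x. W n i x * (complex_of_real (x $ 1) * partial_deriv 2 \<psi> x) \<partial>lborel)
        = (\<integral>x. V i x * (1 * complex_of_real (x $ 1) * partial_deriv 2 (\<lambda>x. \<kappa> n x * \<psi> x) x) \<partial>lborel)
          - (\<integral>x. (d n x * V i x) * \<psi> x \<partial>lborel)"
      unfolding pw by (intro Bochner_Integration.integral_diff integrable_mult_L2 V test_L2[OF t2] dV test_L2[OF \<psi>])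
    also have "(\<integral>x. V i x * (1 * complex_of_real (x $ 1) * partial_deriv 2 (\<lambda>x. \<kappa> n x * \<psi> x) x) \<partial>lborel)
        = - complex_of_real \<sigma> * (\<integral>x. N i x * (\<kappa> n x * \<psi> x) \<partial>lborel)"
      using eq[OF t] unfolding N_def by simp
    also have "(\<integral>x. N i x * (\<kappa> n x * \<psi> x) \<partial>lborel) = (\<integral>x. (\<kappa> n x * N i x) * \<psi> x \<partial>lborel)"
      by (simp add: mult_ac)
    also have "- complex_of_real \<sigma> * (\<integral>x. (\<kappa> n x * N i x) * \<psi> x \<partial>lborel) - (\<integral>x. (d n x * V i x) * \<psi> x \<partial>lborel)
        = - (\<integral>x. S n i x * \<psi> x \<partial>lborel)"
    proof -
      have "S n i x * \<psi> x = complex_of_real \<sigma> * ((\<kappa> n x * N i x) * \<psi> x) + (d n x * V i x) * \<psi> x" for x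
        by (simp add: S_def algebra_simps)
      then have "(\<integral>x. S n i x * \<psi> x \<partial>lborel)
          = (\<integral>x. complex_of_real \<sigma> * ((\<kappa> n x * N i x) * \<psi> x) \<partial>lborel) + (\<integral>x. (d n x * V i x) * \<psi> x \<partial>lborel)"
        by (simp only:) (intro Bochner_Integration.integral_add integrable_mult_right integrable_mult_L2 \<kappa>N dV test_L2[OF \<psi>])
      then show ?thesis by (simp only: integral_mult_right_zero) simp
    qed
    finally show ?thesis .
  qed
  have B0: "0 \<le> B" using dq[of 0] by linarith
  have a0: "AE x in lborel. (x::real^3) $ 1 \<noteq> 0"
  proof -
    have "negligible {x::real^3. x $ 1 = 0}" by (rule negligible_standard_hyperplane_cart)
    then have "{x::real^3. x $ 1 = 0} \<in> null_sets lebesgue" by (simp add: negligible_iff_null_sets)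
    moreover have "{x::real^3. x $ 1 = 0} \<in> sets lborel"
      unfolding sets_lborel by (intro borel_closed closed_Collect_eq continuous_intros)
    ultimately have "{x::real^3. x $ 1 = 0} \<in> null_sets lborel"
      using null_sets_completion_iff by blast
    from AE_not_in[OF this] show ?thesis by simp
  qed
  have energy: "2 * (\<integral>x. w x * (S n i x \<bullet> W n i x) \<partial>lborel) = - (\<integral>x. (\<sigma> * dq x * w x) * (norm (W n i x))\<^sup>2 \<partial>lborel)" for n i
  proof (rule shear_energy_identity[OF W S weak, where B = "1 + B"])
    show "\<bar>w x\<bar> \<le> 1 + B" for x using w[of x] B0 by simp
    show "\<bar>\<sigma> * dq x * w x\<bar> \<le> 1 + B" for x
    proof -
      have "\<bar>\<sigma> * dq x * w x\<bar> = dq x * w x" using \<sigma> dq(1)[of x] w(1)[of x] by (auto simp: abs_mult)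
      also have "\<dots> \<le> B * 1" using dq w B0 by (intro mult_mono) (auto intro: less_imp_le)
      finally show ?thesis by simp
    qed
    show "AE x in lborel. \<forall>t. ((\<lambda>t. w (shear t x)) has_real_derivative \<sigma> * dq (shear t x) * w (shear t x)) (at t)"
      using a0 by eventually_elim (intro allI der)
  qed measurable
  define E where "E n x = w x * (2 * ((cmod (\<kappa> n x))\<^sup>2 * m x))" for n x
  define F where "F n x = w x * (- 2 * \<sigma> * Re (cnj (d n x) * \<kappa> n x) * m x)" for n x
  have wL: "integrable lborel (\<lambda>x. w x * (u x \<bullet> v x))" if "u \<in> L2" "v \<in> L2" for u v :: "real^3 \<Rightarrow> complex"
  proof (rule Bochner_Integration.integrable_bound[OF integrable_inner_L2[OF that]])
    show "AE x in lborel. norm (w x * (u x \<bullet> v x)) \<le> norm (u x \<bullet> v x)"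
      using w by (intro AE_I2) (simp add: abs_mult mult_left_le_one_le less_imp_le)
    show "(\<lambda>x. w x * (u x \<bullet> v x)) \<in> borel_measurable lborel"
      using L2_D(3)[OF that(1)] L2_D(3)[OF that(2)] by measurable
  qed
  have dqL: "integrable lborel (\<lambda>x. (\<sigma> * dq x * w x) * (norm (u x))\<^sup>2)" if "u \<in> L2" for u :: "real^3 \<Rightarrow> complex"
  proof (rule Bochner_Integration.integrable_bound[where f = "\<lambda>x. B * (norm (u x))\<^sup>2"])
    show "AE x in lborel. norm ((\<sigma> * dq x * w x) * (norm (u x))\<^sup>2) \<le> norm (B * (norm (u x))\<^sup>2)"
    proof (rule AE_I2)
      fix x
      have "\<bar>\<sigma> * dq x * w x\<bar> = dq x * w x" using \<sigma> dq(1)[of x] w(1)[of x] by (auto simp: abs_mult)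
      also have "\<dots> \<le> B * 1" using dq w B0 by (intro mult_mono) (auto intro: less_imp_le)
      finally have "\<bar>\<sigma> * dq x * w x\<bar> * (norm (u x))\<^sup>2 \<le> \<bar>B\<bar> * (norm (u x))\<^sup>2"
        using B0 by (intro mult_right_mono) auto
      then show "norm ((\<sigma> * dq x * w x) * (norm (u x))\<^sup>2) \<le> norm (B * (norm (u x))\<^sup>2)"
        by (simp only: real_norm_def abs_mult[of _ "(norm (u x))\<^sup>2"] abs_power2)
    qed
    show "(\<lambda>x. (\<sigma> * dq x * w x) * (norm (u x))\<^sup>2) \<in> borel_measurable lborel"
      using L2_D(3)[OF that] by measurable
  qed (use L2_D(2)[OF that] in simp)
  have Fdom: "\<bar>F n x\<bar> \<le> 2 * (C * C) * m x" for n x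
  proof -
    have "\<bar>Re (cnj (d n x) * \<kappa> n x)\<bar> \<le> cmod (d n x) * cmod (\<kappa> n x)"
      using abs_Re_le_cmod[of "cnj (d n x) * \<kappa> n x"] by (simp add: norm_mult)
    also have "\<dots> \<le> C * C" using db \<kappa>(2,3) by (intro mult_mono) (auto intro: less_imp_le)
    finally have "w x * (2 * \<bar>Re (cnj (d n x) * \<kappa> n x)\<bar> * m x) \<le> 1 * (2 * (C * C) * m x)"
      using w m0 by (intro mult_mono) (auto intro: less_imp_le mult_nonneg_nonneg)
    moreover have "\<bar>F n x\<bar> = w x * (2 * \<bar>Re (cnj (d n x) * \<kappa> n x)\<bar> * m x)"
      using \<sigma> w(1)[of x] m0[of x] by (auto simp: F_def abs_mult)
    ultimately show ?thesis by simp
  qed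
  have Fm [measurable]: "F n \<in> borel_measurable borel" for n
  proof -
    have [measurable]: "(\<lambda>x. cnj (d n x)) \<in> borel_measurable borel"
      by (rule borel_measurable_continuous_on[OF _ dm]) (intro continuous_intros)
    show ?thesis unfolding F_def[abs_def] by measurable
  qed
  have Fi: "integrable lborel (F n)" for n
    by (rule Bochner_Integration.integrable_bound[where f = "\<lambda>x. 2 * (C * C) * m x"])
      (use mi in simp, measurable, use Fdom in \<open>auto intro: order_trans[OF _ abs_ge_self]\<close>)
  have Edom: "\<bar>E n x\<bar> \<le> 2 * (C * C) * m x" for n x
  proof -
    have "(cmod (\<kappa> n x))\<^sup>2 \<le> C * C" using power_mono[OF \<kappa>(3) norm_ge_zero, of n x 2] by (simp add: power2_eq_square)
    then have "w x * (2 * ((cmod (\<kappa> n x))\<^sup>2 * m x)) \<le> 1 * (2 * ((C * C) * m x))"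
      using w m0 by (intro mult_mono) (auto intro: less_imp_le mult_nonneg_nonneg)
    moreover have "0 \<le> E n x" unfolding E_def using w m0 by (intro mult_nonneg_nonneg) (auto intro: less_imp_le)
    ultimately show ?thesis by (simp add: E_def)
  qed
  have Em [measurable]: "E n \<in> borel_measurable borel" for n unfolding E_def[abs_def] by measurable
  have Ei: "integrable lborel (E n)" for n
    by (rule Bochner_Integration.integrable_bound[where f = "\<lambda>x. 2 * (C * C) * m x"])
      (use mi in simp, measurable, use Edom in \<open>auto intro: order_trans[OF _ abs_ge_self]\<close>)
  have EF: "(\<integral>x. E n x \<partial>lborel) \<le> (\<integral>x. F n x \<partial>lborel)" for n
  proof -
    define H where "H x = (\<Sum>i\<in>UNIV. 2 * (w x * (S n i x \<bullet> W n i x)) + (\<sigma> * dq x * w x) * (norm (W n i x))\<^sup>2)" for x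
    have Hi: "integrable lborel H" unfolding H_def[abs_def]
      by (intro Bochner_Integration.integrable_sum Bochner_Integration.integrable_add integrable_mult_right wL dqL S W)
    have "(\<integral>x. H x \<partial>lborel) = (\<Sum>i\<in>UNIV. 2 * (\<integral>x. w x * (S n i x \<bullet> W n i x) \<partial>lborel) + (\<integral>x. (\<sigma> * dq x * w x) * (norm (W n i x))\<^sup>2 \<partial>lborel))"
      unfolding H_def
      by (subst Bochner_Integration.integral_sum) (intro Bochner_Integration.integrable_add integrable_mult_right wL dqL S W,
          intro sum.cong refl, subst Bochner_Integration.integral_add,
          intro integrable_mult_right wL S W, intro dqL W, simp only: integral_mult_right_zero)
    then have H0: "(\<integral>x. H x \<partial>lborel) = 0" unfolding energy by simp
    have ss: "\<sigma> * \<sigma> = 1" using \<sigma> by auto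
    have "E n x \<le> \<sigma> * H x + F n x" for x
    proof -
      let ?r = "(cmod (\<kappa> n x))\<^sup>2"
      have SW: "S n i x \<bullet> W n i x = \<sigma> * (?r * (N i x \<bullet> V i x)) + Re (cnj (d n x) * \<kappa> n x) * (cmod (V i x))\<^sup>2" for i
        unfolding S_def W_def cmod_power2
        by (simp add: inner_complex_def power2_eq_square algebra_simps)
      have WW: "(norm (W n i x))\<^sup>2 = ?r * (cmod (V i x))\<^sup>2" for i
        by (simp add: W_def norm_mult power_mult_distrib)
      have "H x = w x * (\<sigma> * (?r * (2 * (\<Sum>i\<in>UNIV. N i x \<bullet> V i x) + dq x * m x)) + 2 * Re (cnj (d n x) * \<kappa> n x) * m x)"
        unfolding H_def SW WW m_def by (simp add: sum_3 algebra_simps)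
      then have "\<sigma> * H x = w x * ((\<sigma> * \<sigma>) * (?r * (2 * (\<Sum>i\<in>UNIV. N i x \<bullet> V i x) + dq x * m x))) + w x * (2 * \<sigma> * Re (cnj (d n x) * \<kappa> n x) * m x)"
        by (simp add: algebra_simps)
      then have "\<sigma> * H x + F n x = w x * (?r * (2 * (\<Sum>i\<in>UNIV. N i x \<bullet> V i x) + dq x * m x))"
        unfolding F_def ss by (simp add: algebra_simps)
      moreover have "w x * (?r * (2 * m x)) \<le> w x * (?r * (2 * (\<Sum>i\<in>UNIV. N i x \<bullet> V i x) + dq x * m x))"
        using w(1)[of x] by (intro mult_left_mono pointwise) auto
      ultimately show ?thesis unfolding E_def by (simp add: mult.left_commute)
    qed
    then have "(\<integral>x. E n x \<partial>lborel) \<le> (\<integral>x. \<sigma> * H x + F n x \<partial>lborel)"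
      by (intro integral_mono Ei Bochner_Integration.integrable_add integrable_mult_right Hi Fi)
    also have "\<dots> = \<sigma> * (\<integral>x. H x \<partial>lborel) + (\<integral>x. F n x \<partial>lborel)"
      by (subst Bochner_Integration.integral_add) (intro integrable_mult_right Hi, rule Fi, simp only: integral_mult_right_zero)
    finally show ?thesis using H0 by simp
  qed
  have Flim: "(\<lambda>n. \<integral>x. F n x \<partial>lborel) \<longlonglongrightarrow> integral\<^sup>L lborel (\<lambda>x::real^3. 0::real)"
  proof (rule integral_dominated_convergence[where w = "\<lambda>x. 2 * (C * C) * m x"])
    show "AE x in lborel. (\<lambda>n. F n x) \<longlonglongrightarrow> 0"
    proof (rule AE_I2)
      fix x
      have "(\<lambda>n. w x * (- 2 * \<sigma> * Re (cnj (d n x) * \<kappa> n x) * m x)) \<longlonglongrightarrow> w x * (- 2 * \<sigma> * Re (cnj 0 * 1) * m x)"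
        by (intro tendsto_intros d0 \<kappa>(4))
      then show "(\<lambda>n. F n x) \<longlonglongrightarrow> 0" by (simp add: F_def)
    qed
  qed (use mi Fdom in auto)
  have Elim: "(\<lambda>n. \<integral>x. E n x \<partial>lborel) \<longlonglongrightarrow> (\<integral>x. w x * (2 * m x) \<partial>lborel)"
  proof (rule integral_dominated_convergence[where w = "\<lambda>x. 2 * (C * C) * m x"])
    show "AE x in lborel. (\<lambda>n. E n x) \<longlonglongrightarrow> w x * (2 * m x)"
    proof (rule AE_I2)
      fix x
      have "(\<lambda>n. w x * (2 * ((cmod (\<kappa> n x))\<^sup>2 * m x))) \<longlonglongrightarrow> w x * (2 * ((cmod 1)\<^sup>2 * m x))"
        by (intro tendsto_intros \<kappa>(4))
      then show "(\<lambda>n. E n x) \<longlonglongrightarrow> w x * (2 * m x)" by (simp add: E_def)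
    qed
  qed (use mi Edom in auto)
  have "(\<integral>x. w x * (2 * m x) \<partial>lborel) \<le> integral\<^sup>L lborel (\<lambda>x::real^3. 0::real)"
    by (rule LIMSEQ_le[OF Elim Flim]) (use EF in blast)
  moreover have nn: "AE x in lborel. 0 \<le> w x * (2 * m x)"
    using w m0 by (intro AE_I2 mult_nonneg_nonneg) (auto intro: less_imp_le)
  moreover have wi: "integrable lborel (\<lambda>x. w x * (2 * m x))"
  proof (rule Bochner_Integration.integrable_bound[where f = "\<lambda>x. 2 * m x"])
    show "AE x in lborel. norm (w x * (2 * m x)) \<le> norm (2 * m x)"
      using w m0 by (intro AE_I2) (simp add: abs_mult mult_left_le_one_le less_imp_le)
  qed (use mi in auto)
  ultimately have "(\<integral>x. w x * (2 * m x) \<partial>lborel) = 0"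
    using integral_nonneg_AE[OF nn] by simp
  then have "AE x in lborel. w x * (2 * m x) = 0"
    using integral_nonneg_eq_0_iff_AE[OF wi nn] by simp
  then show ?thesis
  proof eventually_elim
    case (elim x)
    then have "m x = 0" using w(1)[of x] by simp
    then show ?case unfolding m_def by (subst (asm) sum_nonneg_eq_0_iff) auto
  qed
qed

section \<open>The operator on the Fourier side\<close>

lemma L2_vec_component:
  fixes u :: "real^3 \<Rightarrow> complex^3"
  assumes "u \<in> L2" shows "(\<lambda>x. u x $ i) \<in> L2"
proof (rule L2_dominated[OF assms, where C = 1])
  show "(\<lambda>x. u x $ i) \<in> borel_measurable lborel"
    by (rule borel_measurable_continuous_on[OF _ L2_D(1)[OF assms]]) (intro continuous_intros)
qed (simp add: Finite_Cartesian_Product.norm_nth_le)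

lemma vec_eq_sum_axis: "u = (\<Sum>i\<in>UNIV. axis i (u $ i))" for u :: "complex^3"
  by (simp add: vec_eq_iff axis_def sum.delta)

lemma L2_vecI:
  fixes u :: "real^3 \<Rightarrow> complex^3"
  assumes "\<And>i. (\<lambda>x. u x $ i) \<in> L2" shows "u \<in> L2"
proof -
  have "(\<lambda>x. axis i (u x $ i) :: complex^3) \<in> L2" for i
  proof (rule L2_dominated[OF assms[of i], where C = 1])
    have "linear (axis i :: complex \<Rightarrow> complex^3)"
      by (rule linearI) (auto simp: vec_eq_iff axis_def)
    then have "continuous_on UNIV (axis i :: complex \<Rightarrow> complex^3)"
      by (intro linear_continuous_on linear_conv_bounded_linear[THEN iffD1])
    then show "(\<lambda>x. axis i (u x $ i) :: complex^3) \<in> borel_measurable lborel"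
      by (rule borel_measurable_continuous_on[OF _ L2_D(1)[OF assms]])
  qed (simp add: norm_vec_def L2_set_def axis_def if_distrib[of norm] if_distrib[of "\<lambda>a. a\<^sup>2"] sum.delta cong: if_cong)
  then have "(\<lambda>x. \<Sum>i\<in>UNIV. axis i (u x $ i)) \<in> L2" by (intro L2_sum)
  then show ?thesis by (simp add: vec_eq_sum_axis[symmetric])
qed

definition riesz_symbol :: "3 \<Rightarrow> 3 \<Rightarrow> real^3 \<Rightarrow> complex" where
  "riesz_symbol j k \<xi> = complex_of_real (\<xi> $ j * \<xi> $ k / (norm \<xi>)\<^sup>2)"

lemma riesz_symbol_measurable [measurable]: "riesz_symbol j k \<in> borel_measurable borel"
  unfolding riesz_symbol_def[abs_def] by measurable

lemma riesz_symbol_le_1: "cmod (riesz_symbol j k \<xi>) \<le> 1"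
proof -
  have "\<bar>\<xi> $ j\<bar> * \<bar>\<xi> $ k\<bar> \<le> norm \<xi> * norm \<xi>"
    by (intro mult_mono component_le_norm_cart) auto
  then show ?thesis
    unfolding riesz_symbol_def norm_of_real abs_divide abs_mult
    by (simp add: divide_le_eq power2_eq_square)
qed

lemma riesz_symbol_even: "riesz_symbol j k (- \<xi>) = riesz_symbol j k \<xi>"
  by (simp add: riesz_symbol_def)

lemma riesz2_fourier: "is_fourier u U \<Longrightarrow> is_fourier (riesz2 j k u) (\<lambda>\<xi>. riesz_symbol j k \<xi> * U \<xi>)"
  using multiplier_fourier[OF riesz_symbol_measurable riesz_symbol_le_1]
  by (simp add: riesz2_def riesz_symbol_def[abs_def])

definition order0_symbol :: "real \<Rightarrow> 3 \<Rightarrow> 3 \<Rightarrow> real^3 \<Rightarrow> complex" where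
  "order0_symbol f i k \<xi> = (let a = complex_of_real f; b = complex_of_real (2 - f); r = (\<lambda>i k. riesz_symbol i k \<xi>) in
     (vector [vector [a * r 1 2, (a - 1) + b * r 1 1, 0],
              vector [- a + a * r 2 2, b * r 1 2, 0],
              vector [a * r 2 3, b * r 1 3, 0]] :: complex^3^3) $ i $ k)"

lemma order0_symbol_simps:
  "order0_symbol f 1 1 \<xi> = complex_of_real f * riesz_symbol 1 2 \<xi>"
  "order0_symbol f 1 2 \<xi> = (complex_of_real f - 1) + complex_of_real (2 - f) * riesz_symbol 1 1 \<xi>"
  "order0_symbol f 1 3 \<xi> = 0"
  "order0_symbol f 2 1 \<xi> = - complex_of_real f + complex_of_real f * riesz_symbol 2 2 \<xi>"
  "order0_symbol f 2 2 \<xi> = complex_of_real (2 - f) * riesz_symbol 1 2 \<xi>"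
  "order0_symbol f 2 3 \<xi> = 0"
  "order0_symbol f 3 1 \<xi> = complex_of_real f * riesz_symbol 2 3 \<xi>"
  "order0_symbol f 3 2 \<xi> = complex_of_real (2 - f) * riesz_symbol 1 3 \<xi>"
  "order0_symbol f 3 3 \<xi> = 0"
  by (simp_all add: order0_symbol_def Let_def vector_3)

lemma order0_symbol_measurable [measurable]: "order0_symbol f i k \<in> borel_measurable borel"
proof -
  have "\<forall>i k. order0_symbol f i k \<in> borel_measurable borel"
    unfolding forall_3 order0_symbol_simps[abs_def] by (intro conjI; measurable)
  then show ?thesis by blast
qed

lemma order0_symbol_bounded: "cmod (order0_symbol f i k \<xi>) \<le> 2 * \<bar>f\<bar> + \<bar>2 - f\<bar> + 1"
proof -
  have r: "cmod (complex_of_real c * riesz_symbol i k \<xi>) \<le> \<bar>c\<bar>" for c i k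
    using riesz_symbol_le_1[of i k \<xi>] by (simp add: norm_mult mult_left_le)
  have "cmod ((complex_of_real f - 1) + complex_of_real (2 - f) * riesz_symbol 1 1 \<xi>) \<le> (\<bar>f\<bar> + 1) + \<bar>2 - f\<bar>"
    using norm_triangle_ineq4[of "complex_of_real f" 1]
    by (intro order_trans[OF norm_triangle_ineq] add_mono r) simp
  moreover have "cmod (- complex_of_real f + complex_of_real f * riesz_symbol 2 2 \<xi>) \<le> \<bar>f\<bar> + \<bar>f\<bar>"
    by (intro order_trans[OF norm_triangle_ineq] add_mono r) simp
  ultimately have "\<forall>i k. cmod (order0_symbol f i k \<xi>) \<le> 2 * \<bar>f\<bar> + \<bar>2 - f\<bar> + 1"
    unfolding forall_3 order0_symbol_simps
    using r[of f 1 2] r[of "2 - f" 1 2] r[of f 2 3] r[of "2 - f" 1 3]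
    by (intro conjI; (linarith | simp add: add_nonneg_nonneg))
  then show ?thesis by blast
qed

lemma order0_symbol_even: "order0_symbol f i k (- \<xi>) = order0_symbol f i k \<xi>"
  unfolding order0_symbol_def riesz_symbol_even ..

text \<open>What remains of the operator without its two differential terms. At viscosity zero the Laplacian
  is absent, so that only the shear term has to be added back.\<close>

definition order0_part :: "real \<Rightarrow> (real^3 \<Rightarrow> complex^3) \<Rightarrow> 3 \<Rightarrow> real^3 \<Rightarrow> complex" where
  "order0_part f u i x = Lop f 0 u x $ i + weak_shear (\<lambda>x. u x $ i) x"

lemma Lop_component:
  "Lop f \<nu> u x $ i = complex_of_real \<nu> * weak_laplacian (\<lambda>x. u x $ i) x - weak_shear (\<lambda>x. u x $ i) x + order0_part f u i x"
proof -
  have "\<forall>i. Lop f \<nu> u x $ i = complex_of_real \<nu> * weak_laplacian (\<lambda>x. u x $ i) x - weak_shear (\<lambda>x. u x $ i) x + order0_part f u i x"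
    unfolding forall_3 order0_part_def
    by (simp add: Lop_def Let_def vector_3 advection_diffusion_def)
  then show ?thesis by blast
qed

lemma order0_part_fourier:
  assumes U: "\<And>k. is_fourier (\<lambda>x. u x $ k) (U k)"
  shows "is_fourier (order0_part f u i) (\<lambda>\<xi>. \<Sum>k\<in>UNIV. order0_symbol f i k \<xi> * U k \<xi>)"
proof -
  let ?a = "complex_of_real f" and ?b = "complex_of_real (2 - f)"
  let ?u = "\<lambda>k x. u x $ k"
  note R = riesz2_fourier[OF U]
  have 1: "order0_part f u 1 = (\<lambda>x. ?a * riesz2 1 2 (?u 1) x + ((?a - 1) * ?u 2 x + ?b * riesz2 1 1 (?u 2) x))"
    by (auto simp: order0_part_def Lop_def Let_def vector_3 advection_diffusion_def)
  have 2: "order0_part f u 2 = (\<lambda>x. (- ?a * ?u 1 x + ?a * riesz2 2 2 (?u 1) x) + ?b * riesz2 1 2 (?u 2) x)"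
    by (auto simp: order0_part_def Lop_def Let_def vector_3 advection_diffusion_def)
  have 3: "order0_part f u 3 = (\<lambda>x. ?a * riesz2 2 3 (?u 1) x + ?b * riesz2 1 3 (?u 2) x)"
    by (auto simp: order0_part_def Lop_def Let_def vector_3 advection_diffusion_def)
  have "is_fourier (order0_part f u 1) (\<lambda>\<xi>. ?a * (riesz_symbol 1 2 \<xi> * U 1 \<xi>) + ((?a - 1) * U 2 \<xi> + ?b * (riesz_symbol 1 1 \<xi> * U 2 \<xi>)))"
    unfolding 1 by (intro fourier_add fourier_cmult R U)
  moreover have "is_fourier (order0_part f u 2) (\<lambda>\<xi>. (- ?a * U 1 \<xi> + ?a * (riesz_symbol 2 2 \<xi> * U 1 \<xi>)) + ?b * (riesz_symbol 1 2 \<xi> * U 2 \<xi>))"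
    unfolding 2 by (intro fourier_add fourier_cmult R U)
  moreover have "is_fourier (order0_part f u 3) (\<lambda>\<xi>. ?a * (riesz_symbol 2 3 \<xi> * U 1 \<xi>) + ?b * (riesz_symbol 1 3 \<xi> * U 2 \<xi>))"
    unfolding 3 by (intro fourier_add fourier_cmult R U)
  ultimately have "\<forall>i. is_fourier (order0_part f u i) (\<lambda>\<xi>. \<Sum>k\<in>UNIV. order0_symbol f i k \<xi> * U k \<xi>)"
    unfolding forall_3 sum_3 order0_symbol_simps by (simp add: algebra_simps)
  then show ?thesis by blast
qed

lemma Ldom_D:
  assumes "u \<in> Ldom"
  shows "(\<lambda>x. u x $ i) \<in> L2" "is_weak_laplacian (\<lambda>x. u x $ i) (weak_laplacian (\<lambda>x. u x $ i))"
    "is_weak_shear (\<lambda>x. u x $ i) (weak_shear (\<lambda>x. u x $ i))"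
proof -
  have u: "u \<in> L2" "\<exists>g. is_weak_laplacian (\<lambda>x. u x $ i) g" "\<exists>g. is_weak_shear (\<lambda>x. u x $ i) g"
    using assms by (auto simp: Ldom_def)
  show "(\<lambda>x. u x $ i) \<in> L2" by (rule L2_vec_component[OF u(1)])
  show "is_weak_laplacian (\<lambda>x. u x $ i) (weak_laplacian (\<lambda>x. u x $ i))"
    unfolding weak_laplacian_def by (rule someI_ex[OF u(2)])
  show "is_weak_shear (\<lambda>x. u x $ i) (weak_shear (\<lambda>x. u x $ i))"
    unfolding weak_shear_def by (rule someI_ex[OF u(3)])
qed

lemma shifted_component:
  "shifted \<mu> (Lop f \<nu>) u x $ i = \<mu> * u x $ i - complex_of_real \<nu> * weak_laplacian (\<lambda>x. u x $ i) x
    + weak_shear (\<lambda>x. u x $ i) x - order0_part f u i x"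
  by (simp add: shifted_def Lop_component)

text \<open>The symbol of \<open>\<mu> - \<L>\<close> up to the transport term \<open>- \<xi>\<^sub>1 \<partial>\<^sub>2\<close>.\<close>

definition resolvent_symbol :: "complex \<Rightarrow> real \<Rightarrow> real \<Rightarrow> (3 \<Rightarrow> real^3 \<Rightarrow> complex) \<Rightarrow> 3 \<Rightarrow> real^3 \<Rightarrow> complex" where
  "resolvent_symbol \<mu> \<nu> f U i \<xi> =
    (\<mu> + complex_of_real (\<nu> * (norm \<xi>)\<^sup>2)) * U i \<xi> - (\<Sum>k\<in>UNIV. order0_symbol f i k \<xi> * U k \<xi>)"

lemma integrable_norm_power2_pairing:
  assumes "u \<in> L2" "\<psi> \<in> test_functions"
  shows "integrable lborel (\<lambda>\<xi>. u \<xi> * (complex_of_real ((norm \<xi>)\<^sup>2) * \<psi> \<xi>))"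
  by (intro integrable_mult_L2 assms test_L2 test_norm_power2_mult)

lemma test_shear_derivative:
  "\<psi> \<in> test_functions \<Longrightarrow> (\<lambda>\<xi>. complex_of_real (\<xi> $ 1) * partial_deriv 2 \<psi> \<xi>) \<in> test_functions"
  using test_coord_mult[OF test_partial, of \<psi> 1 1 2] by simp

text \<open>Testing with Fourier transforms of test functions moves the operator to the Fourier side.\<close>

lemma shifted_weak_form:
  assumes u: "u \<in> Ldom" and U: "\<And>i. is_fourier (\<lambda>x. u x $ i) (U i)" and \<psi>: "\<psi> \<in> test_functions"
  shows "(\<integral>x. shifted \<mu> (Lop f \<nu>) u x $ i * FT \<psi> x \<partial>lborel)
    = (\<integral>\<xi>. resolvent_symbol \<mu> \<nu> f U i \<xi> * \<psi> \<xi> \<partial>lborel)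
      + (\<integral>\<xi>. U i \<xi> * (complex_of_real (\<xi> $ 1) * partial_deriv 2 \<psi> \<xi>) \<partial>lborel)"
    (is "?lhs = ?rhs")
proof -
  let ?u = "\<lambda>x. u x $ i"
  let ?Z = "\<lambda>\<xi>. \<Sum>k\<in>UNIV. order0_symbol f i k \<xi> * U k \<xi>"
  note D = Ldom_D[OF u, of i]
  have L: "weak_laplacian ?u \<in> L2" "weak_shear ?u \<in> L2"
    using D by (auto simp: is_weak_laplacian_def is_weak_shear_def)
  note Z = order0_part_fourier[OF U, of f i]
  note F = test_fourier[OF \<psi>]
  note UL = fourier_L2(2)[OF U]
  have "?lhs = (\<integral>x. \<mu> * (?u x * FT \<psi> x) - complex_of_real \<nu> * (weak_laplacian ?u x * FT \<psi> x)
      + weak_shear ?u x * FT \<psi> x - order0_part f u i x * FT \<psi> x \<partial>lborel)"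
    unfolding shifted_component by (simp add: algebra_simps)
  also have "\<dots> = \<mu> * (\<integral>x. ?u x * FT \<psi> x \<partial>lborel) - complex_of_real \<nu> * (\<integral>x. weak_laplacian ?u x * FT \<psi> x \<partial>lborel)
      + (\<integral>x. weak_shear ?u x * FT \<psi> x \<partial>lborel) - (\<integral>x. order0_part f u i x * FT \<psi> x \<partial>lborel)"
    using integrable_mult_L2[OF D(1) F(2)] integrable_mult_L2[OF L(1) F(2)] integrable_mult_L2[OF L(2) F(2)]
      integrable_mult_L2[OF fourier_L2(1)[OF Z] F(2)] by simp
  also have "(\<integral>x. ?u x * FT \<psi> x \<partial>lborel) = (\<integral>\<xi>. U i \<xi> * \<psi> \<xi> \<partial>lborel)"
    by (rule fourier_pairing[OF U F(1), symmetric])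
  also have "(\<integral>x. weak_laplacian ?u x * FT \<psi> x \<partial>lborel) = - (\<integral>\<xi>. U i \<xi> * (complex_of_real ((norm \<xi>)\<^sup>2) * \<psi> \<xi>) \<partial>lborel)"
    unfolding weak_laplacian_FT[OF D(1,2) \<psi>]
    using fourier_pairing[OF U test_fourier(1)[OF test_norm_power2_mult[OF \<psi>]]] by simp
  also have "(\<integral>x. weak_shear ?u x * FT \<psi> x \<partial>lborel) = (\<integral>\<xi>. U i \<xi> * (complex_of_real (\<xi> $ 1) * partial_deriv 2 \<psi> \<xi>) \<partial>lborel)"
    unfolding weak_shear_FT[OF D(1,3) \<psi>]
    using fourier_pairing[OF U test_fourier(1)[OF test_shear_derivative[OF \<psi>]]] by simp
  also have "(\<integral>x. order0_part f u i x * FT \<psi> x \<partial>lborel) = (\<integral>\<xi>. ?Z \<xi> * \<psi> \<xi> \<partial>lborel)"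
    by (rule fourier_pairing[OF Z F(1), symmetric])
  finally have 1: "?lhs = \<mu> * (\<integral>\<xi>. U i \<xi> * \<psi> \<xi> \<partial>lborel) - complex_of_real \<nu> * - (\<integral>\<xi>. U i \<xi> * (complex_of_real ((norm \<xi>)\<^sup>2) * \<psi> \<xi>) \<partial>lborel)
      + (\<integral>\<xi>. U i \<xi> * (complex_of_real (\<xi> $ 1) * partial_deriv 2 \<psi> \<xi>) \<partial>lborel) - (\<integral>\<xi>. ?Z \<xi> * \<psi> \<xi> \<partial>lborel)" .
  have "(\<integral>\<xi>. resolvent_symbol \<mu> \<nu> f U i \<xi> * \<psi> \<xi> \<partial>lborel)
      = (\<integral>\<xi>. \<mu> * (U i \<xi> * \<psi> \<xi>) + complex_of_real \<nu> * (U i \<xi> * (complex_of_real ((norm \<xi>)\<^sup>2) * \<psi> \<xi>)) - ?Z \<xi> * \<psi> \<xi> \<partial>lborel)"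
    unfolding resolvent_symbol_def by (simp add: algebra_simps)
  also have "\<dots> = \<mu> * (\<integral>\<xi>. U i \<xi> * \<psi> \<xi> \<partial>lborel) + complex_of_real \<nu> * (\<integral>\<xi>. U i \<xi> * (complex_of_real ((norm \<xi>)\<^sup>2) * \<psi> \<xi>) \<partial>lborel)
      - (\<integral>\<xi>. ?Z \<xi> * \<psi> \<xi> \<partial>lborel)"
    using integrable_mult_L2[OF UL test_L2[OF \<psi>]] integrable_norm_power2_pairing[OF UL \<psi>]
      integrable_mult_L2[OF fourier_L2(2)[OF Z] test_L2[OF \<psi>]] by simp
  finally show ?thesis using 1 by simp
qed

lemma integrable_resolvent_symbol:
  assumes "\<And>i. U i \<in> L2" "\<psi> \<in> test_functions"
  shows "integrable lborel (\<lambda>\<xi>. resolvent_symbol \<mu> \<nu> f U i \<xi> * \<psi> \<xi>)"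
proof -
  have Z: "(\<lambda>\<xi>. \<Sum>k\<in>UNIV. order0_symbol f i k \<xi> * U k \<xi>) \<in> L2"
    by (intro L2_sum L2_mult_bounded[OF assms(1) order0_symbol_measurable order0_symbol_bounded])
  have "integrable lborel (\<lambda>\<xi>. \<mu> * (U i \<xi> * \<psi> \<xi>) + complex_of_real \<nu> * (U i \<xi> * (complex_of_real ((norm \<xi>)\<^sup>2) * \<psi> \<xi>))
      - (\<Sum>k\<in>UNIV. order0_symbol f i k \<xi> * U k \<xi>) * \<psi> \<xi>)"
    by (intro Bochner_Integration.integrable_diff Bochner_Integration.integrable_add integrable_mult_right
        integrable_mult_L2[OF assms(1) test_L2[OF assms(2)]] integrable_norm_power2_pairing[OF assms]
        integrable_mult_L2[OF Z test_L2[OF assms(2)]])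
  moreover have "\<mu> * (U i \<xi> * \<psi> \<xi>) + complex_of_real \<nu> * (U i \<xi> * (complex_of_real ((norm \<xi>)\<^sup>2) * \<psi> \<xi>))
      - (\<Sum>k\<in>UNIV. order0_symbol f i k \<xi> * U k \<xi>) * \<psi> \<xi> = resolvent_symbol \<mu> \<nu> f U i \<xi> * \<psi> \<xi>" for \<xi>
    unfolding resolvent_symbol_def by (simp add: algebra_simps)
  ultimately show ?thesis by simp
qed

section \<open>Injectivity\<close>

text \<open>The difference of the transforms of two fields with the same image solves the equation with
  \<open>\<sigma> = 1\<close>. Working with this difference avoids proving that the operator, whose terms are chosen
  representatives, is linear.\<close>

lemma shifted_Lop_injective:
  assumes \<nu>: "\<nu> > 0"
  shows "L2_injective Ldom (shifted \<mu> (Lop f \<nu>))"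
  unfolding L2_injective_def
proof (intro ballI impI)
  fix u v assume uv: "u \<in> Ldom" "v \<in> Ldom"
    and ae: "AE x in lborel. shifted \<mu> (Lop f \<nu>) u x = shifted \<mu> (Lop f \<nu>) v x"
  have "\<exists>F. is_fourier (\<lambda>x. u x $ i) F" "\<exists>F. is_fourier (\<lambda>x. v x $ i) F" for i
    using fourier_exists Ldom_D(1) uv by blast+
  then obtain U V where U: "\<And>i. is_fourier (\<lambda>x. u x $ i) (U i)" and V: "\<And>i. is_fourier (\<lambda>x. v x $ i) (V i)"
    by metis
  define W where "W i \<xi> = U i \<xi> - V i \<xi>" for i \<xi>
  note UL = fourier_L2(2)[OF U] and VL = fourier_L2(2)[OF V]
  have WL: "W i \<in> L2" for i unfolding W_def[abs_def] by (intro L2_diff UL VL)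
  have "AE \<xi> in lborel. W i \<xi> = 0" for i
  proof (rule shear_diffusion_uniqueness[OF \<nu> disjI1[OF refl] WL order0_symbol_measurable order0_symbol_bounded])
    fix i \<psi> assume \<psi>: "\<psi> \<in> test_functions"
    have balance: "r = - q" if "a + b = c + d" "q = a - c" "r = b - d" for a b c d q r :: complex
      using that by algebra
    have meas: "(\<lambda>x. shifted \<mu> (Lop f \<nu>) w x $ i * FT \<psi> x) \<in> borel_measurable lborel"
      if w: "w \<in> Ldom" and F: "\<And>i. is_fourier (\<lambda>x. w x $ i) (F i)" for w F
    proof -
      have "(\<lambda>x. shifted \<mu> (Lop f \<nu>) w x $ i) \<in> L2"
        using Ldom_D[OF w, of i] fourier_L2(1)[OF order0_part_fourier[OF F]]
        unfolding shifted_component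
        by (intro L2_diff L2_add L2_cmult) (auto simp: is_weak_laplacian_def is_weak_shear_def)
      then show ?thesis using integrable_mult_L2[OF _ test_fourier(2)[OF \<psi>]] borel_measurable_integrable by blast
    qed
    have "(\<integral>x. shifted \<mu> (Lop f \<nu>) u x $ i * FT \<psi> x \<partial>lborel) = (\<integral>x. shifted \<mu> (Lop f \<nu>) v x $ i * FT \<psi> x \<partial>lborel)"
      by (rule integral_cong_AE[OF meas[OF uv(1) U] meas[OF uv(2) V]]) (use ae in eventually_elim, simp)
    moreover have "(\<integral>\<xi>. resolvent_symbol \<mu> \<nu> f W i \<xi> * \<psi> \<xi> \<partial>lborel)
        = (\<integral>\<xi>. resolvent_symbol \<mu> \<nu> f U i \<xi> * \<psi> \<xi> \<partial>lborel) - (\<integral>\<xi>. resolvent_symbol \<mu> \<nu> f V i \<xi> * \<psi> \<xi> \<partial>lborel)"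
    proof -
      have "resolvent_symbol \<mu> \<nu> f W i \<xi> * \<psi> \<xi> = resolvent_symbol \<mu> \<nu> f U i \<xi> * \<psi> \<xi> - resolvent_symbol \<mu> \<nu> f V i \<xi> * \<psi> \<xi>" for \<xi>
        by (simp add: resolvent_symbol_def W_def algebra_simps sum_subtractf)
      then show ?thesis
        using Bochner_Integration.integral_diff[OF integrable_resolvent_symbol[OF UL \<psi>] integrable_resolvent_symbol[OF VL \<psi>]]
        by (simp only:)
    qed
    moreover have "(\<integral>\<xi>. W i \<xi> * (complex_of_real (\<xi> $ 1) * partial_deriv 2 \<psi> \<xi>) \<partial>lborel)
        = (\<integral>\<xi>. U i \<xi> * (complex_of_real (\<xi> $ 1) * partial_deriv 2 \<psi> \<xi>) \<partial>lborel)
          - (\<integral>\<xi>. V i \<xi> * (complex_of_real (\<xi> $ 1) * partial_deriv 2 \<psi> \<xi>) \<partial>lborel)"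
      unfolding W_def left_diff_distrib
      by (intro Bochner_Integration.integral_diff integrable_mult_L2 UL VL test_L2 test_shear_derivative \<psi>)
    ultimately have "(\<integral>\<xi>. W i \<xi> * (complex_of_real (\<xi> $ 1) * partial_deriv 2 \<psi> \<xi>) \<partial>lborel)
        = - (\<integral>\<xi>. resolvent_symbol \<mu> \<nu> f W i \<xi> * \<psi> \<xi> \<partial>lborel)"
      unfolding shifted_weak_form[OF uv(1) U \<psi>] shifted_weak_form[OF uv(2) V \<psi>] by (rule balance)
    then show "(\<integral>\<xi>. W i \<xi> * (complex_of_real (\<xi> $ 1) * partial_deriv 2 \<psi> \<xi>) \<partial>lborel) = - complex_of_real 1 *
        (\<integral>\<xi>. ((\<mu> + complex_of_real (\<nu> * (norm \<xi>)\<^sup>2)) * W i \<xi> - (\<Sum>k\<in>UNIV. order0_symbol f i k \<xi> * W k \<xi>)) * \<psi> \<xi> \<partial>lborel)"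
      unfolding resolvent_symbol_def by simp
  qed
  then have "AE x in lborel. u x $ i = v x $ i" for i
    by (intro fourier_inj[OF U V]) (auto simp: W_def)
  then have "AE x in lborel. \<forall>i\<in>UNIV. u x $ i = v x $ i" by (intro AE_finite_allI) auto
  then show "AE x in lborel. u x = v x" by eventually_elim (simp add: vec_eq_iff)
qed

section \<open>Density of the range\<close>

lemma smooth_weak_laplacian:
  assumes u: "smooth u" and L: "laplacian u \<in> L2"
  shows "is_weak_laplacian u (laplacian u)"
  unfolding is_weak_laplacian_def
proof (intro conjI L ballI)
  fix \<phi> assume \<phi>: "\<phi> \<in> test_functions"
  have i: "integrable lborel (\<lambda>x. partial_deriv j (partial_deriv j u) x * \<phi> x)"
    "integrable lborel (\<lambda>x. u x * partial_deriv j (partial_deriv j \<phi>) x)" for j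
    by (intro test_integrable test_mult_smooth smooth_partial test_partial u \<phi>)+
  have "(\<integral>x. laplacian u x * \<phi> x \<partial>lborel) = (\<Sum>j\<in>UNIV. \<integral>x. partial_deriv j (partial_deriv j u) x * \<phi> x \<partial>lborel)"
    unfolding laplacian_def sum_distrib_right by (intro Bochner_Integration.integral_sum i)
  also have "\<dots> = (\<Sum>j\<in>UNIV. \<integral>x. u x * partial_deriv j (partial_deriv j \<phi>) x \<partial>lborel)"
    using integral_by_parts[OF \<phi> smooth_partial[OF u]] integral_by_parts[OF test_partial[OF \<phi>] u] by simp
  also have "\<dots> = (\<integral>x. u x * laplacian \<phi> x \<partial>lborel)"
    unfolding laplacian_def sum_distrib_left by (intro Bochner_Integration.integral_sum[symmetric] i)
  finally show "(\<integral>x. laplacian u x * \<phi> x \<partial>lborel) = (\<integral>x. u x * laplacian \<phi> x \<partial>lborel)" .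
qed

lemma smooth_weak_shear:
  assumes u: "smooth u" and L: "(\<lambda>x. complex_of_real (x $ 2) * partial_deriv 1 u x) \<in> L2"
  shows "is_weak_shear u (\<lambda>x. complex_of_real (x $ 2) * partial_deriv 1 u x)"
  unfolding is_weak_shear_def
proof (intro conjI L ballI)
  fix \<phi> assume \<phi>: "\<phi> \<in> test_functions"
  have "(\<integral>x. (complex_of_real (x $ 2) * u x) * partial_deriv 1 \<phi> x \<partial>lborel)
      = - (\<integral>x. partial_deriv 1 (\<lambda>x. complex_of_real (x $ 2) * u x) x * \<phi> x \<partial>lborel)"
    by (rule integral_by_parts[OF \<phi> smooth_mult[OF smooth_coord u]])
  then show "(\<integral>x. complex_of_real (x $ 2) * partial_deriv 1 u x * \<phi> x \<partial>lborel)
      = - (\<integral>x. u x * (complex_of_real (x $ 2) * partial_deriv 1 \<phi> x) \<partial>lborel)"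
    unfolding partial_deriv_mult[OF smooth_coord u] partial_deriv_coord by (simp add: mult_ac)
qed

lemma weak_laplacian_unique:
  assumes "is_weak_laplacian u g" "is_weak_laplacian u h"
  shows "AE x in lborel. g x = h x"
  using assms by (intro test_functions_separate_eq) (auto simp: is_weak_laplacian_def)

lemma weak_shear_unique:
  assumes "is_weak_shear u g" "is_weak_shear u h"
  shows "AE x in lborel. g x = h x"
  using assms by (intro test_functions_separate_eq) (auto simp: is_weak_shear_def)

lemma FT_weak_derivatives:
  assumes \<psi>: "\<psi> \<in> test_functions"
  shows "is_weak_laplacian (FT \<psi>) (\<lambda>x. - FT (\<lambda>\<xi>. complex_of_real ((norm \<xi>)\<^sup>2) * \<psi> \<xi>) x)"
    "is_weak_shear (FT \<psi>) (\<lambda>x. - FT (\<lambda>\<xi>. complex_of_real (\<xi> $ 1) * partial_deriv 2 \<psi> \<xi>) x)"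
proof -
  have "laplacian (FT \<psi>) = (\<lambda>x. - FT (\<lambda>\<xi>. complex_of_real ((norm \<xi>)\<^sup>2) * \<psi> \<xi>) x)"
    by (rule ext) (rule laplacian_FT[OF \<psi>])
  then show "is_weak_laplacian (FT \<psi>) (\<lambda>x. - FT (\<lambda>\<xi>. complex_of_real ((norm \<xi>)\<^sup>2) * \<psi> \<xi>) x)"
    using smooth_weak_laplacian[OF smooth_FT[OF \<psi>]] L2_minus[OF test_fourier(2)[OF test_norm_power2_mult[OF \<psi>]]] by simp
  have "(\<lambda>x. complex_of_real (x $ 2) * partial_deriv 1 (FT \<psi>) x) = (\<lambda>x. - FT (\<lambda>\<xi>. complex_of_real (\<xi> $ 1) * partial_deriv 2 \<psi> \<xi>) x)"
    by (rule ext) (rule shear_FT[OF \<psi>])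
  then show "is_weak_shear (FT \<psi>) (\<lambda>x. - FT (\<lambda>\<xi>. complex_of_real (\<xi> $ 1) * partial_deriv 2 \<psi> \<xi>) x)"
    using smooth_weak_shear[OF smooth_FT[OF \<psi>]] L2_minus[OF test_fourier(2)[OF test_shear_derivative[OF \<psi>]]] by simp
qed

text \<open>The image of the field \<open>(FT \<psi>\<^sub>i)\<^sub>i\<close> under \<open>\<mu> - \<L>\<close> is the Fourier transform of this field.\<close>

definition resolvent_image :: "complex \<Rightarrow> real \<Rightarrow> real \<Rightarrow> (3 \<Rightarrow> real^3 \<Rightarrow> complex) \<Rightarrow> 3 \<Rightarrow> real^3 \<Rightarrow> complex" where
  "resolvent_image \<mu> \<nu> f \<psi> i \<xi> = resolvent_symbol \<mu> \<nu> f \<psi> i \<xi> - complex_of_real (\<xi> $ 1) * partial_deriv 2 (\<psi> i) \<xi>"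

lemma resolvent_image_L2:
  assumes \<psi>: "\<And>i. \<psi> i \<in> test_functions"
  shows "resolvent_image \<mu> \<nu> f \<psi> i \<in> L2"
proof -
  have "(\<lambda>\<xi>. (\<mu> * \<psi> i \<xi> + complex_of_real \<nu> * (complex_of_real ((norm \<xi>)\<^sup>2) * \<psi> i \<xi>))
      - (\<Sum>k\<in>UNIV. order0_symbol f i k \<xi> * \<psi> k \<xi>) - complex_of_real (\<xi> $ 1) * partial_deriv 2 (\<psi> i) \<xi>) \<in> L2"
    by (intro L2_diff L2_add L2_sum L2_mult_bounded[OF _ order0_symbol_measurable order0_symbol_bounded]
        test_L2 test_cmult test_norm_power2_mult test_shear_derivative \<psi>)
  then show ?thesis
    by (simp add: resolvent_image_def[abs_def] resolvent_symbol_def algebra_simps)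
qed

text \<open>Both sides are compared after one more transform, which by inversion turns transforms of test
  functions into reflected test functions; the symbol of order zero is even and so commutes with the
  reflection.\<close>

lemma resolvent_image_in_range:
  assumes \<psi>: "\<And>i. \<psi> i \<in> test_functions" and h: "h \<in> L2"
    and F: "\<And>i. is_fourier (resolvent_image \<mu> \<nu> f \<psi> i) (\<lambda>x. h x $ i)"
  shows "h \<in> L2_range Ldom (shifted \<mu> (Lop f \<nu>))"
proof -
  let ?c = "complex_of_real plancherel_const"
  define u :: "real^3 \<Rightarrow> complex^3" where "u x = (\<chi> i. FT (\<psi> i) x)" for x
  have ui: "(\<lambda>x. u x $ i) = FT (\<psi> i)" for i by (simp add: u_def)
  have uD: "u \<in> Ldom"
    unfolding Ldom_def mem_Collect_eq
  proof (intro conjI allI)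
    show "u \<in> L2" by (rule L2_vecI) (simp add: ui test_fourier(2)[OF \<psi>])
  qed (use FT_weak_derivatives[OF \<psi>] ui in auto)
  note D = Ldom_D[OF uD, unfolded ui]
  have U: "is_fourier (\<lambda>x. u x $ i) (\<lambda>\<xi>. ?c * \<psi> i (- \<xi>))" for i
    unfolding ui by (rule fourier_inversion[OF test_fourier(1)[OF \<psi>]])
  have "AE x in lborel. shifted \<mu> (Lop f \<nu>) u x $ i = h x $ i" for i
  proof -
    define G where "G x = \<mu> * FT (\<psi> i) x - complex_of_real \<nu> * ((-1) * FT (\<lambda>\<xi>. complex_of_real ((norm \<xi>)\<^sup>2) * \<psi> i \<xi>) x)
      + (-1) * FT (\<lambda>\<xi>. complex_of_real (\<xi> $ 1) * partial_deriv 2 (\<psi> i) \<xi>) x - order0_part f u i x" for x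
    have ae: "AE x in lborel. shifted \<mu> (Lop f \<nu>) u x $ i = G x"
      using weak_laplacian_unique[OF D(2) FT_weak_derivatives(1)[OF \<psi>], of i]
        weak_shear_unique[OF D(3) FT_weak_derivatives(2)[OF \<psi>], of i]
      by eventually_elim (simp add: shifted_component ui G_def, simp add: u_def)
    have G: "is_fourier G (\<lambda>\<xi>. \<mu> * (?c * \<psi> i (- \<xi>)) - complex_of_real \<nu> * ((-1) * (?c * (complex_of_real ((norm (- \<xi>))\<^sup>2) * \<psi> i (- \<xi>))))
      + (-1) * (?c * (complex_of_real ((- \<xi>) $ 1) * partial_deriv 2 (\<psi> i) (- \<xi>)))
      - (\<Sum>k\<in>UNIV. order0_symbol f i k \<xi> * (?c * \<psi> k (- \<xi>))))"
      unfolding G_def[abs_def]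
      by (intro fourier_diff fourier_add fourier_cmult order0_part_fourier[OF U]
          fourier_inversion[OF test_fourier(1)] \<psi> test_norm_power2_mult test_shear_derivative)
    have "is_fourier (\<lambda>x. h x $ i) (\<lambda>\<xi>. ?c * resolvent_image \<mu> \<nu> f \<psi> i (- \<xi>))"
      by (rule fourier_inversion[OF F])
    then have "AE x in lborel. G x = h x $ i"
    proof (rule fourier_inj[OF G])
      show "AE \<xi> in lborel. \<mu> * (?c * \<psi> i (- \<xi>)) - complex_of_real \<nu> * ((-1) * (?c * (complex_of_real ((norm (- \<xi>))\<^sup>2) * \<psi> i (- \<xi>))))
      + (-1) * (?c * (complex_of_real ((- \<xi>) $ 1) * partial_deriv 2 (\<psi> i) (- \<xi>)))
      - (\<Sum>k\<in>UNIV. order0_symbol f i k \<xi> * (?c * \<psi> k (- \<xi>))) = ?c * resolvent_image \<mu> \<nu> f \<psi> i (- \<xi>)"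
        by (intro AE_I2)
          (simp add: resolvent_image_def resolvent_symbol_def order0_symbol_even algebra_simps sum_distrib_left)
    qed
    with ae show ?thesis by eventually_elim simp
  qed
  then have "AE x in lborel. \<forall>i\<in>UNIV. shifted \<mu> (Lop f \<nu>) u x $ i = h x $ i" by (intro AE_finite_allI) auto
  then have "AE x in lborel. shifted \<mu> (Lop f \<nu>) u x = h x" by eventually_elim (simp add: vec_eq_iff)
  then show ?thesis using uD h by (auto simp: L2_range_def)
qed

text \<open>The images of the fields whose components are transforms of test functions. Described on the
  Fourier side this is visibly a complex subspace, and it is enough to show that it is dense.\<close>

definition explicit_range :: "complex \<Rightarrow> real \<Rightarrow> real \<Rightarrow> (real^3 \<Rightarrow> complex^3) set" where
  "explicit_range \<mu> \<nu> f = {h \<in> L2. \<exists>\<psi>. (\<forall>i. \<psi> i \<in> test_functions) \<and>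
     (\<forall>i. is_fourier (resolvent_image \<mu> \<nu> f \<psi> i) (\<lambda>x. h x $ i))}"

lemma resolvent_image_add:
  assumes "\<And>i. \<psi> i \<in> test_functions" "\<And>i. \<phi> i \<in> test_functions"
  shows "resolvent_image \<mu> \<nu> f (\<lambda>i \<xi>. \<psi> i \<xi> + \<phi> i \<xi>) i \<xi> = resolvent_image \<mu> \<nu> f \<psi> i \<xi> + resolvent_image \<mu> \<nu> f \<phi> i \<xi>"
  unfolding resolvent_image_def resolvent_symbol_def
    partial_deriv_add[OF test_smooth[OF assms(1)] test_smooth[OF assms(2)]]
  by (simp add: algebra_simps sum.distrib)

lemma resolvent_image_cmult:
  assumes "\<And>i. \<psi> i \<in> test_functions"
  shows "resolvent_image \<mu> \<nu> f (\<lambda>i \<xi>. c * \<psi> i \<xi>) i \<xi> = c * resolvent_image \<mu> \<nu> f \<psi> i \<xi>"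
  unfolding resolvent_image_def resolvent_symbol_def partial_deriv_cmult[OF test_smooth[OF assms]]
  by (simp add: algebra_simps sum_distrib_left)

lemma explicit_range_add:
  assumes "a \<in> explicit_range \<mu> \<nu> f" "b \<in> explicit_range \<mu> \<nu> f"
  shows "(\<lambda>x. a x + b x) \<in> explicit_range \<mu> \<nu> f"
proof -
  obtain \<psi> \<phi> where \<psi>: "\<And>i. \<psi> i \<in> test_functions" "\<And>i. is_fourier (resolvent_image \<mu> \<nu> f \<psi> i) (\<lambda>x. a x $ i)"
    and \<phi>: "\<And>i. \<phi> i \<in> test_functions" "\<And>i. is_fourier (resolvent_image \<mu> \<nu> f \<phi> i) (\<lambda>x. b x $ i)"
    and L: "a \<in> L2" "b \<in> L2"
    using assms unfolding explicit_range_def by blast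
  have "is_fourier (resolvent_image \<mu> \<nu> f (\<lambda>i \<xi>. \<psi> i \<xi> + \<phi> i \<xi>) i) (\<lambda>x. (a x + b x) $ i)" for i
    using fourier_add[OF \<psi>(2) \<phi>(2), of i i]
    by (simp add: resolvent_image_add[OF \<psi>(1) \<phi>(1), abs_def])
  moreover have "(\<lambda>\<xi>. \<psi> i \<xi> + \<phi> i \<xi>) \<in> test_functions" for i by (rule test_add[OF \<psi>(1) \<phi>(1)])
  ultimately show ?thesis
    unfolding explicit_range_def mem_Collect_eq
    by (intro conjI L2_add L exI[of _ "\<lambda>i \<xi>. \<psi> i \<xi> + \<phi> i \<xi>"] allI)
qed

lemma explicit_range_cmult:
  assumes "a \<in> explicit_range \<mu> \<nu> f"
  shows "(\<lambda>x. c *s a x) \<in> explicit_range \<mu> \<nu> f"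
proof -
  obtain \<psi> where \<psi>: "\<And>i. \<psi> i \<in> test_functions" "\<And>i. is_fourier (resolvent_image \<mu> \<nu> f \<psi> i) (\<lambda>x. a x $ i)"
    and L: "a \<in> L2"
    using assms unfolding explicit_range_def by blast
  have "is_fourier (resolvent_image \<mu> \<nu> f (\<lambda>i \<xi>. c * \<psi> i \<xi>) i) (\<lambda>x. (c *s a x) $ i)" for i
    using fourier_cmult[OF \<psi>(2), of c i]
    by (simp add: resolvent_image_cmult[OF \<psi>(1), abs_def])
  moreover have "(\<lambda>\<xi>. c * \<psi> i \<xi>) \<in> test_functions" for i by (rule test_cmult[OF \<psi>(1)])
  moreover have "(\<lambda>x. c *s a x) \<in> L2"
    by (rule L2_vecI) (simp add: L2_cmult L2_vec_component[OF L])
  ultimately show ?thesis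
    unfolding explicit_range_def mem_Collect_eq
    by (intro conjI exI[of _ "\<lambda>i \<xi>. c * \<psi> i \<xi>"] allI)
qed

lemma explicit_range_exists:
  assumes \<psi>: "\<And>i. \<psi> i \<in> test_functions"
  obtains h where "h \<in> explicit_range \<mu> \<nu> f" "\<And>i. is_fourier (resolvent_image \<mu> \<nu> f \<psi> i) (\<lambda>x. h x $ i)"
proof -
  have "\<forall>i. \<exists>H. is_fourier (resolvent_image \<mu> \<nu> f \<psi> i) H"
    using fourier_exists[OF resolvent_image_L2[where \<psi> = \<psi>, OF \<psi>]] by blast
  then obtain H where H: "\<And>i. is_fourier (resolvent_image \<mu> \<nu> f \<psi> i) (H i)" by metis
  define h :: "real^3 \<Rightarrow> complex^3" where "h x = (\<chi> i. H i x)" for x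
  have hi: "(\<lambda>x. h x $ i) = H i" for i by (simp add: h_def)
  have hL: "h \<in> L2" by (rule L2_vecI) (simp add: hi fourier_L2(2)[OF H])
  show ?thesis
  proof (rule that)
    show "h \<in> explicit_range \<mu> \<nu> f"
      unfolding explicit_range_def mem_Collect_eq hi
      by (intro conjI hL exI[of _ \<psi>] allI \<psi> H)
    show "is_fourier (resolvent_image \<mu> \<nu> f \<psi> i) (\<lambda>x. h x $ i)" for i unfolding hi by (rule H)
  qed
qed

text \<open>Orthogonality to the images of all fields with a single nonzero component is the weak form of the
  transposed equation for the transform \<open>Q\<close> of the conjugate of \<open>v\<close>. The derivative
  \<open>\<xi>\<^sub>1 \<partial>\<^sub>2\<close> stays on the test function, with the sign that it has in the operator, so that \<open>\<sigma> = -1\<close>.\<close>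

lemma explicit_range_orthogonal:
  assumes \<nu>: "\<nu> > 0" and v: "v \<in> L2"
    and orth: "\<And>h. h \<in> explicit_range \<mu> \<nu> f \<Longrightarrow> (\<integral>x. v x \<bullet> h x \<partial>lborel) = 0"
  shows "AE x in lborel. v x = 0"
proof -
  have cv: "(\<lambda>x. cnj (v x $ i)) \<in> L2" for i by (intro L2_cnj L2_vec_component v)
  then have "\<forall>i. \<exists>Q. is_fourier (\<lambda>x. cnj (v x $ i)) Q" using fourier_exists by blast
  then obtain Q where Q: "\<And>i. is_fourier (\<lambda>x. cnj (v x $ i)) (Q i)" by metis
  note QL = fourier_L2(2)[OF Q]
  have zero: "(\<Sum>i\<in>UNIV. \<integral>x. cnj (v x $ i) * h x $ i \<partial>lborel) = 0" if h: "h \<in> explicit_range \<mu> \<nu> f" for h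
  proof -
    have i: "integrable lborel (\<lambda>x. cnj (v x $ i) * g x $ i)" if "g \<in> explicit_range \<mu> \<nu> f" for g i
      using that by (intro integrable_mult_L2 cv L2_vec_component) (auto simp: explicit_range_def)
    have re: "Re (\<Sum>i\<in>UNIV. \<integral>x. cnj (v x $ i) * g x $ i \<partial>lborel) = 0" if g: "g \<in> explicit_range \<mu> \<nu> f" for g
    proof -
      have "(\<integral>x. v x \<bullet> g x \<partial>lborel) = (\<integral>x. (\<Sum>i\<in>UNIV. Re (cnj (v x $ i) * g x $ i)) \<partial>lborel)"
        unfolding inner_vec_def inner_complex_Re ..
      also have "\<dots> = (\<Sum>i\<in>UNIV. \<integral>x. Re (cnj (v x $ i) * g x $ i) \<partial>lborel)"
        by (intro Bochner_Integration.integral_sum integrable_Re i[OF g])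
      also have "\<dots> = Re (\<Sum>i\<in>UNIV. \<integral>x. cnj (v x $ i) * g x $ i \<partial>lborel)"
        unfolding integral_Re[OF i[OF g]] by simp
      finally show ?thesis using orth[OF g] by simp
    qed
    have "Re (\<Sum>i\<in>UNIV. \<integral>x. cnj (v x $ i) * (\<i> *s h x) $ i \<partial>lborel) = 0"
      by (rule re[OF explicit_range_cmult[OF h]])
    also have "(\<Sum>i\<in>UNIV. \<integral>x. cnj (v x $ i) * (\<i> *s h x) $ i \<partial>lborel) = \<i> * (\<Sum>i\<in>UNIV. \<integral>x. cnj (v x $ i) * h x $ i \<partial>lborel)"
      by (simp add: mult.left_commute sum_distrib_left)
    finally show ?thesis using re[OF h] by (simp add: complex_eq_iff)
  qed
  have Q0: "AE \<xi> in lborel. Q j \<xi> = 0" for j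
  proof (rule shear_diffusion_uniqueness[OF \<nu> disjI2[OF refl] QL, where s = "\<lambda>i k. order0_symbol f k i"])
    fix j :: 3 and \<phi> assume \<phi>: "\<phi> \<in> test_functions"
    define \<psi> where "\<psi> i = (if i = j then \<phi> else (\<lambda>\<xi>. 0))" for i
    have \<psi>: "\<psi> i \<in> test_functions" for i by (simp add: \<psi>_def \<phi> test_zero)
    obtain h where h: "h \<in> explicit_range \<mu> \<nu> f" "\<And>i. is_fourier (resolvent_image \<mu> \<nu> f \<psi> i) (\<lambda>x. h x $ i)"
      by (rule explicit_range_exists[where \<psi> = \<psi> and \<mu> = \<mu> and \<nu> = \<nu> and f = f, OF \<psi>]) blast
    let ?A = "\<lambda>\<xi>. (\<mu> + complex_of_real (\<nu> * (norm \<xi>)\<^sup>2)) * \<phi> \<xi> - complex_of_real (\<xi> $ 1) * partial_deriv 2 \<phi> \<xi>"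
    have img: "resolvent_image \<mu> \<nu> f \<psi> i \<xi> = (if i = j then ?A \<xi> else 0) - order0_symbol f i j \<xi> * \<phi> \<xi>" for i \<xi>
    proof -
      have "(\<Sum>k\<in>UNIV. order0_symbol f i k \<xi> * \<psi> k \<xi>) = (\<Sum>k\<in>UNIV. if k = j then order0_symbol f i k \<xi> * \<phi> \<xi> else 0)"
        by (intro sum.cong) (auto simp: \<psi>_def)
      also have "\<dots> = order0_symbol f i j \<xi> * \<phi> \<xi>" by (simp add: sum.delta)
      finally show ?thesis
        by (simp add: resolvent_image_def resolvent_symbol_def \<psi>_def partial_deriv_const algebra_simps)
    qed
    have iQ: "integrable lborel (\<lambda>\<xi>. Q i \<xi> * resolvent_image \<mu> \<nu> f \<psi> i \<xi>)" for i
      by (intro integrable_mult_L2 QL resolvent_image_L2 \<psi>)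
    have "0 = (\<Sum>i\<in>UNIV. \<integral>\<xi>. Q i \<xi> * resolvent_image \<mu> \<nu> f \<psi> i \<xi> \<partial>lborel)"
      using zero[OF h(1)] unfolding fourier_pairing[OF Q h(2)] by simp
    also have "\<dots> = (\<integral>\<xi>. (\<Sum>i\<in>UNIV. Q i \<xi> * resolvent_image \<mu> \<nu> f \<psi> i \<xi>) \<partial>lborel)"
      by (rule Bochner_Integration.integral_sum[symmetric]) (rule iQ)
    also have "\<dots> = (\<integral>\<xi>. ((\<mu> + complex_of_real (\<nu> * (norm \<xi>)\<^sup>2)) * Q j \<xi> - (\<Sum>i\<in>UNIV. order0_symbol f i j \<xi> * Q i \<xi>)) * \<phi> \<xi>
        - Q j \<xi> * (complex_of_real (\<xi> $ 1) * partial_deriv 2 \<phi> \<xi>) \<partial>lborel)"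
    proof (rule Bochner_Integration.integral_cong[OF refl])
      fix \<xi>
      have "(\<Sum>i\<in>UNIV. Q i \<xi> * resolvent_image \<mu> \<nu> f \<psi> i \<xi>)
          = (\<Sum>i\<in>UNIV. if i = j then Q i \<xi> * ?A \<xi> else 0) - (\<Sum>i\<in>UNIV. order0_symbol f i j \<xi> * Q i \<xi>) * \<phi> \<xi>"
        unfolding img sum_subtractf[symmetric] sum_distrib_right
        by (intro sum.cong) (auto simp: algebra_simps)
      also have "(\<Sum>i\<in>UNIV. if i = j then Q i \<xi> * ?A \<xi> else 0) = Q j \<xi> * ?A \<xi>" by (simp add: sum.delta)
      finally show "(\<Sum>i\<in>UNIV. Q i \<xi> * resolvent_image \<mu> \<nu> f \<psi> i \<xi>)
          = ((\<mu> + complex_of_real (\<nu> * (norm \<xi>)\<^sup>2)) * Q j \<xi> - (\<Sum>i\<in>UNIV. order0_symbol f i j \<xi> * Q i \<xi>)) * \<phi> \<xi>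
            - Q j \<xi> * (complex_of_real (\<xi> $ 1) * partial_deriv 2 \<phi> \<xi>)"
        by (simp add: algebra_simps)
    qed
    also have "\<dots> = (\<integral>\<xi>. ((\<mu> + complex_of_real (\<nu> * (norm \<xi>)\<^sup>2)) * Q j \<xi> - (\<Sum>i\<in>UNIV. order0_symbol f i j \<xi> * Q i \<xi>)) * \<phi> \<xi> \<partial>lborel)
        - (\<integral>\<xi>. Q j \<xi> * (complex_of_real (\<xi> $ 1) * partial_deriv 2 \<phi> \<xi>) \<partial>lborel)"
    proof (rule Bochner_Integration.integral_diff)
      have Z: "(\<lambda>\<xi>. \<Sum>i\<in>UNIV. order0_symbol f i j \<xi> * Q i \<xi>) \<in> L2"
        by (intro L2_sum L2_mult_bounded[OF QL order0_symbol_measurable order0_symbol_bounded])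
      have "integrable lborel (\<lambda>\<xi>. \<mu> * (Q j \<xi> * \<phi> \<xi>) + complex_of_real \<nu> * (Q j \<xi> * (complex_of_real ((norm \<xi>)\<^sup>2) * \<phi> \<xi>))
          - (\<Sum>i\<in>UNIV. order0_symbol f i j \<xi> * Q i \<xi>) * \<phi> \<xi>)"
        by (intro Bochner_Integration.integrable_diff Bochner_Integration.integrable_add integrable_mult_right
            integrable_mult_L2[OF QL test_L2[OF \<phi>]] integrable_norm_power2_pairing[OF QL \<phi>]
            integrable_mult_L2[OF Z test_L2[OF \<phi>]])
      then show "integrable lborel (\<lambda>\<xi>. ((\<mu> + complex_of_real (\<nu> * (norm \<xi>)\<^sup>2)) * Q j \<xi> - (\<Sum>i\<in>UNIV. order0_symbol f i j \<xi> * Q i \<xi>)) * \<phi> \<xi>)"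
        by (simp add: algebra_simps)
    qed (intro integrable_mult_L2 QL test_L2 test_shear_derivative \<phi>)
    finally show "(\<integral>\<xi>. Q j \<xi> * (complex_of_real (\<xi> $ 1) * partial_deriv 2 \<phi> \<xi>) \<partial>lborel) = - complex_of_real (- 1) *
        (\<integral>\<xi>. ((\<mu> + complex_of_real (\<nu> * (norm \<xi>)\<^sup>2)) * Q j \<xi> - (\<Sum>k\<in>UNIV. order0_symbol f k j \<xi> * Q k \<xi>)) * \<phi> \<xi> \<partial>lborel)"
      by simp
  qed (rule order0_symbol_measurable order0_symbol_bounded)+
  have "is_fourier (\<lambda>x. 0) (\<lambda>\<xi>. 0)" using fourier_cmult[OF Q, of 0 1] by simp
  then have "AE x in lborel. cnj (v x $ i) = 0" for i
    by (rule fourier_inj[OF Q _ Q0])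
  then have "AE x in lborel. \<forall>i\<in>UNIV. cnj (v x $ i) = 0" by (intro AE_finite_allI) auto
  then show ?thesis by eventually_elim (simp add: vec_eq_iff)
qed

lemma shifted_Lop_dense_range:
  assumes \<nu>: "\<nu> > 0"
  shows "L2_dense (L2_range Ldom (shifted \<mu> (Lop f \<nu>)))"
  unfolding L2_dense_def
proof (intro ballI allI impI)
  fix g :: "real^3 \<Rightarrow> complex^3" and e :: real
  assume g: "g \<in> L2" and e: "e > 0"
  let ?S = "explicit_range \<mu> \<nu> f"
  have sub: "?S \<subseteq> L2_range Ldom (shifted \<mu> (Lop f \<nu>))"
    unfolding explicit_range_def using resolvent_image_in_range by blast
  have sc: "(\<lambda>x. c *\<^sub>R a x) \<in> ?S" if "a \<in> ?S" for a c
  proof -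
    have "c *\<^sub>R a x = complex_of_real c *s a x" for x
      by (simp add: vec_eq_iff scaleR_conv_of_real[where 'a = complex])
    then show ?thesis using explicit_range_cmult[OF that, of "complex_of_real c"] by simp
  qed
  obtain h0 where "h0 \<in> ?S" using explicit_range_exists[of "\<lambda>i \<xi>. 0"] test_zero by blast
  then have ne: "?S \<noteq> {}" by blast
  have SL: "?S \<subseteq> L2" by (auto simp: explicit_range_def)
  show "\<exists>h\<in>L2_range Ldom (shifted \<mu> (Lop f \<nu>)). L2_norm (\<lambda>x. h x - g x) < e"
  proof (rule ccontr)
    assume "\<not> ?thesis"
    then have far: "\<And>h. h \<in> ?S \<Longrightarrow> L2_norm (\<lambda>x. h x - g x) \<ge> e" using sub by force
    obtain v where "v \<in> L2" "\<And>h. h \<in> ?S \<Longrightarrow> (\<integral>x. v x \<bullet> h x \<partial>lborel) = 0" "\<not> (AE x in lborel. v x = 0)"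
      using L2_orthogonal_complement[OF SL ne explicit_range_add sc g e far] by blast
    then show False using explicit_range_orthogonal[OF \<nu>] by blast
  qed
qed

theorem lemma3p3:
  fixes f \<nu> :: real
  assumes "f > 0" and "\<nu> > 0"
  shows "\<forall>\<mu>\<in>L2_spectrum Ldom (Lop f \<nu>).
           L2_injective Ldom (shifted \<mu> (Lop f \<nu>)) \<and>
           L2_dense (L2_range Ldom (shifted \<mu> (Lop f \<nu>)))"
  using shifted_Lop_injective[OF assms(2)] shifted_Lop_dense_range[OF assms(2)] by blast

end
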